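(* For any positive integer $T$ and $\epsilon>0$, there is a polynomial-time reduction from an instance $(D=(V,A),l_A,w_{\mathsf{GMD}})$ of Generalized Max-Dicut($T$) in which $D$ is acyclic and $\mathsf{ndeg}\ge\frac1\epsilon$ to an instance $(G,b,w_{\mathsf{GP}})$ of Graph Pricing such that \[\mathsf{Opt}(D,l_A,w_{\mathsf{GMD}})\le\mathsf{Opt}(G,b,w_{\mathsf{GP}})\le\mathsf{Opt}(D,l_A,w_{\mathsf{GMD}})+3\epsilon.\]
   Context: Generalized Max-Dicut($T$): an instance is a directed graph $D=(V,A)$ with edge labels $l_A:A\to\{1,\dots,T\}$ and weights $w_{\mathsf{GMD}}:A\to\mathbb{R}^+$ summing to $1$; a labeling $l_V:V\to\{0,\dots,T\}$ satisfies $(u,v)$ iff $l_V(u)=0$ and $l_V(v)=l_A(u,v)$; $\mathsf{Opt}(D,l_A,w_{\mathsf{GMD}})$ is the maximum weight of satisfied edges. The normalized outdegree is $\mathsf{ndeg}=\big[\sum_{u\in V}\max_{(u,v)\in A}w_{\mathsf{GMD}}(u,v)\big]^{-1}$. Graph Pricing: an instance is an undirected graph $G=(V,E)$ (parallel edges allowed) with budgets $b:E\to\mathbb{R}^+$ and weights $w_{\mathsf{GP}}:E\to\mathbb{R}^+$; a pricing $p:V\to\mathbb{R}^+\cup\{0\}$ has value $\sum_{e=(u,v)}w_{\mathsf{GP}}(e)(p(u)+p(v))\mathbb{I}[p(u)+p(v)\le b(e)]$, and $\mathsf{Opt}(G,b,w_{\mathsf{GP}})$ is the maximum value.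
   Formalization: The reduction is a Turing machine on binary encodings, so the weights of the Generalized Max-Dicut instance are taken to be rational (fractions in binary) instead of arbitrary positive reals, for which polynomial time in the input length is undefined. *)

theory Defs
  imports
    "HOL-Analysis.Function_Topology"
    "HOL-Computational_Algebra.Polynomial"
    "Graph_Theory.Pair_Digraph"
begin

section \<open>Generalized Max-Dicut\<close>

text \<open>An arc is the pair of its endpoints; parallel arcs are not possible.\<close>

definition gmd_instance ::
  "nat \<Rightarrow> 'v pair_pre_digraph \<Rightarrow> ('v \<times> 'v \<Rightarrow> nat) \<Rightarrow> ('v \<times> 'v \<Rightarrow> real) \<Rightarrow> bool"
where
  "gmd_instance T D l w \<longleftrightarrow>
     pair_fin_digraph D \<and>
     (\<forall>e\<in>parcs D. l e \<in> {1..T}) \<and>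
     (\<forall>e\<in>parcs D. w e > 0) \<and>
     (\<Sum>e\<in>parcs D. w e) = 1"

definition gmd_satisfied ::
  "'v pair_pre_digraph \<Rightarrow> ('v \<times> 'v \<Rightarrow> nat) \<Rightarrow> ('v \<Rightarrow> nat) \<Rightarrow> ('v \<times> 'v) set"
where
  "gmd_satisfied D l lv = {(u, v) \<in> parcs D. lv u = 0 \<and> lv v = l (u, v)}"

definition gmd_opt ::
  "nat \<Rightarrow> 'v pair_pre_digraph \<Rightarrow> ('v \<times> 'v \<Rightarrow> nat) \<Rightarrow> ('v \<times> 'v \<Rightarrow> real) \<Rightarrow> real"
where
  "gmd_opt T D l w =
     Max ((\<lambda>lv. \<Sum>e\<in>gmd_satisfied D l lv. w e) ` (pverts D \<rightarrow>\<^sub>E {0..T}))"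

text \<open>The inserted 0 makes vertices without outgoing arcs contribute nothing; it is
  irrelevant for all other vertices because weights are positive.\<close>

definition ndeg :: "'v pair_pre_digraph \<Rightarrow> ('v \<times> 'v \<Rightarrow> real) \<Rightarrow> real" where
  "ndeg D w = inverse (\<Sum>u\<in>pverts D. Max (insert 0 {w (u, v) | v. (u, v) \<in> parcs D}))"


section \<open>Graph Pricing\<close>

record ('v, 'e) multigraph =
  mverts :: "'v set"
  medges :: "'e set"
  ends :: "'e \<Rightarrow> 'v set"

definition gp_instance ::
  "('v, 'e) multigraph \<Rightarrow> ('e \<Rightarrow> real) \<Rightarrow> ('e \<Rightarrow> real) \<Rightarrow> bool"
where
  "gp_instance G b w \<longleftrightarrow>
     finite (mverts G) \<and> finite (medges G) \<and>
     (\<forall>e\<in>medges G. ends G e \<subseteq> mverts G \<and> card (ends G e) = 2) \<and>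
     (\<forall>e\<in>medges G. b e > 0 \<and> w e > 0)"

definition pricings :: "('v, 'e) multigraph \<Rightarrow> ('v \<Rightarrow> real) set" where
  "pricings G = {p. \<forall>v\<in>mverts G. p v \<ge> 0}"

definition edge_price :: "('v, 'e) multigraph \<Rightarrow> ('v \<Rightarrow> real) \<Rightarrow> 'e \<Rightarrow> real" where
  "edge_price G p e = (\<Sum>v\<in>ends G e. p v)"

definition gp_value ::
  "('v, 'e) multigraph \<Rightarrow> ('e \<Rightarrow> real) \<Rightarrow> ('e \<Rightarrow> real) \<Rightarrow> ('v \<Rightarrow> real) \<Rightarrow> real"
where
  "gp_value G b w p =
     (\<Sum>e\<in>medges G. w e * edge_price G p e * of_bool (edge_price G p e \<le> b e))"

text \<open>The set of pricings is infinite, so the maximum is written as a supremum.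
  Lemma \<open>gp_opt_attained\<close> below shows that it is a maximum.\<close>

definition gp_opt ::
  "('v, 'e) multigraph \<Rightarrow> ('e \<Rightarrow> real) \<Rightarrow> ('e \<Rightarrow> real) \<Rightarrow> real"
where
  "gp_opt G b w = (SUP p\<in>pricings G. gp_value G b w p)"

lemma edge_price_nonneg:
  assumes "gp_instance G b w" "p \<in> pricings G" "e \<in> medges G"
  shows "edge_price G p e \<ge> 0"
  using assms unfolding gp_instance_def pricings_def edge_price_def
  by (auto intro!: sum_nonneg)

lemma gp_value_attains_max:
  assumes inst: "gp_instance G b w"
  obtains p where "p \<in> pricings G" "\<And>q. q \<in> pricings G \<Longrightarrow> gp_value G b w q \<le> gp_value G b w p"
proof -
  define B where "B = (\<Sum>e\<in>medges G. b e)"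
  define U where "U = (\<Union>e\<in>medges G. ends G e)"
  define K where "K = Pi\<^sub>E UNIV (\<lambda>v. if v \<in> U then {0..B} else {0::real})"
  define P where "P S = K \<inter> {p. \<forall>e\<in>S. edge_price G p e \<le> b e}" for S
  define val where "val S p = (\<Sum>e\<in>S. w e * edge_price G p e)" for S p
  have fin: "finite (medges G)" "\<And>e. e \<in> medges G \<Longrightarrow> finite (ends G e)"
    and bpos: "\<And>e. e \<in> medges G \<Longrightarrow> b e > 0" and wpos: "\<And>e. e \<in> medges G \<Longrightarrow> w e > 0"
    using inst unfolding gp_instance_def by (auto intro: finite_subset)
  have cont: "continuous_on UNIV (\<lambda>p. edge_price G p e)" for e
    unfolding edge_price_def by (intro continuous_intros continuous_on_product_coordinates)
  have "compact K"
  proof -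
    have "compactin (product_topology (\<lambda>_. euclidean) UNIV) K"
      unfolding K_def compactin_PiE by auto
    then show ?thesis
      by (simp add: euclidean_product_topology)
  qed
  have compact: "compact (P S)" for S
  proof -
    have "closed {p. edge_price G p e \<le> b e}" for e
      by (intro closed_Collect_le cont continuous_on_const)
    then have "closed (\<Inter>e\<in>S. {p. edge_price G p e \<le> b e})"
      by blast
    moreover have "(\<Inter>e\<in>S. {p. edge_price G p e \<le> b e}) = {p. \<forall>e\<in>S. edge_price G p e \<le> b e}"
      by auto
    ultimately show ?thesis
      unfolding P_def using \<open>compact K\<close> compact_Int_closed by metis
  qed
  have B0: "B \<ge> 0"
    unfolding B_def using bpos by (intro sum_nonneg less_imp_le) auto
  have ne: "P S \<noteq> {}" if "S \<subseteq> medges G" for S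
  proof -
    have "(\<lambda>_. 0) \<in> P S"
      using that bpos B0 unfolding P_def K_def edge_price_def by (auto intro: less_imp_le)
    then show ?thesis by blast
  qed
  have "\<exists>p\<in>P S. \<forall>q\<in>P S. val S q \<le> val S p" if "S \<subseteq> medges G" for S
  proof (rule continuous_attains_sup[OF compact ne[OF that]])
    show "continuous_on (P S) (val S)"
      unfolding val_def using cont
      by (intro continuous_intros continuous_on_subset[OF cont]) auto
  qed
  then obtain best where best: "\<And>S. S \<subseteq> medges G \<Longrightarrow> best S \<in> P S"
      "\<And>S q. S \<subseteq> medges G \<Longrightarrow> q \<in> P S \<Longrightarrow> val S q \<le> val S (best S)"
    by metis
  have KP: "K \<subseteq> pricings G"
    unfolding K_def pricings_def by (auto simp: PiE_iff split: if_splits) (smt (verit, best))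
  have val_le: "val S p \<le> gp_value G b w p" if "S \<subseteq> medges G" "p \<in> P S" for S p
  proof -
    have p: "p \<in> pricings G" using that KP unfolding P_def by auto
    have "val S p = (\<Sum>e\<in>S. w e * edge_price G p e * of_bool (edge_price G p e \<le> b e))"
      unfolding val_def using that by (intro sum.cong) (auto simp: P_def)
    also have "\<dots> \<le> gp_value G b w p"
      unfolding gp_value_def using that fin(1) edge_price_nonneg[OF inst p] wpos
      by (intro sum_mono2) (auto simp: less_imp_le)
    finally show ?thesis .
  qed
  have le_val: "\<exists>S\<subseteq>medges G. gp_value G b w q \<le> val S (best S)" if q: "q \<in> pricings G" for q
  proof -
    define S where "S = {e \<in> medges G. edge_price G q e \<le> b e}"
    define q' where "q' v = (if v \<in> (\<Union>e\<in>S. ends G e) then q v else 0)" for v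
    have S: "S \<subseteq> medges G" unfolding S_def by auto
    have same: "edge_price G q' e = edge_price G q e" if "e \<in> S" for e
      unfolding edge_price_def q'_def using that by (intro sum.cong) auto
    have q0: "q v \<ge> 0" if "e \<in> medges G" "v \<in> ends G e" for e v
      using that q inst unfolding pricings_def gp_instance_def by auto
    have "q v \<le> B" if "e \<in> S" "v \<in> ends G e" for e v
    proof -
      have e: "e \<in> medges G" using that S by auto
      have "q v \<le> edge_price G q e"
        unfolding edge_price_def using that fin(2)[OF e] q0[OF e]
        by (intro member_le_sum) auto
      also have "\<dots> \<le> b e" using that unfolding S_def by auto
      also have "\<dots> \<le> B" unfolding B_def using e fin(1) bpos
        by (intro member_le_sum) (auto intro: less_imp_le)
      finally show ?thesis .
    qed
    then have "q' \<in> K"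
      unfolding K_def q'_def U_def using q0 S B0 by (auto simp: PiE_iff)
    then have "q' \<in> P S"
      unfolding P_def using same by (auto simp: S_def)
    moreover have "gp_value G b w q = val S q'"
    proof -
      have "gp_value G b w q = (\<Sum>e\<in>S. w e * edge_price G q e)"
        unfolding gp_value_def S_def using fin(1) by (intro sum.mono_neutral_cong_right) auto
      then show ?thesis unfolding val_def using same by (simp cong: sum.cong)
    qed
    ultimately show ?thesis using S best(2) by metis
  qed
  define m where "m = Max ((\<lambda>S. val S (best S)) ` Pow (medges G))"
  have "m \<in> (\<lambda>S. val S (best S)) ` Pow (medges G)"
    unfolding m_def using fin(1) by (intro Max_in) auto
  then obtain S where S: "S \<subseteq> medges G" "m = val S (best S)" by auto
  have mmax: "val S' (best S') \<le> m" if "S' \<subseteq> medges G" for S'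
    unfolding m_def using that fin(1) by (intro Max_ge) auto
  show thesis
  proof (rule that[of "best S"])
    show "best S \<in> pricings G" using best(1)[OF S(1)] KP unfolding P_def by auto
    fix q assume "q \<in> pricings G"
    then obtain S' where "S' \<subseteq> medges G" "gp_value G b w q \<le> val S' (best S')"
      using le_val by blast
    then have "gp_value G b w q \<le> m" using mmax order_trans by blast
    also have "m \<le> gp_value G b w (best S)"
      using val_le[OF S(1) best(1)[OF S(1)]] S(2) by simp
    finally show "gp_value G b w q \<le> gp_value G b w (best S)" .
  qed
qed

lemma gp_opt_attained:
  assumes "gp_instance G b w"
  shows "\<exists>p\<in>pricings G. gp_value G b w p = gp_opt G b w \<and>
           (\<forall>q\<in>pricings G. gp_value G b w q \<le> gp_value G b w p)"
proof -
  obtain p where p: "p \<in> pricings G"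
      "\<And>q. q \<in> pricings G \<Longrightarrow> gp_value G b w q \<le> gp_value G b w p"
    using gp_value_attains_max[OF assms] by blast
  have "gp_opt G b w = gp_value G b w p"
    unfolding gp_opt_def using p by (intro cSup_eq_maximum) auto
  then show ?thesis using p by auto
qed


section \<open>Polynomial-time functions on binary words\<close>

text \<open>Deterministic Turing machines with finitely many two-way infinite tapes. A tape is its
  cell contents together with the head position. Symbol 0 is the blank, symbols 1 and 2 stand
  for the input letters \<open>False\<close> and \<open>True\<close>; further work symbols are allowed. The initial
  state is 0, and every state from \<open>num_states\<close> on is a halting state. The transition function
  takes the state and the scanned symbols to the next state and, for each tape, the symbol
  written and the head movement.\<close>

type_synonym tape = "(int \<Rightarrow> nat) \<times> int"
type_synonym config = "nat \<times> tape list"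

record machine =
  num_tapes :: nat
  num_states :: nat
  num_symbols :: nat
  delta :: "nat \<Rightarrow> nat list \<Rightarrow> nat \<times> (nat \<times> int) list"

definition turing_machine :: "machine \<Rightarrow> bool" where
  "turing_machine M \<longleftrightarrow>
     num_tapes M \<ge> 1 \<and> num_symbols M \<ge> 3 \<and>
     (\<forall>q<num_states M. \<forall>syms. length syms = num_tapes M \<and> set syms \<subseteq> {..<num_symbols M} \<longrightarrow>
        (case delta M q syms of (q', acts) \<Rightarrow>
           q' \<le> num_states M \<and> length acts = num_tapes M \<and>
           set acts \<subseteq> {..<num_symbols M} \<times> {-1, 0, 1}))"

definition halted :: "machine \<Rightarrow> config \<Rightarrow> bool" where
  "halted M c \<longleftrightarrow> fst c \<ge> num_states M"

definition act :: "nat \<times> int \<Rightarrow> tape \<Rightarrow> tape" where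
  "act a t = ((fst t)(snd t := fst a), snd t + snd a)"

definition step :: "machine \<Rightarrow> config \<Rightarrow> config" where
  "step M c =
     (if halted M c then c
      else case delta M (fst c) (map (\<lambda>(cells, h). cells h) (snd c)) of
             (q', acts) \<Rightarrow> (q', map2 act acts (snd c)))"

definition word_cells :: "bool list \<Rightarrow> int \<Rightarrow> nat" where
  "word_cells x i =
     (if 0 \<le> i \<and> i < int (length x) then (if x ! nat i then 2 else 1) else 0)"

definition start :: "machine \<Rightarrow> bool list \<Rightarrow> config" where
  "start M x = (0, (word_cells x, 0) # replicate (num_tapes M - 1) (\<lambda>_. 0, 0))"

text \<open>Input and output are both on the first tape.\<close>

definition polytime :: "(bool list \<Rightarrow> bool list) \<Rightarrow> bool" where
  "polytime f \<longleftrightarrow>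
     (\<exists>M (p :: nat poly). turing_machine M \<and>
        (\<forall>x. \<exists>n \<le> poly p (length x).
           halted M ((step M ^^ n) (start M x)) \<and>
           fst (hd (snd ((step M ^^ n) (start M x)))) = word_cells (f x)))"


section \<open>Binary encodings of instances\<close>

text \<open>Lists are encoded by putting \<open>True\<close> before every element and \<open>False\<close> at the end; thus,
  when the encoding of elements is self-delimiting, so is that of lists. Natural numbers are
  encoded by their binary digits, least significant first and without leading zeros.\<close>

definition enc_list :: "('a \<Rightarrow> bool list) \<Rightarrow> 'a list \<Rightarrow> bool list" where
  "enc_list enc xs = concat (map (\<lambda>x. True # enc x) xs) @ [False]"

fun binary :: "nat \<Rightarrow> bool list" where
  "binary n = (if n = 0 then [] else odd n # binary (n div 2))"

declare binary.simps [simp del]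

definition enc_nat :: "nat \<Rightarrow> bool list" where
  "enc_nat n = enc_list (\<lambda>b. [b]) (binary n)"

text \<open>Weights and budgets are given as fractions of natural numbers, not necessarily in lowest
  terms. Consequently, only instances with rational weights and budgets have encodings.\<close>

definition fraction :: "nat \<times> nat \<Rightarrow> real \<Rightarrow> bool" where
  "fraction q r \<longleftrightarrow> snd q > 0 \<and> r = real (fst q) / real (snd q)"

definition enc_frac :: "nat \<times> nat \<Rightarrow> bool list" where
  "enc_frac q = enc_nat (fst q) @ enc_nat (snd q)"

text \<open>The vertices and the arcs or edges may be listed in any order.\<close>

definition encodes_gmd ::
  "bool list \<Rightarrow> nat pair_pre_digraph \<Rightarrow> (nat \<times> nat \<Rightarrow> nat) \<Rightarrow> (nat \<times> nat \<Rightarrow> real) \<Rightarrow> bool"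
where
  "encodes_gmd s D l w \<longleftrightarrow>
     (\<exists>vs as wq.
        distinct vs \<and> set vs = pverts D \<and> distinct as \<and> set as = parcs D \<and>
        (\<forall>e\<in>parcs D. fraction (wq e) (w e)) \<and>
        s = enc_list enc_nat vs @
            enc_list (\<lambda>e. enc_nat (fst e) @ enc_nat (snd e) @ enc_nat (l e) @ enc_frac (wq e)) as)"

text \<open>The edges of a multigraph are anonymous: the encoding does not contain their names, just
  their endpoints, budgets and weights.\<close>

definition encodes_gp ::
  "bool list \<Rightarrow> (nat, 'e) multigraph \<Rightarrow> ('e \<Rightarrow> real) \<Rightarrow> ('e \<Rightarrow> real) \<Rightarrow> bool"
where
  "encodes_gp s G b w \<longleftrightarrow>
     (\<exists>vs es u v bq wq.
        distinct vs \<and> set vs = mverts G \<and> distinct es \<and> set es = medges G \<and>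
        (\<forall>e\<in>medges G. ends G e = {u e, v e} \<and> fraction (bq e) (b e) \<and> fraction (wq e) (w e)) \<and>
        s = enc_list enc_nat vs @
            enc_list (\<lambda>e. enc_nat (u e) @ enc_nat (v e) @ enc_frac (bq e) @ enc_frac (wq e)) es)"

end

theory Submission
  imports Defs
begin

text \<open>An arc \<open>(u, v)\<close> with label \<open>i\<close> becomes an edge with budget \<open>2^(K (i + T r(v)))\<close> and weight
  \<open>w(u, v)\<close> divided by the budget, where \<open>2^K \<ge> 1/\<epsilon>\<close> and \<open>r\<close> ranks the heads of arcs, sinks first and
  injectively. Then \<open>T\<close> prices at a vertex correspond to its nonzero labels, and the other prices are
  rounded. The price of the tail of an arc within its budget is below the scale of the tail, so that
  the tail gets label 0. Hence the share of the heads in the value exceeds the satisfied weight by at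
  most \<open>2^(-K)\<close>. The share of a tail is at most twice the largest weight of its outgoing arcs, since
  the budgets of these arcs are distinct powers of 2; in total this is at most \<open>2 \<epsilon>\<close>, by the bound on
  the normalized outdegree.

  For the Turing machine, the powers of 2 are harmless: multiplying by \<open>2^n\<close> puts \<open>n\<close> zeros in front
  of the binary digits, so only unary exponents have to be computed. A machine that takes any arc
  and walks along arcs for as many passes over the arc list as there are arcs arrives at a vertex
  without outgoing arcs. It then emits and deletes the arcs into this vertex, and increases the
  rank. The machine is compiled from a program over stacks; a tape represents a stack.\<close>

section \<open>Stack programs and their compilation\<close>

text \<open>The budgets obey three demands. Consecutive labels of a head are a factor
  \<open>2^K\<close> apart, so that a price meant for a lower label earns at most an \<epsilon>
  fraction of the weight. The budgets of the arcs out of \<open>u\<close> must not exceed the scale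
  \<open>2^(K T r(u))\<close> on which the labels of \<open>u\<close> begin, and acyclicity provides
  ranks with this property. The budgets of the arcs out of one vertex must be distinct, hence the
  injectivity. Of the constant 3, two parts pay for a geometric series at the tails and one for the
  rounding at the heads. The numbers are exponentially large but have polynomially many digits,
  because ranks stay below the number of arcs and \<open>T\<close> and \<open>K\<close> are fixed.

  The shape of the machine comes from the demand that it halt in polynomial time on every word,
  including malformed ones and graphs with cycles. Hence a clock ends the walk, the decoders are
  total, and only \<open>T\<close> digits of a label are evaluated. Whatever the input, the walk
  ends in the head of a remaining arc, so that each round deletes an arc.\<close>

type_synonym stacks = "nat list list"

fun top_sym :: "nat list \<Rightarrow> nat" where
  "top_sym [] = 0"
| "top_sym (a # l) = a"

text \<open>Guards are arbitrary predicates on the top symbols, because a transition function may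
  depend on these arbitrarily. \<open>Copy\<close> pushes whatever symbol is read, which spares a
  case distinction over the alphabet.\<close>

datatype com =
    Push nat nat
  | Copy nat nat
  | Pop nat
  | Seq com com (infixr ";;" 60)
  | Cond "nat list \<Rightarrow> bool" com com
  | Loop "nat list \<Rightarrow> bool" com

text \<open>The times are those of the compiled code. Only nonblank symbols are pushed, so that
  reading 0 means an empty stack. \<open>Pop\<close> on an empty stack does nothing; this happens
  when a malformed input breaks off.\<close>

inductive exec :: "com \<Rightarrow> stacks \<Rightarrow> nat \<Rightarrow> stacks \<Rightarrow> bool" where
  Push: "i < length s \<Longrightarrow> a \<noteq> 0 \<Longrightarrow> exec (Push i a) s 2 (s[i := a # s ! i])"
| Copy: "i < length s \<Longrightarrow> j < length s \<Longrightarrow> i \<noteq> j \<Longrightarrow> top_sym (s ! i) \<noteq> 0 \<Longrightarrow>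
    exec (Copy i j) s 2 (s[j := top_sym (s ! i) # s ! j])"
| Pop: "i < length s \<Longrightarrow> s ! i = [] \<or> top_sym (s ! i) \<noteq> 0 \<Longrightarrow> exec (Pop i) s 1 (s[i := tl (s ! i)])"
| Seq: "exec c s m s1 \<Longrightarrow> exec d s1 n s2 \<Longrightarrow> exec (c ;; d) s (m + n) s2"
| CondT: "P (map top_sym s) \<Longrightarrow> exec c s n s1 \<Longrightarrow> exec (Cond P c d) s (Suc n) s1"
| CondF: "\<not> P (map top_sym s) \<Longrightarrow> exec d s n s1 \<Longrightarrow> exec (Cond P c d) s (Suc n) s1"
| LoopF: "\<not> P (map top_sym s) \<Longrightarrow> exec (Loop P c) s 1 s"
| LoopT: "P (map top_sym s) \<Longrightarrow> exec c s m s1 \<Longrightarrow> exec (Loop P c) s1 n s2 \<Longrightarrow>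
    exec (Loop P c) s (Suc (m + n)) s2"

fun wf_com :: "nat \<Rightarrow> nat \<Rightarrow> com \<Rightarrow> bool" where
  "wf_com k m (Push i a) \<longleftrightarrow> i < k \<and> a < m"
| "wf_com k m (Copy i j) \<longleftrightarrow> i < k \<and> j < k"
| "wf_com k m (Pop i) \<longleftrightarrow> i < k"
| "wf_com k m (c ;; d) \<longleftrightarrow> wf_com k m c \<and> wf_com k m d"
| "wf_com k m (Cond P c d) \<longleftrightarrow> wf_com k m c \<and> wf_com k m d"
| "wf_com k m (Loop P c) \<longleftrightarrow> wf_com k m c"

text \<open>A program owns the states below \<open>nstates\<close>, is entered in state 0 and is
  left in state \<open>nstates\<close> itself. In a sequence the exit of the first part thus
  coincides with the entry of the second.\<close>

fun nstates :: "com \<Rightarrow> nat" where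
  "nstates (Push i a) = 2"
| "nstates (Copy i j) = 2"
| "nstates (Pop i) = 1"
| "nstates (c ;; d) = nstates c + nstates d"
| "nstates (Cond P c d) = Suc (nstates c + nstates d)"
| "nstates (Loop P c) = Suc (nstates c)"

definition stay :: "nat list \<Rightarrow> (nat \<times> int) list" where
  "stay syms = map (\<lambda>a. (a, 0)) syms"

text \<open>A pushing command first moves the head and only then writes, because a step of the
  machine writes before it moves.\<close>

fun com_delta :: "com \<Rightarrow> nat \<Rightarrow> nat list \<Rightarrow> nat \<times> (nat \<times> int) list" where
  "com_delta (Push i a) q syms =
     (if q = 0 then (1, (stay syms)[i := (syms ! i, 1)]) else (2, (stay syms)[i := (a, 0)]))"
| "com_delta (Copy i j) q syms =
     (if q = 0 then (1, (stay syms)[j := (syms ! j, 1)]) else (2, (stay syms)[j := (syms ! i, 0)]))"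
| "com_delta (Pop i) q syms = (1, if syms ! i = 0 then stay syms else (stay syms)[i := (0, -1)])"
| "com_delta (c ;; d) q syms =
     (if q < nstates c then com_delta c q syms
      else apfst (\<lambda>q'. q' + nstates c) (com_delta d (q - nstates c) syms))"
| "com_delta (Cond P c d) q syms =
     (if q = 0 then (if P syms then 1 else Suc (nstates c), stay syms)
      else if q < Suc (nstates c) then
        apfst (\<lambda>q'. if q' < nstates c then Suc q' else Suc (nstates c + nstates d)) (com_delta c (q - 1) syms)
      else apfst (\<lambda>q'. q' + Suc (nstates c)) (com_delta d (q - Suc (nstates c)) syms))"
| "com_delta (Loop P c) q syms =
     (if q = 0 then (if P syms then 1 else Suc (nstates c), stay syms)
      else apfst (\<lambda>q'. if q' < nstates c then Suc q' else 0) (com_delta c (q - 1) syms))"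

lemma nstates_pos: "nstates c > 0"
  by (induction c) auto

lemma com_delta_valid:
  assumes "wf_com k m c" "q < nstates c" "length syms = k" "set syms \<subseteq> {..<m}" "m > 0"
    "com_delta c q syms = (q', acts)"
  shows "q' \<le> nstates c \<and> length acts = k \<and> set acts \<subseteq> {..<m} \<times> {-1, 0, 1}"
  using assms
proof (induction c arbitrary: q q')
  case (Push i a)
  moreover have "syms ! i < m" using Push by (metis lessThan_iff nth_mem subsetD wf_com.simps(1))
  ultimately show ?case
    by (auto simp: stay_def split: if_splits dest!: subsetD[OF set_update_subset_insert])
next
  case (Copy i j)
  moreover have "syms ! i < m" "syms ! j < m"
    using Copy by (metis lessThan_iff nth_mem subsetD wf_com.simps(2))+
  ultimately show ?case
    by (auto simp: stay_def split: if_splits dest!: subsetD[OF set_update_subset_insert])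
next
  case (Pop i)
  then show ?case
    by (auto simp: stay_def split: if_splits dest!: subsetD[OF set_update_subset_insert])
next
  case (Seq c d)
  show ?case
  proof (cases "q < nstates c")
    case True
    then show ?thesis using Seq.IH(1)[of q q'] Seq.prems by auto
  next
    case False
    then obtain q1 where "com_delta d (q - nstates c) syms = (q1, acts)" "q' = q1 + nstates c"
      using Seq.prems by (cases "com_delta d (q - nstates c) syms") auto
    then show ?thesis using Seq.IH(2)[of "q - nstates c" q1] Seq.prems False by auto
  qed
next
  case (Cond P c d)
  consider "q = 0" | "q \<noteq> 0" "q < Suc (nstates c)" | "q \<ge> Suc (nstates c)" by linarith
  then show ?case
  proof cases
    case 1
    then show ?thesis using Cond.prems nstates_pos[of c] by (auto simp: stay_def)
  next
    case 2
    then obtain q1 where "com_delta c (q - 1) syms = (q1, acts)"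
      "q' = (if q1 < nstates c then Suc q1 else Suc (nstates c + nstates d))"
      using Cond.prems by (cases "com_delta c (q - 1) syms") auto
    then show ?thesis using Cond.IH(1)[of "q - 1" q1] Cond.prems 2 by auto
  next
    case 3
    then obtain q1 where "com_delta d (q - Suc (nstates c)) syms = (q1, acts)"
      "q' = q1 + Suc (nstates c)"
      using Cond.prems by (cases "com_delta d (q - Suc (nstates c)) syms") auto
    then show ?thesis using Cond.IH(2)[of "q - Suc (nstates c)" q1] Cond.prems 3 by auto
  qed
next
  case (Loop P c)
  show ?case
  proof (cases "q = 0")
    case True
    then show ?thesis using Loop.prems nstates_pos[of c] by (auto simp: stay_def)
  next
    case False
    then obtain q1 where "com_delta c (q - 1) syms = (q1, acts)"
      "q' = (if q1 < nstates c then Suc q1 else 0)"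
      using Loop.prems by (cases "com_delta c (q - 1) syms") auto
    then show ?thesis using Loop.IH[of "q - 1" q1] Loop.prems False by auto
  qed
qed

text \<open>\<open>run d n q ts t q' ts'\<close>: \<open>t\<close> steps lead from state \<open>q\<close> to state \<open>q'\<close>, and all of them
  start in states below \<open>n\<close>.\<close>

inductive run :: "(nat \<Rightarrow> nat list \<Rightarrow> nat \<times> (nat \<times> int) list) \<Rightarrow> nat \<Rightarrow>
    nat \<Rightarrow> tape list \<Rightarrow> nat \<Rightarrow> nat \<Rightarrow> tape list \<Rightarrow> bool" for d n where
  stop: "run d n q ts 0 q ts"
| step: "q < n \<Longrightarrow> d q (map (\<lambda>(cells, h). cells h) ts) = (q1, acts) \<Longrightarrow>
    run d n q1 (map2 act acts ts) t q' ts' \<Longrightarrow> run d n q ts (Suc t) q' ts'"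

lemma run_trans: "run d n q ts t q1 ts1 \<Longrightarrow> run d n q1 ts1 t' q' ts' \<Longrightarrow> run d n q ts (t + t') q' ts'"
  by (induction rule: run.induct) (auto intro: run.intros)

text \<open>Embeds the states of a part into a larger program by \<open>g\<close>. Only states below
  \<open>n\<close> are simulated, so the exit may be sent anywhere: to the end, to a second part, or
  back to a guard.\<close>

lemma run_lift:
  assumes "run d n q ts t q' ts'"
    and "\<And>q syms. q < n \<Longrightarrow> g q < n' \<and> d' (g q) syms = apfst g (d q syms)"
  shows "run d' n' (g q) ts t (g q') ts'"
  using assms(1)
proof (induction rule: run.induct)
  case (step q ts q1 acts t q' ts')
  then show ?case using assms(2)[of q] by (auto intro: run.step)
qed (auto intro: run.stop)

section \<open>Tapes as stacks\<close>

text \<open>The bottom of the stack is in cell 0 and the head is on the top symbol. For the empty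
  stack the head is on the blank in cell -1.\<close>

definition tape_of :: "nat list \<Rightarrow> tape" where
  "tape_of l = (\<lambda>i. if 0 \<le> i \<and> i < int (length l) then rev l ! nat i else 0, int (length l) - 1)"

lemma read_tape_of: "(\<lambda>(cells, h). cells h) (tape_of l) = top_sym l"
  by (cases l) (auto simp: tape_of_def nth_append)

lemma map_read_tape_of: "map (\<lambda>(cells, h). cells h) (map tape_of s) = map top_sym s"
  using read_tape_of by (simp add: o_def)

lemma act_stay: "act ((\<lambda>(cells, h). cells h) t, 0) t = t"
  by (auto simp: act_def split: prod.splits)

lemma map2_act_stay: "map2 act (stay (map (\<lambda>(cells, h). cells h) ts)) ts = ts"
  by (rule nth_equalityI) (auto simp: stay_def act_stay)

lemma map2_act_update:
  assumes "syms = map (\<lambda>(cells, h). cells h) ts"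
  shows "map2 act ((stay syms)[i := a]) ts = ts[i := act a (ts ! i)]"
  unfolding assms
proof (rule nth_equalityI, goal_cases)
  case (2 j)
  then show ?case by (cases "i = j") (auto simp: stay_def act_stay)
qed (simp add: stay_def)

lemma map2_act_stay_top: "map2 act (stay (map top_sym s)) (map tape_of s) = map tape_of s"
  using map2_act_stay[of "map tape_of s"] by (simp only: map_read_tape_of)

lemma act_pop: "l \<noteq> [] \<Longrightarrow> act (0, -1) (tape_of l) = tape_of (tl l)"
proof (cases l)
  case (Cons a l')
  then show ?thesis by (auto simp: act_def tape_of_def nth_append fun_eq_iff)
qed auto

lemma act_push: "act (a, 0) (act (top_sym l, 1) (tape_of l)) = tape_of (a # l)"
proof (cases l)
  case (Cons b l')
  then show ?thesis by (auto simp: act_def tape_of_def nth_append fun_eq_iff nth_Cons')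
qed (auto simp: act_def tape_of_def fun_eq_iff)

text \<open>Treats \<open>Push\<close> and \<open>Copy\<close> together. In the second step tape
  \<open>i\<close> already scans the cell above its old top, so only the other tapes may be
  consulted; this suffices for \<open>Copy\<close> because its source and target differ.\<close>

lemma run_push:
  assumes "i < length s" "nstates c = 2"
    "\<And>syms. com_delta c 0 syms = (1, (stay syms)[i := (syms ! i, 1)])"
    "\<And>syms. length syms = length s \<Longrightarrow> (\<And>j. j < length s \<Longrightarrow> j \<noteq> i \<Longrightarrow> syms ! j = top_sym (s ! j)) \<Longrightarrow>
       com_delta c 1 syms = (2, (stay syms)[i := (a, 0)])"
  shows "run (com_delta c) (nstates c) 0 (map tape_of s) 2 2 (map tape_of (s[i := a # s ! i]))"
proof -
  let ?t1 = "(map tape_of s)[i := act (top_sym (s ! i), 1) (tape_of (s ! i))]"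
  let ?syms = "map (\<lambda>(cells, h). cells h) ?t1"
  have "run (com_delta c) 2 2 (map tape_of (s[i := a # s ! i])) 0 2 (map tape_of (s[i := a # s ! i]))"
    by (rule run.stop)
  moreover have "?t1[i := act (a, 0) (?t1 ! i)] = map tape_of (s[i := a # s ! i])"
    using assms(1) by (simp add: act_push map_update)
  ultimately have 1: "run (com_delta c) 2 1 ?t1 (Suc 0) 2 (map tape_of (s[i := a # s ! i]))"
  proof (intro run.step[where ?q1.0 = 2 and acts = "(stay ?syms)[i := (a, 0)]"], goal_cases)
    case 2
    have "?syms ! j = top_sym (s ! j)" if "j < length s" "j \<noteq> i" for j
      using that read_tape_of by simp
    then show ?case by (intro assms(4)) auto
  next
    case 3
    then show ?case by (subst map2_act_update) auto
  qed auto
  have 2: "map2 act ((stay (map top_sym s))[i := (map top_sym s ! i, 1)]) (map tape_of s) = ?t1"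
    using assms(1) by (subst map2_act_update) (simp_all add: map_read_tape_of del: map_map)
  have "run (com_delta c) 2 0 (map tape_of s) (Suc (Suc 0)) 2 (map tape_of (s[i := a # s ! i]))"
    by (rule run.step[OF _ _ 1[folded 2]]) (simp, simp only: map_read_tape_of assms(3))
  then show ?thesis by (simp add: assms(2) numeral_2_eq_2)
qed

lemma exec_run:
  "exec c s t s' \<Longrightarrow> run (com_delta c) (nstates c) 0 (map tape_of s) t (nstates c) (map tape_of s')"
proof (induction rule: exec.induct)
  case (Push i s a)
  have "run (com_delta (Push i a)) (nstates (Push i a)) 0 (map tape_of s) 2 2
      (map tape_of (s[i := a # s ! i]))"
    using Push by (intro run_push) auto
  then show ?case by (simp del: com_delta.simps)
next
  case (Copy i s j)
  have "run (com_delta (Copy i j)) (nstates (Copy i j)) 0 (map tape_of s) 2 2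
      (map tape_of (s[j := top_sym (s ! i) # s ! j]))"
    using Copy by (intro run_push) auto
  then show ?case by (simp del: com_delta.simps)
next
  case (Pop i s)
  have "map2 act (snd (com_delta (Pop i) 0 (map top_sym s))) (map tape_of s) = map tape_of (s[i := tl (s ! i)])"
  proof (cases "s ! i = []")
    case True
    then show ?thesis using Pop by (simp add: map2_act_stay_top) (metis list_update_id)
  next
    case False
    then have "map2 act ((stay (map top_sym s))[i := (0, -1)]) (map tape_of s) =
        (map tape_of s)[i := act (0, -1) (map tape_of s ! i)]"
      by (intro map2_act_update) (simp only: map_read_tape_of)
    then show ?thesis using Pop False by (simp add: map_update act_pop)
  qed
  then have "run (com_delta (Pop i)) 1 0 (map tape_of s) (Suc 0) 1 (map tape_of (s[i := tl (s ! i)]))"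
    by (intro run.step[where ?q1.0 = 1 and acts = "snd (com_delta (Pop i) 0 (map top_sym s))"])
      (simp, simp add: map_read_tape_of del: map_map,
        simp add: run.stop del: com_delta.simps)
  then show ?case by (simp del: com_delta.simps)
next
  case (Seq c s m s1 d n s2)
  have 1: "run (com_delta (c ;; d)) (nstates (c ;; d)) 0 (map tape_of s) m (nstates c) (map tape_of s1)"
    using Seq.IH(1) by (rule run_lift[where g = id, simplified]) auto
  have 2: "run (com_delta (c ;; d)) (nstates (c ;; d)) (0 + nstates c) (map tape_of s1) n
      (nstates d + nstates c) (map tape_of s2)"
    using Seq.IH(2) by (rule run_lift) auto
  show ?case using run_trans[OF 1 2[unfolded add_0]] by (simp add: add.commute del: com_delta.simps)
next
  case (CondT P s c n s1 d)
  let ?g = "\<lambda>q'. if q' < nstates c then Suc q' else Suc (nstates c + nstates d)"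
  have "run (com_delta (Cond P c d)) (nstates (Cond P c d)) (?g 0) (map tape_of s) n
      (?g (nstates c)) (map tape_of s1)"
    using CondT.IH by (rule run_lift) auto
  then show ?case using CondT.hyps nstates_pos[of c]
    by (intro run.step[where ?q1.0 = 1 and acts = "stay (map top_sym s)"])
      (simp, simp add: map_read_tape_of del: map_map,
        simp add: map2_act_stay_top del: com_delta.simps)
next
  case (CondF P s d n s1 c)
  have "run (com_delta (Cond P c d)) (nstates (Cond P c d)) (0 + Suc (nstates c)) (map tape_of s) n
      (nstates d + Suc (nstates c)) (map tape_of s1)"
    using CondF.IH by (rule run_lift) auto
  then show ?case using CondF.hyps
    by (intro run.step[where ?q1.0 = "Suc (nstates c)" and acts = "stay (map top_sym s)"])
      (simp, simp add: map_read_tape_of del: map_map,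
        simp add: map2_act_stay_top add.commute del: com_delta.simps)
next
  case (LoopF P s c)
  then have "run (com_delta (Loop P c)) (nstates (Loop P c)) 0 (map tape_of s) (Suc 0)
      (nstates (Loop P c)) (map tape_of s)"
    by (intro run.step[where ?q1.0 = "Suc (nstates c)" and acts = "stay (map top_sym s)"])
      (simp, simp add: map_read_tape_of del: map_map,
        simp add: map2_act_stay_top run.stop del: com_delta.simps)
  then show ?case by (simp del: com_delta.simps)
next
  case (LoopT P s c m s1 n s2)
  \<comment> \<open>The exit of the body is sent to the guard in state 0.\<close>
  let ?g = "\<lambda>q'. if q' < nstates c then Suc q' else 0"
  have "run (com_delta (Loop P c)) (nstates (Loop P c)) (?g 0) (map tape_of s) m
      (?g (nstates c)) (map tape_of s1)"
    using LoopT.IH(1) by (rule run_lift) auto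
  then have "run (com_delta (Loop P c)) (nstates (Loop P c)) 1 (map tape_of s) (m + n)
      (nstates (Loop P c)) (map tape_of s2)"
    using run_trans LoopT.IH(2) nstates_pos[of c] by (simp del: com_delta.simps)
  then show ?case using LoopT.hyps
    by (intro run.step[where ?q1.0 = 1 and acts = "stay (map top_sym s)"])
      (simp, simp add: map_read_tape_of del: map_map,
        simp add: map2_act_stay_top del: com_delta.simps)
qed

section \<open>From stack programs to Turing machines\<close>

text \<open>The additional state 0 moves the first head past the input and then moves all heads one
  cell to the left. After that the first tape is a stack with the last input letter on top, and the
  other tapes are empty stacks.\<close>

definition machine_of :: "nat \<Rightarrow> nat \<Rightarrow> com \<Rightarrow> machine" where
  "machine_of k m c = \<lparr>num_tapes = k, num_states = Suc (nstates c), num_symbols = m,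
     delta = (\<lambda>q syms. if q = 0 then
         (if hd syms = 0 then (1, map (\<lambda>a. (a, -1)) syms) else (0, (stay syms)[0 := (hd syms, 1)]))
       else apfst Suc (com_delta c (q - 1) syms))\<rparr>"

lemma turing_machine_machine_of:
  assumes "wf_com k m c" "k \<ge> 1" "m \<ge> 3"
  shows "turing_machine (machine_of k m c)"
  unfolding turing_machine_def
proof (intro conjI allI impI)
  fix q syms
  assume q: "q < num_states (machine_of k m c)"
    and syms: "length syms = num_tapes (machine_of k m c) \<and> set syms \<subseteq> {..<num_symbols (machine_of k m c)}"
  show "case delta (machine_of k m c) q syms of (q', acts) \<Rightarrow>
      q' \<le> num_states (machine_of k m c) \<and> length acts = num_tapes (machine_of k m c) \<and>
      set acts \<subseteq> {..<num_symbols (machine_of k m c)} \<times> {-1, 0, 1}"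
  proof (cases "q = 0")
    case True
    have "hd syms \<in> set syms" using syms assms by (intro hd_in_set) (auto simp: machine_of_def)
    then show ?thesis using True syms
      by (auto simp: machine_of_def stay_def dest!: subsetD[OF set_update_subset_insert])
  next
    case False
    obtain q' acts where *: "com_delta c (q - 1) syms = (q', acts)" by fastforce
    show ?thesis using com_delta_valid[OF assms(1) _ _ _ _ *] False q syms assms(3) *
      by (auto simp: machine_of_def)
  qed
qed (use assms in \<open>auto simp: machine_of_def\<close>)

lemma run_machine_of:
  assumes "run (com_delta c) (nstates c) q ts t q' ts'"
  shows "(step (machine_of k m c) ^^ t) (Suc q, ts) = (Suc q', ts')"
  using assms
proof (induction rule: run.induct)
  case (step q ts q1 acts t q' ts')
  then have "step (machine_of k m c) (Suc q, ts) = (Suc q1, map2 act acts ts)"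
    by (simp add: step_def halted_def machine_of_def)
  then show ?case using step.IH by (simp add: funpow_swap1[symmetric] funpow_Suc_right del: funpow.simps)
qed simp

lemma machine_of_init:
  assumes "k \<ge> 1"
  shows "(step (machine_of k m c) ^^ Suc (length x)) (start (machine_of k m c) x) =
    (1, map tape_of (rev (map (\<lambda>b. if b then 2 else 1) x) # replicate (k - 1) []))"
proof -
  let ?M = "machine_of k m c"
  let ?rest = "replicate (k - 1) ((\<lambda>_. 0, 0) :: tape)"
  have "(step ?M ^^ n) (start ?M x) = (0, (word_cells x, int n) # ?rest)" if "n \<le> length x" for n
    using that
  proof (induction n)
    case 0
    then show ?case by (simp add: start_def machine_of_def)
  next
    case (Suc n)
    let ?ts = "(word_cells x, int n) # ?rest"
    let ?syms = "map (\<lambda>(cells, h). cells h) ?ts"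
    have "word_cells x (int n) \<noteq> 0" using Suc.prems by (simp add: word_cells_def)
    then have "step ?M (0, ?ts) = (0, map2 act ((stay ?syms)[0 := (hd ?syms, 1)]) ?ts)"
      by (simp add: step_def halted_def machine_of_def)
    also have "map2 act ((stay ?syms)[0 := (hd ?syms, 1)]) ?ts = (word_cells x, int (Suc n)) # ?rest"
      by (subst map2_act_update) (simp_all add: act_def)
    finally show ?case using Suc by simp
  qed
  then have "(step ?M ^^ Suc (length x)) (start ?M x) = step ?M (0, (word_cells x, int (length x)) # ?rest)"
    by simp
  also have "\<dots> = (1, (word_cells x, int (length x) - 1) # replicate (k - 1) (\<lambda>_. 0, -1))"
  proof -
    have "word_cells x (int (length x)) = 0" by (simp add: word_cells_def)
    moreover have "map2 act (replicate n (0, -1)) (replicate n ((\<lambda>_. 0, 0) :: tape)) =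
        replicate n (\<lambda>_. 0, -1)" for n
      by (induction n) (auto simp: act_def)
    ultimately show ?thesis
      by (auto simp: step_def halted_def machine_of_def act_def fun_eq_iff)
  qed
  also have "\<dots> = (1, map tape_of (rev (map (\<lambda>b. if b then 2 else 1) x) # replicate (k - 1) []))"
  proof -
    have "word_cells x = fst (tape_of (rev (map (\<lambda>b. if b then 2 else 1) x)))"
      by (auto simp: word_cells_def tape_of_def fun_eq_iff)
    then show ?thesis by (auto simp: tape_of_def fun_eq_iff)
  qed
  finally show ?thesis .
qed

lemma polytime_exec:
  fixes p :: "nat poly"
  assumes "wf_com k m c" "k \<ge> 1" "m \<ge> 3"
    and "\<And>x. \<exists>t \<le> poly p (length x). \<exists>s.
      exec c (rev (map (\<lambda>b. if b then 2 else 1) x) # replicate (k - 1) []) t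
        (rev (map (\<lambda>b. if b then 2 else 1) (f x)) # s)"
  shows "polytime f"
  unfolding polytime_def
\<comment> \<open>The summand \<open>1 + X\<close> pays for the initial walk along the input and the
  turn at its end.\<close>
proof (intro exI[of _ "machine_of k m c"] exI[of _ "p + [:1, 1:]"] conjI allI)
  let ?M = "machine_of k m c"
  let ?enc = "\<lambda>x. rev (map (\<lambda>b. if b then 2 else 1) x) :: nat list"
  show "turing_machine ?M" using assms(1-3) by (rule turing_machine_machine_of)
  fix x
  obtain t s where t: "t \<le> poly p (length x)"
    "exec c (?enc x # replicate (k - 1) []) t (?enc (f x) # s)"
    using assms(4) by blast
  have "(step ?M ^^ (t + Suc (length x))) (start ?M x) =
      (Suc (nstates c), map tape_of (?enc (f x) # s))"
    using run_machine_of[OF exec_run[OF t(2)]] machine_of_init[OF assms(2), where m = m and c = c and x = x]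
    by (simp only: funpow_add o_apply One_nat_def)
  moreover have "fst (tape_of (?enc (f x))) = word_cells (f x)"
    by (auto simp: word_cells_def tape_of_def fun_eq_iff)
  ultimately show "\<exists>n \<le> poly (p + [:1, 1:]) (length x). halted ?M ((step ?M ^^ n) (start ?M x)) \<and>
      fst (hd (snd ((step ?M ^^ n) (start ?M x)))) = word_cells (f x)"
    using t(1) by (intro exI[of _ "t + Suc (length x)"]) (simp add: halted_def machine_of_def)
qed

section \<open>Upper bounds on running times\<close>

text \<open>With a bound instead of the exact time, both branches of a conditional and all passes of
  a loop can share one expression.\<close>

definition runs :: "com \<Rightarrow> stacks \<Rightarrow> nat \<Rightarrow> stacks \<Rightarrow> bool" where
  "runs c s n s' \<longleftrightarrow> (\<exists>t\<le>n. exec c s t s')"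

lemma runs_Push: "i < length s \<Longrightarrow> a \<noteq> 0 \<Longrightarrow> s' = s[i := a # s ! i] \<Longrightarrow> runs (Push i a) s 2 s'"
  unfolding runs_def using exec.Push by blast

lemma runs_Copy: "i < length s \<Longrightarrow> j < length s \<Longrightarrow> i \<noteq> j \<Longrightarrow> top_sym (s ! i) \<noteq> 0 \<Longrightarrow>
    s' = s[j := top_sym (s ! i) # s ! j] \<Longrightarrow> runs (Copy i j) s 2 s'"
  unfolding runs_def using exec.Copy by blast

lemma runs_Pop: "i < length s \<Longrightarrow> s ! i = [] \<or> top_sym (s ! i) \<noteq> 0 \<Longrightarrow> s' = s[i := tl (s ! i)] \<Longrightarrow>
    runs (Pop i) s 1 s'"
  unfolding runs_def using exec.Pop by blast

lemma runs_Seq: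
  assumes "runs c s m s1" "runs d s1 n s2"
  shows "runs (c ;; d) s (m + n) s2"
proof -
  obtain t u where "t \<le> m" "exec c s t s1" "u \<le> n" "exec d s1 u s2"
    using assms unfolding runs_def by blast
  then have "t + u \<le> m + n" "exec (c ;; d) s (t + u) s2" by (auto intro: exec.Seq)
  then show ?thesis unfolding runs_def by blast
qed

lemma runs_mono: "runs c s m s' \<Longrightarrow> m \<le> n \<Longrightarrow> runs c s n s'"
  unfolding runs_def by (meson order_trans)

lemma runs_Cond:
  assumes "P (map top_sym s) \<Longrightarrow> runs c s n s'" "\<not> P (map top_sym s) \<Longrightarrow> runs d s n s'"
  shows "runs (Cond P c d) s (Suc n) s'"
proof (cases "P (map top_sym s)")
  case True
  then obtain t where "t \<le> n" "exec c s t s'" using assms unfolding runs_def by blast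
  then have "Suc t \<le> Suc n" "exec (Cond P c d) s (Suc t) s'" using True by (auto intro: exec.CondT)
  then show ?thesis unfolding runs_def by blast
next
  case False
  then obtain t where "t \<le> n" "exec d s t s'" using assms unfolding runs_def by blast
  then have "Suc t \<le> Suc n" "exec (Cond P c d) s (Suc t) s'" using False by (auto intro: exec.CondF)
  then show ?thesis unfolding runs_def by blast
qed

lemma runs_Loop_end: "\<not> P (map top_sym s) \<Longrightarrow> 1 \<le> n \<Longrightarrow> runs (Loop P c) s n s"
  unfolding runs_def using exec.LoopF by blast

lemma runs_Loop_step:
  assumes "P (map top_sym s)" "runs c s m s1" "runs (Loop P c) s1 n s2" "Suc (m + n) \<le> k"
  shows "runs (Loop P c) s k s2"
proof -
  obtain t u where "t \<le> m" "exec c s t s1" "u \<le> n" "exec (Loop P c) s1 u s2"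
    using assms unfolding runs_def by blast
  then have "Suc (t + u) \<le> k" "exec (Loop P c) s (Suc (t + u)) s2"
    using assms(1,4) by (auto intro: exec.LoopT)
  then show ?thesis unfolding runs_def by blast
qed

definition nonblank :: "nat \<Rightarrow> bool" where "nonblank a \<longleftrightarrow> a \<noteq> 0"

definition is_bit :: "nat \<Rightarrow> bool" where "is_bit a \<longleftrightarrow> a = 1 \<or> a = 2"

definition sym_of :: "bool \<Rightarrow> nat" where "sym_of b = (if b then 2 else 1)"

lemma sym_of_simps [simp]: "sym_of True = 2" "sym_of False = 1" "is_bit (sym_of b)" "sym_of b \<noteq> 0" "0 < sym_of b"
  "sym_of b \<noteq> 3" "sym_of b \<noteq> 4" "sym_of b \<noteq> 5" "nonblank (sym_of b)" "sym_of b = sym_of c \<longleftrightarrow> b = c"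
  by (auto simp: sym_of_def is_bit_def nonblank_def)

lemma sym_of_eq_2 [simp]: "sym_of b = 2 \<longleftrightarrow> b" by (simp add: sym_of_def)

lemma is_bit_simps [simp]: "\<not> is_bit 0" "\<not> is_bit 3" "\<not> is_bit 4" "\<not> is_bit 5" "is_bit 1" "is_bit 2" "is_bit (Suc 0)"
  by (auto simp: is_bit_def)

lemma nonblank_simps [simp]: "\<not> nonblank 0" "nonblank (Suc n)" "nonblank (numeral k)" "nonblank 1"
  by (auto simp: nonblank_def)

lemma list_update_Cons_numeral [simp]:
  "(x # xs)[numeral k := y] = x # xs[pred_numeral k := y]"
  by (simp add: numeral_eq_Suc)

abbreviation skip :: com where "skip \<equiv> Loop (\<lambda>_. False) (Pop 0)"

text \<open>Moving reverses a segment; this is why the arcs travel from stack 2 to stack 3 and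
  back.\<close>

abbreviation move :: "nat \<Rightarrow> nat \<Rightarrow> (nat \<Rightarrow> bool) \<Rightarrow> com" where
  "move i j P \<equiv> Loop (\<lambda>t. P (t ! i)) (Copy i j ;; Pop i)"

abbreviation clear :: "nat \<Rightarrow> (nat \<Rightarrow> bool) \<Rightarrow> com" where
  "clear i P \<equiv> Loop (\<lambda>t. P (t ! i)) (Pop i)"

fun pushes :: "nat \<Rightarrow> nat \<Rightarrow> nat \<Rightarrow> com" where
  "pushes i a 0 = skip"
| "pushes i a (Suc n) = Push i a ;; pushes i a n"

lemma runs_move1:
  "i < length s \<Longrightarrow> j < length s \<Longrightarrow> i \<noteq> j \<Longrightarrow> s ! i = a # r \<Longrightarrow> a \<noteq> 0 \<Longrightarrow>
    s' = s[i := r, j := a # s ! j] \<Longrightarrow> runs (Copy i j ;; Pop i) s 3 s'"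
  using runs_Seq[OF runs_Copy[of i s j] runs_Pop[of i "s[j := a # s ! j]"]]
  by (simp add: list_update_swap)

lemma runs_move:
  assumes "i < length s" "j < length s" "i \<noteq> j" "s ! i = xs @ r"
    "\<And>x. x \<in> set xs \<Longrightarrow> P x \<and> x \<noteq> 0" "\<not> P (top_sym r)"
    "s' = s[i := r, j := rev xs @ s ! j]"
  shows "runs (move i j P) s (4 * length xs + 1) s'"
  using assms
proof (induction xs arbitrary: s)
  case Nil
  then show ?case using runs_Loop_end[of "\<lambda>t. P (t ! i)" s] by auto
next
  case (Cons a xs)
  let ?s = "s[i := xs @ r, j := a # s ! j]"
  have 1: "runs (Copy i j ;; Pop i) s 3 ?s"
    using Cons.prems by (intro runs_move1) auto
  have 2: "runs (move i j P) ?s (4 * length xs + 1) s'"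
    using Cons.prems by (intro Cons.IH) (auto simp: list_update_swap)
  show ?case using Cons.prems by (intro runs_Loop_step[OF _ 1 2]) auto
qed

lemma runs_clear:
  assumes "i < length s" "s ! i = xs @ r"
    "\<And>x. x \<in> set xs \<Longrightarrow> P x \<and> x \<noteq> 0" "\<not> P (top_sym r)" "s' = s[i := r]"
  shows "runs (clear i P) s (2 * length xs + 1) s'"
  using assms
proof (induction xs arbitrary: s)
  case Nil
  then show ?case using runs_Loop_end[of "\<lambda>t. P (t ! i)" s] by auto
next
  case (Cons a xs)
  let ?s = "s[i := xs @ r]"
  have 1: "runs (Pop i) s 1 ?s"
    using Cons.prems by (intro runs_Pop) auto
  have 2: "runs (clear i P) ?s (2 * length xs + 1) s'"
    using Cons.prems by (intro Cons.IH) (auto simp: list_update_swap)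
  show ?case using Cons.prems by (intro runs_Loop_step[OF _ 1 2]) auto
qed

lemma runs_pushes:
  assumes "i < length s" "a \<noteq> 0" "s' = s[i := replicate n a @ s ! i]"
  shows "runs (pushes i a n) s (2 * n + 1) s'"
  using assms
proof (induction n arbitrary: s)
  case 0
  then show ?case by (auto intro: runs_Loop_end)
next
  case (Suc n)
  have "runs (pushes i a n) (s[i := a # s ! i]) (2 * n + 1) s'"
    using Suc.prems by (intro Suc.IH) (auto simp: replicate_app_Cons_same)
  then have "runs (Push i a ;; pushes i a n) s (2 + (2 * n + 1)) s'"
    using Suc.prems by (intro runs_Seq[OF runs_Push]) auto
  then show ?case by simp
qed

section \<open>Arcs as records of digit words\<close>

text \<open>Tail, head, label, numerator and denominator of the weight. They are arbitrary digit
  words, since a malformed input may contain numbers with leading zeros.\<close>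

type_synonym arc = "bool list \<times> bool list \<times> bool list \<times> bool list \<times> bool list"

abbreviation arc_tail :: "arc \<Rightarrow> bool list" where "arc_tail \<equiv> fst"
abbreviation arc_head :: "arc \<Rightarrow> bool list" where "arc_head \<equiv> \<lambda>e. fst (snd e)"

abbreviation syms :: "bool list \<Rightarrow> nat list" where "syms \<equiv> map sym_of"

definition field :: "bool list \<Rightarrow> nat list" where "field bs = syms bs @ [3]"

definition record_of :: "arc \<Rightarrow> nat list" where
  "record_of e = (case e of (u, v, l, n, d) \<Rightarrow> field u @ field v @ field l @ field n @ field d @ [5])"

abbreviation records :: "arc list \<Rightarrow> nat list" where
  "records es \<equiv> concat (map record_of es)"

section \<open>Comparing fields\<close>

text \<open>Stack 0 holds the output; 1 the input and, after parsing, the used part of the clock 8; 2 and 3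
  the arcs to the right and to the left of the current position; 4 a vertex, and 5 the part of it that
  has been compared; 6 is auxiliary; 7 holds the base exponent in unary, in symbols 1, below the
  contribution of the label, in symbols 2; 8 holds the number of arcs in unary. Symbol 3 ends a field,
  5 ends a record, and 4 marks a mismatch.\<close>

definition compare :: com where
  "compare = Loop (\<lambda>t. is_bit (t ! 2))
     (Cond (\<lambda>t. t ! 2 = t ! 4) (Copy 4 5 ;; Pop 4) (Push 4 4) ;; Copy 2 3 ;; Pop 2)"

text \<open>Once stack 4 shows a symbol that is not a digit, no later digit can match, and each of
  them adds another marker.\<close>

lemma runs_compare_mismatch:
  assumes "\<And>b. top_sym h \<noteq> sym_of b"
  shows "runs compare [out, i, syms u @ 3 # r, b, h, g, x, c, k] (8 * length u + 1)
    [out, i, 3 # r, rev (syms u) @ b, replicate (length u) 4 @ h, g, x, c, k]"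
  using assms
proof (induction u arbitrary: h b)
  case Nil
  then show ?case unfolding compare_def by (auto intro: runs_Loop_end)
next
  case (Cons a u)
  let ?body = "Cond (\<lambda>t. t ! 2 = t ! 4) (Copy 4 5 ;; Pop 4) (Push 4 4)"
  have "runs ?body [out, i, syms (a # u) @ 3 # r, b, h, g, x, c, k] (Suc 2)
      [out, i, syms (a # u) @ 3 # r, b, 4 # h, g, x, c, k]"
    using Cons.prems[of a] by (intro runs_Cond) (auto intro!: runs_Push)
  moreover have "runs (Copy 2 3 ;; Pop 2) [out, i, syms (a # u) @ 3 # r, b, 4 # h, g, x, c, k] 3
      [out, i, syms u @ 3 # r, sym_of a # b, 4 # h, g, x, c, k]"
    by (rule runs_move1) auto
  ultimately have 1: "runs (?body ;; Copy 2 3 ;; Pop 2) [out, i, syms (a # u) @ 3 # r, b, h, g, x, c, k]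
      (Suc 2 + 3) [out, i, syms u @ 3 # r, sym_of a # b, 4 # h, g, x, c, k]"
    by (rule runs_Seq)
  have 2: "runs compare [out, i, syms u @ 3 # r, sym_of a # b, 4 # h, g, x, c, k] (8 * length u + 1)
    [out, i, 3 # r, rev (syms u) @ sym_of a # b, replicate (length u) 4 @ 4 # h, g, x, c, k]"
    by (rule Cons.IH) (auto simp: sym_of_def)
  show ?case using runs_Loop_step[OF _ 1 2[unfolded compare_def]] unfolding compare_def
    by (simp add: replicate_app_Cons_same)
qed

lemma runs_compare_eq:
  "runs compare [out, i, syms u @ 3 # r, b, syms u @ h, g, x, c, k] (8 * length u + 1)
    [out, i, 3 # r, rev (syms u) @ b, h, rev (syms u) @ g, x, c, k]"
proof (induction u arbitrary: b g)
  case Nil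
  then show ?case unfolding compare_def by (auto intro: runs_Loop_end)
next
  case (Cons a u)
  let ?body = "Cond (\<lambda>t. t ! 2 = t ! 4) (Copy 4 5 ;; Pop 4) (Push 4 4)"
  have "runs ?body [out, i, syms (a # u) @ 3 # r, b, syms (a # u) @ h, g, x, c, k] (Suc 3)
      [out, i, syms (a # u) @ 3 # r, b, syms u @ h, sym_of a # g, x, c, k]"
    by (intro runs_Cond) (auto intro!: runs_move1)
  moreover have "runs (Copy 2 3 ;; Pop 2)
      [out, i, syms (a # u) @ 3 # r, b, syms u @ h, sym_of a # g, x, c, k] 3
      [out, i, syms u @ 3 # r, sym_of a # b, syms u @ h, sym_of a # g, x, c, k]"
    by (rule runs_move1) auto
  ultimately have 1: "runs (?body ;; Copy 2 3 ;; Pop 2)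
      [out, i, syms (a # u) @ 3 # r, b, syms (a # u) @ h, g, x, c, k] (Suc 3 + 3)
      [out, i, syms u @ 3 # r, sym_of a # b, syms u @ h, sym_of a # g, x, c, k]"
    by (rule runs_Seq)
  have 2: "runs compare [out, i, syms u @ 3 # r, sym_of a # b, syms u @ h, sym_of a # g, x, c, k]
      (8 * length u + 1)
      [out, i, 3 # r, rev (syms u) @ sym_of a # b, h, rev (syms u) @ sym_of a # g, x, c, k]"
    by (rule Cons.IH)
  show ?case using runs_Loop_step[OF _ 1 2[unfolded compare_def]] unfolding compare_def by simp
qed

text \<open>Equality must be visible in the top of stack 4 alone. After a mismatch a marker lies
  there, and if \<open>u\<close> is a proper prefix of \<open>v\<close> a digit of \<open>v\<close>
  does; neither is the terminator 3. The prefix \<open>v1\<close> has gone to stack 5, from where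
  \<open>v\<close> can be restored.\<close>

lemma runs_compare_neq:
  assumes "u \<noteq> v"
  shows "\<exists>j v1 v2. j \<le> length u \<and> length v1 \<le> length u \<and> v = v1 @ v2 \<and> top_sym (replicate j 4 @ field v2) \<noteq> 3 \<and>
    runs compare [out, i, syms u @ 3 # r, b, field v, g, x, c, k] (8 * length u + 1)
      [out, i, 3 # r, rev (syms u) @ b, replicate j 4 @ field v2, rev (syms v1) @ g, x, c, k]"
  using assms
proof (induction u arbitrary: v b g)
  case Nil
  then obtain a v' where "v = a # v'" by (cases v) auto
  then have "runs compare [out, i, syms [] @ 3 # r, b, field v, g, x, c, k] (8 * length [] + 1)
      [out, i, 3 # r, rev (syms []) @ b, replicate 0 4 @ field v, rev (syms []) @ g, x, c, k]"
    unfolding compare_def by (auto intro: runs_Loop_end)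
  moreover have "top_sym (replicate 0 4 @ field v) \<noteq> 3" using \<open>v = _\<close> by (simp add: field_def)
  ultimately show ?case by (intro exI[of _ 0] exI[of _ "[]"] exI[of _ v]) simp
next
  case (Cons a u)
  let ?body = "Cond (\<lambda>t. t ! 2 = t ! 4) (Copy 4 5 ;; Pop 4) (Push 4 4)"
  show ?case
  proof (cases "\<exists>v'. v = a # v'")
    case True
    then obtain v' where v: "v = a # v'" by blast
    then obtain j v1 v2 where IH: "j \<le> length u" "length v1 \<le> length u" "v' = v1 @ v2"
      "top_sym (replicate j 4 @ field v2) \<noteq> 3"
      "runs compare [out, i, syms u @ 3 # r, sym_of a # b, field v', sym_of a # g, x, c, k] (8 * length u + 1)
      [out, i, 3 # r, rev (syms u) @ sym_of a # b, replicate j 4 @ field v2, rev (syms v1) @ sym_of a # g, x, c, k]"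
      using Cons by blast
    have "runs ?body [out, i, syms (a # u) @ 3 # r, b, field v, g, x, c, k] (Suc 3)
        [out, i, syms (a # u) @ 3 # r, b, field v', sym_of a # g, x, c, k]"
      by (intro runs_Cond) (auto intro!: runs_move1 simp: v field_def)
    moreover have "runs (Copy 2 3 ;; Pop 2)
        [out, i, syms (a # u) @ 3 # r, b, field v', sym_of a # g, x, c, k] 3
        [out, i, syms u @ 3 # r, sym_of a # b, field v', sym_of a # g, x, c, k]"
      by (rule runs_move1) auto
    ultimately have 1: "runs (?body ;; Copy 2 3 ;; Pop 2)
        [out, i, syms (a # u) @ 3 # r, b, field v, g, x, c, k] (Suc 3 + 3)
        [out, i, syms u @ 3 # r, sym_of a # b, field v', sym_of a # g, x, c, k]"
      by (rule runs_Seq)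
    have "runs compare [out, i, syms (a # u) @ 3 # r, b, field v, g, x, c, k] (8 * length (a # u) + 1)
      [out, i, 3 # r, rev (syms (a # u)) @ b, replicate j 4 @ field v2, rev (syms (a # v1)) @ g, x, c, k]"
      using runs_Loop_step[OF _ 1 IH(5)[unfolded compare_def]] unfolding compare_def by simp
    then show ?thesis using IH v
      by (intro exI[of _ j] exI[of _ "a # v1"] exI[of _ v2]) simp
  next
    case False
    then have top: "top_sym (field v) \<noteq> sym_of a" by (cases v) (auto simp: field_def)
    have "runs ?body [out, i, syms (a # u) @ 3 # r, b, field v, g, x, c, k] (Suc 2)
        [out, i, syms (a # u) @ 3 # r, b, 4 # field v, g, x, c, k]"
      using top by (intro runs_Cond) (auto intro!: runs_Push)
    moreover have "runs (Copy 2 3 ;; Pop 2) [out, i, syms (a # u) @ 3 # r, b, 4 # field v, g, x, c, k] 3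
        [out, i, syms u @ 3 # r, sym_of a # b, 4 # field v, g, x, c, k]"
      by (rule runs_move1) auto
    ultimately have 1: "runs (?body ;; Copy 2 3 ;; Pop 2)
        [out, i, syms (a # u) @ 3 # r, b, field v, g, x, c, k] (Suc 2 + 3)
        [out, i, syms u @ 3 # r, sym_of a # b, 4 # field v, g, x, c, k]"
      by (rule runs_Seq)
    have 2: "runs compare [out, i, syms u @ 3 # r, sym_of a # b, 4 # field v, g, x, c, k] (8 * length u + 1)
        [out, i, 3 # r, rev (syms u) @ sym_of a # b, replicate (length u) 4 @ 4 # field v, g, x, c, k]"
      by (rule runs_compare_mismatch) (auto simp: sym_of_def)
    have "runs compare [out, i, syms (a # u) @ 3 # r, b, field v, g, x, c, k] (8 * length (a # u) + 1)
      [out, i, 3 # r, rev (syms (a # u)) @ b, replicate (length (a # u)) 4 @ field v, rev (syms []) @ g, x, c, k]"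
      using runs_Loop_step[OF _ 1 2[unfolded compare_def]] unfolding compare_def
      by (simp add: replicate_app_Cons_same)
    then show ?thesis
      by (intro exI[of _ "length (a # u)"] exI[of _ "[]"] exI[of _ v]) simp
  qed
qed

definition copy_field :: com where
  "copy_field = Loop (\<lambda>t. is_bit (t ! 2)) (Copy 2 5 ;; Copy 2 3 ;; Pop 2)"

lemma runs_copy_field:
  "runs copy_field [out, i, syms u @ 3 # r, b, h, g, x, c, k] (6 * length u + 1)
    [out, i, 3 # r, rev (syms u) @ b, h, rev (syms u) @ g, x, c, k]"
proof (induction u arbitrary: b g)
  case Nil
  then show ?case unfolding copy_field_def by (auto intro: runs_Loop_end)
next
  case (Cons a u)
  have 1: "runs (Copy 2 5 ;; Copy 2 3 ;; Pop 2) [out, i, syms (a # u) @ 3 # r, b, h, g, x, c, k] (2 + 3)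
      [out, i, syms u @ 3 # r, sym_of a # b, h, sym_of a # g, x, c, k]"
    by (rule runs_Seq[OF runs_Copy runs_move1]) auto
  show ?case using runs_Loop_step[OF _ 1 Cons[unfolded copy_field_def]] unfolding copy_field_def by simp
qed

definition emit_field :: "nat \<Rightarrow> com" where
  "emit_field i = Loop (\<lambda>t. is_bit (t ! i)) (Push 0 2 ;; Copy i 0 ;; Pop i) ;; Push 0 1"

text \<open>\<open>enc_nat\<close> from the digits onwards. Names and weights are copied digit by
  digit, without computing their values.\<close>

definition code :: "bool list \<Rightarrow> bool list" where
  "code = enc_list (\<lambda>b. [b])"

lemma code_simps [simp]: "code [] = [False]" "code (b # u) = True # b # code u"
  by (simp_all add: code_def enc_list_def)

lemma code_nonempty [simp]: "code u \<noteq> []"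
  by (cases u) auto

lemma runs_emit_field:
  assumes "i < length s" "i \<noteq> 0" "s ! i = syms u @ r" "\<not> is_bit (top_sym r)"
    "s' = s[i := r, 0 := rev (syms (code u)) @ s ! 0]"
  shows "runs (emit_field i) s (6 * length u + 3) s'"
proof -
  \<comment> \<open>The loop writes all of the code except its last letter \<open>False\<close>,
    which is the first letter of the reversed code and is removed by \<open>tl\<close>.\<close>
  have "runs (Loop (\<lambda>t. is_bit (t ! i)) (Push 0 2 ;; Copy i 0 ;; Pop i)) s (6 * length u + 1)
      (s[i := r, 0 := tl (rev (syms (code u))) @ s ! 0])"
    using assms(1-4)
  proof (induction u arbitrary: s)
    case Nil
    then have "s[i := r, 0 := tl (rev (syms (code []))) @ s ! 0] = s"
      by simp (metis list_update_id)
    then show ?case using Nil by (simp add: runs_Loop_end del: code_simps)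
  next
    case (Cons a u)
    let ?s = "s[i := syms u @ r, 0 := sym_of a # 2 # s ! 0]"
    have "0 < length s" using Cons.prems by linarith
    then have "s[0 := 2 # s ! 0] ! 0 = 2 # s ! 0" by simp
    then have 1: "runs (Push 0 2 ;; Copy i 0 ;; Pop i) s (2 + 3) ?s"
      using Cons.prems
      by (intro runs_Seq[OF runs_Push[of 0 s 2 "s[0 := 2 # s ! 0]"]
            runs_move1[where i = i and j = 0 and a = "sym_of a" and r = "syms u @ r"]])
        (auto simp: list_update_swap)
    have 2: "runs (Loop (\<lambda>t. is_bit (t ! i)) (Push 0 2 ;; Copy i 0 ;; Pop i)) ?s (6 * length u + 1)
        (?s[i := r, 0 := tl (rev (syms (code u))) @ ?s ! 0])"
      using Cons.prems by (intro Cons.IH) auto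
    have "?s[i := r, 0 := tl (rev (syms (code u))) @ ?s ! 0] =
        s[i := r, 0 := tl (rev (syms (code (a # u)))) @ s ! 0]"
      using Cons.prems by (cases s) (auto simp: list_update_swap nth_Cons' split: nat.splits)
    then show ?case using runs_Loop_step[OF _ 1 2] Cons.prems by simp
  qed
  moreover have "runs (Push 0 1) (s[i := r, 0 := tl (rev (syms (code u))) @ s ! 0]) 2 s'"
  proof (rule runs_Push)
    obtain z where z: "rev (syms (code u)) = 1 # z"
      by (simp add: code_def enc_list_def)
    moreover have "0 < length s" using assms(1) by linarith
    ultimately show "s' = (s[i := r, 0 := tl (rev (syms (code u))) @ s ! 0])
        [0 := 1 # s[i := r, 0 := tl (rev (syms (code u))) @ s ! 0] ! 0]"
      unfolding assms(5) z by simp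
  qed (use assms in auto)
  ultimately have "runs (emit_field i) s (6 * length u + 1 + 2) s'"
    unfolding emit_field_def by (rule runs_Seq)
  then show ?thesis by (rule runs_mono) simp
qed

section \<open>Walking towards a sink\<close>

definition skip_record :: com where
  "skip_record = move 2 3 (\<lambda>a. a \<noteq> 5 \<and> a \<noteq> 0) ;; (Copy 2 3 ;; Pop 2)"

lemma runs_skip_record:
  assumes "5 \<notin> set xs" "0 \<notin> set xs"
  shows "runs skip_record [out, i, xs @ 5 # r, b, h, g, x, c, k] (4 * length xs + 4)
    [out, i, r, 5 # rev xs @ b, h, g, x, c, k]"
proof -
  have "runs (move 2 3 (\<lambda>a. a \<noteq> 5 \<and> a \<noteq> 0)) [out, i, xs @ 5 # r, b, h, g, x, c, k] (4 * length xs + 1)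
      [out, i, 5 # r, rev xs @ b, h, g, x, c, k]"
    using assms by (intro runs_move[where r = "5 # r"]) (auto intro!: gr0I)
  moreover have "runs (Copy 2 3 ;; Pop 2) [out, i, 5 # r, rev xs @ b, h, g, x, c, k] 3
      [out, i, r, 5 # rev xs @ b, h, g, x, c, k]"
    by (rule runs_move1) auto
  ultimately have "runs skip_record [out, i, xs @ 5 # r, b, h, g, x, c, k] (4 * length xs + 1 + 3)
      [out, i, r, 5 # rev xs @ b, h, g, x, c, k]"
    unfolding skip_record_def by (rule runs_Seq)
  then show ?thesis by (rule runs_mono) simp
qed

text \<open>In both branches stack 5 ends up with what is missing on stack 4: the whole head of the
  arc if its tail matched, and otherwise the compared prefix of the current vertex. So one final
  \<open>move 5 4\<close> serves both.\<close>

definition walk_arc :: com where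
  "walk_arc = compare ;;
     Cond (\<lambda>t. t ! 4 = 3)
       (clear 5 nonblank ;; (Copy 2 3 ;; Pop 2) ;; copy_field)
       (clear 4 (\<lambda>a. a = 4)) ;;
     move 5 4 nonblank ;; skip_record"

lemma field_not_mem [simp]: "5 \<notin> set (field u)" "0 \<notin> set (field u)"
  by (auto simp: field_def)

lemma length_field [simp]: "length (field u) = Suc (length u)"
  by (simp add: field_def)

lemma length_record_of [simp]:
  "length (record_of (u, v, l, n, d)) = length u + length v + length l + length n + length d + 6"
  by (simp add: record_of_def)

lemma runs_walk_arc:
  "runs walk_arc [out, i, record_of e @ r, b, field h, [], x, c, k] (20 * length (record_of e))
    [out, i, r, rev (record_of e) @ b, field (if arc_tail e = h then arc_head e else h), [], x, c, k]"
proof -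
  obtain u v l n d where e: "e = (u, v, l, n, d)" by (cases e)
  define r1 where "r1 = field l @ field n @ field d"
  have A: "record_of e @ r = syms u @ 3 # syms v @ 3 # r1 @ 5 # r"
    unfolding e record_of_def r1_def by (simp add: field_def)
  have B: "rev (record_of e) @ b = 5 # rev r1 @ 3 # rev (syms v) @ 3 # rev (syms u) @ b"
    unfolding e record_of_def r1_def by (simp add: field_def)
  have r1: "5 \<notin> set r1" "0 \<notin> set r1" unfolding r1_def by auto
  have len: "length (record_of e) = length u + length v + length r1 + 3"
    unfolding e r1_def by simp
  have r1_len: "length r1 \<ge> 3" unfolding r1_def by simp
  let ?clear = "clear 5 nonblank ;; (Copy 2 3 ;; Pop 2) ;; copy_field"
  show ?thesis
  proof (cases "u = h")
    case True
    have 1: "runs compare [out, i, syms u @ 3 # syms v @ 3 # r1 @ 5 # r, b, field h, [], x, c, k]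
        (8 * length u + 1)
        [out, i, 3 # syms v @ 3 # r1 @ 5 # r, rev (syms u) @ b, [3], rev (syms u), x, c, k]"
      using runs_compare_eq[where h = "[3]" and g = "[]"] True by (simp add: field_def)
    have "runs (clear 5 nonblank)
        [out, i, 3 # syms v @ 3 # r1 @ 5 # r, rev (syms u) @ b, [3], rev (syms u), x, c, k]
        (2 * length (rev (syms u)) + 1)
        [out, i, 3 # syms v @ 3 # r1 @ 5 # r, rev (syms u) @ b, [3], [], x, c, k]"
      by (rule runs_clear[where r = "[]"]) auto
    moreover have "runs (Copy 2 3 ;; Pop 2)
        [out, i, 3 # syms v @ 3 # r1 @ 5 # r, rev (syms u) @ b, [3], [], x, c, k] 3
        [out, i, syms v @ 3 # r1 @ 5 # r, 3 # rev (syms u) @ b, [3], [], x, c, k]"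
      by (rule runs_move1) auto
    moreover have "runs copy_field
        [out, i, syms v @ 3 # r1 @ 5 # r, 3 # rev (syms u) @ b, [3], [], x, c, k] (6 * length v + 1)
        [out, i, 3 # r1 @ 5 # r, rev (syms v) @ 3 # rev (syms u) @ b, [3], rev (syms v), x, c, k]"
      using runs_copy_field[where g = "[]"] by simp
    ultimately have 2: "runs ?clear
        [out, i, 3 # syms v @ 3 # r1 @ 5 # r, rev (syms u) @ b, [3], rev (syms u), x, c, k]
        ((2 * length (rev (syms u)) + 1) + (3 + (6 * length v + 1)))
        [out, i, 3 # r1 @ 5 # r, rev (syms v) @ 3 # rev (syms u) @ b, [3], rev (syms v), x, c, k]"
      by (intro runs_Seq)
    have 3: "runs (Cond (\<lambda>t. t ! 4 = 3) ?clear (clear 4 (\<lambda>a. a = 4)))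
        [out, i, 3 # syms v @ 3 # r1 @ 5 # r, rev (syms u) @ b, [3], rev (syms u), x, c, k]
        (Suc ((2 * length (rev (syms u)) + 1) + (3 + (6 * length v + 1))))
        [out, i, 3 # r1 @ 5 # r, rev (syms v) @ 3 # rev (syms u) @ b, [3], rev (syms v), x, c, k]"
      by (rule runs_Cond) (use 2 in auto)
    have 4: "runs (move 5 4 nonblank)
        [out, i, 3 # r1 @ 5 # r, rev (syms v) @ 3 # rev (syms u) @ b, [3], rev (syms v), x, c, k]
        (4 * length (rev (syms v)) + 1)
        [out, i, 3 # r1 @ 5 # r, rev (syms v) @ 3 # rev (syms u) @ b, field v, [], x, c, k]"
      by (rule runs_move[where r = "[]"]) (auto simp: field_def)
    have 5: "runs skip_record
        [out, i, (3 # r1) @ 5 # r, rev (syms v) @ 3 # rev (syms u) @ b, field v, [], x, c, k]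
        (4 * length (3 # r1) + 4)
        [out, i, r, 5 # rev (3 # r1) @ rev (syms v) @ 3 # rev (syms u) @ b, field v, [], x, c, k]"
      by (rule runs_skip_record) (use r1 in auto)
    have "runs walk_arc [out, i, record_of e @ r, b, field h, [], x, c, k]
        ((8 * length u + 1) + (Suc ((2 * length (rev (syms u)) + 1) + (3 + (6 * length v + 1))) +
          ((4 * length (rev (syms v)) + 1) + (4 * length (3 # r1) + 4))))
        [out, i, r, rev (record_of e) @ b, field v, [], x, c, k]"
      unfolding walk_arc_def A B using runs_Seq[OF 1 runs_Seq[OF 3 runs_Seq[OF 4 5[simplified]]]] by simp
    then show ?thesis using True len r1_len by (auto intro: runs_mono simp: e)
  next
    case False
    then obtain j v1 v2 where *: "j \<le> length u" "length v1 \<le> length u" "h = v1 @ v2"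
      "top_sym (replicate j 4 @ field v2) \<noteq> 3"
      "runs compare [out, i, syms u @ 3 # syms v @ 3 # r1 @ 5 # r, b, field h, [], x, c, k] (8 * length u + 1)
      [out, i, 3 # syms v @ 3 # r1 @ 5 # r, rev (syms u) @ b, replicate j 4 @ field v2, rev (syms v1) @ [], x, c, k]"
      using runs_compare_neq by blast
    have 1: "runs compare [out, i, syms u @ 3 # syms v @ 3 # r1 @ 5 # r, b, field h, [], x, c, k] (8 * length u + 1)
      [out, i, 3 # syms v @ 3 # r1 @ 5 # r, rev (syms u) @ b, replicate j 4 @ field v2, rev (syms v1), x, c, k]"
      using *(5) by simp
    have 2: "runs (clear 4 (\<lambda>a. a = 4))
        [out, i, 3 # syms v @ 3 # r1 @ 5 # r, rev (syms u) @ b, replicate j 4 @ field v2, rev (syms v1), x, c, k]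
        (2 * length (replicate j (4 :: nat)) + 1)
        [out, i, 3 # syms v @ 3 # r1 @ 5 # r, rev (syms u) @ b, field v2, rev (syms v1), x, c, k]"
      by (rule runs_clear[where r = "field v2"]) (cases v2; auto simp: field_def)+
    have 3: "runs (Cond (\<lambda>t. t ! 4 = 3) ?clear (clear 4 (\<lambda>a. a = 4)))
        [out, i, 3 # syms v @ 3 # r1 @ 5 # r, rev (syms u) @ b, replicate j 4 @ field v2, rev (syms v1), x, c, k]
        (Suc (2 * length (replicate j (4 :: nat)) + 1))
        [out, i, 3 # syms v @ 3 # r1 @ 5 # r, rev (syms u) @ b, field v2, rev (syms v1), x, c, k]"
      by (rule runs_Cond) (use 2 *(4) in auto)
    have 4: "runs (move 5 4 nonblank)
        [out, i, 3 # syms v @ 3 # r1 @ 5 # r, rev (syms u) @ b, field v2, rev (syms v1), x, c, k]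
        (4 * length (rev (syms v1)) + 1)
        [out, i, 3 # syms v @ 3 # r1 @ 5 # r, rev (syms u) @ b, field h, [], x, c, k]"
      by (rule runs_move[where r = "[]"]) (auto simp: field_def *(3))
    have 5: "runs skip_record
        [out, i, (3 # syms v @ 3 # r1) @ 5 # r, rev (syms u) @ b, field h, [], x, c, k]
        (4 * length (3 # syms v @ 3 # r1) + 4)
        [out, i, r, 5 # rev (3 # syms v @ 3 # r1) @ rev (syms u) @ b, field h, [], x, c, k]"
      by (rule runs_skip_record) (use r1 in auto)
    have "runs walk_arc [out, i, record_of e @ r, b, field h, [], x, c, k]
        ((8 * length u + 1) + (Suc (2 * length (replicate j (4 :: nat)) + 1) +
          ((4 * length (rev (syms v1)) + 1) + (4 * length (3 # syms v @ 3 # r1) + 4))))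
        [out, i, r, rev (record_of e) @ b, field h, [], x, c, k]"
      unfolding walk_arc_def A B using runs_Seq[OF 1 runs_Seq[OF 3 runs_Seq[OF 4 5[simplified]]]] by simp
    then show ?thesis using False len r1_len *(1,2) by (auto intro: runs_mono simp: e)
  qed
qed

definition walk :: "bool list \<Rightarrow> arc list \<Rightarrow> bool list" where
  "walk = foldl (\<lambda>h e. if arc_tail e = h then arc_head e else h)"

definition walk_pass :: com where
  "walk_pass = Loop (\<lambda>t. nonblank (t ! 2)) walk_arc ;; move 3 2 nonblank"

lemma top_record_of [simp]: "nonblank (top_sym (record_of e @ r))"
  by (cases e; cases "fst e") (auto simp: record_of_def field_def)

lemma zero_not_in_records [simp]: "0 \<notin> set (record_of e)"
  by (auto simp: record_of_def split: prod.splits)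

lemma length_record_of_pos: "length (record_of e) \<ge> 6"
  by (cases e) simp

lemma runs_walk_pass:
  "runs walk_pass [out, i, records es, [], field h, [], x, c, k] (25 * length (records es) + 2)
    [out, i, records es, [], field (walk h es), [], x, c, k]"
proof -
  have "runs (Loop (\<lambda>t. nonblank (t ! 2)) walk_arc) [out, i, records es, b, field h, [], x, c, k]
      (21 * length (records es) + 1)
      [out, i, [], rev (records es) @ b, field (walk h es), [], x, c, k]" for b
  proof (induction es arbitrary: b h)
    case Nil
    then show ?case by (auto intro: runs_Loop_end simp: walk_def)
  next
    case (Cons e es)
    have 1: "walk (if arc_tail e = h then arc_head e else h) es = walk h (e # es)"
      by (simp add: walk_def)
    have 2: "rev (records es) @ rev (record_of e) @ b = rev (records (e # es)) @ b" by simp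
    have 3: "runs walk_arc [out, i, records (e # es), b, field h, [], x, c, k] (20 * length (record_of e))
        [out, i, records es, rev (record_of e) @ b, field (if arc_tail e = h then arc_head e else h), [], x, c, k]"
      using runs_walk_arc by simp
    show ?case
      by (rule runs_Loop_step[OF _ 3 Cons.IH[of "rev (record_of e) @ b" "if arc_tail e = h then arc_head e else h", unfolded 1 2]])
        (use length_record_of_pos[of e] in simp_all)
  qed
  from this[of "[]"] have 1: "runs (Loop (\<lambda>t. nonblank (t ! 2)) walk_arc) [out, i, records es, [], field h, [], x, c, k]
      (21 * length (records es) + 1)
      [out, i, [], rev (records es), field (walk h es), [], x, c, k]"
    by simp
  have 2: "runs (move 3 2 nonblank) [out, i, [], rev (records es), field (walk h es), [], x, c, k]
      (4 * length (rev (records es)) + 1) [out, i, records es, [], field (walk h es), [], x, c, k]"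
    by (rule runs_move[where r = "[]"]) (auto simp: nonblank_def intro!: gr0I)
  show ?thesis unfolding walk_pass_def using runs_Seq[OF 1 2] by (auto intro: runs_mono)
qed

section \<open>Emitting the edges into a sink\<close>

text \<open>A zero digit is encoded as the list marker \<open>True\<close> followed by the digit
  \<open>False\<close>. As there is no terminator, the digits of another number can follow.\<close>

definition pad :: "nat \<Rightarrow> bool list" where
  "pad n = concat (replicate n [True, False])"

lemma pad_simps [simp]: "pad 0 = []" "pad (Suc n) = True # False # pad n"
  by (simp_all add: pad_def)

lemma code_replicate_False: "code (replicate n False @ u) = pad n @ code u"
  by (induction n) auto

text \<open>The counter is kept on stack \<open>j\<close> because it is needed twice: for the budget
  and for the denominator of the weight. The second use moves it back and restores its
  order.\<close>

definition emit_pad :: "nat \<Rightarrow> nat \<Rightarrow> com" where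
  "emit_pad i j = Loop (\<lambda>t. nonblank (t ! i)) (Push 0 2 ;; Push 0 1 ;; (Copy i j ;; Pop i))"

lemma runs_emit_pad:
  assumes "i < length s" "j < length s" "i \<noteq> j" "i \<noteq> 0" "j \<noteq> 0" "0 \<notin> set (s ! i)" "s ! i = xs"
    "s' = s[i := [], j := rev xs @ s ! j, 0 := rev (syms (pad (length xs))) @ s ! 0]"
  shows "runs (emit_pad i j) s (8 * length xs + 1) s'"
  using assms
proof (induction xs arbitrary: s)
  case Nil
  then have "s' = s" by simp (metis list_update_id)
  then show ?case using Nil unfolding emit_pad_def by (auto intro: runs_Loop_end)
next
  case (Cons a xs)
  let ?s = "s[i := xs, j := a # s ! j, 0 := 1 # 2 # s ! 0]"
  have len: "0 < length s" using Cons.prems by linarith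
  have a: "a \<noteq> 0" using Cons.prems by auto
  have "runs (Push 0 2) s 2 (s[0 := 2 # s ! 0])"
    using len by (intro runs_Push) auto
  moreover have "runs (Push 0 1) (s[0 := 2 # s ! 0]) 2 (s[0 := 1 # 2 # s ! 0])"
    using len by (intro runs_Push) auto
  moreover have "runs (Copy i j ;; Pop i) (s[0 := 1 # 2 # s ! 0]) 3 ?s"
    using Cons.prems a
    by (intro runs_move1[where a = a and r = xs]) (auto simp: list_update_swap)
  ultimately have 1: "runs (Push 0 2 ;; Push 0 1 ;; (Copy i j ;; Pop i)) s (2 + (2 + 3)) ?s"
    by (intro runs_Seq)
  have 2: "runs (emit_pad i j) ?s (8 * length xs + 1) s'"
    using Cons.prems len
    by (intro Cons.IH) (auto simp: list_update_swap)
  show ?case unfolding emit_pad_def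
    using Cons.prems a
    by (intro runs_Loop_step[OF _ 1 2[unfolded emit_pad_def]]) (auto simp: nonblank_def)
qed

text \<open>The number with the digits \<open>l\<close>, cut off after \<open>k\<close> digits,
  times \<open>w\<close>. The conversion to unary is unrolled into the program, one digit at a time,
  so the number of digits is fixed; this also bounds the exponents on malformed inputs.\<close>

fun label_value :: "nat \<Rightarrow> nat \<Rightarrow> bool list \<Rightarrow> nat" where
  "label_value 0 w l = 0"
| "label_value (Suc k) w [] = 0"
| "label_value (Suc k) w (b # l) = (if b then w else 0) + label_value k (2 * w) l"

fun read_label :: "nat \<Rightarrow> nat \<Rightarrow> com" where
  "read_label 0 w = clear 2 is_bit"
| "read_label (Suc k) w = Cond (\<lambda>t. is_bit (t ! 2))
     (Cond (\<lambda>t. t ! 2 = 2) (pushes 7 2 w) skip ;; Pop 2 ;; read_label k (2 * w)) skip"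

lemma runs_read_label:
  "runs (read_label m w) [out, i, syms l @ 3 # r, b, h, g, x, c, k]
    (4 * length l + 2 * label_value m w l + 2)
    [out, i, 3 # r, b, h, g, x, replicate (label_value m w l) 2 @ c, k]"
proof (induction m w l arbitrary: c rule: label_value.induct)
  case (1 w l)
  have "runs (clear 2 is_bit) [out, i, syms l @ 3 # r, b, h, g, x, c, k] (2 * length (syms l) + 1)
    [out, i, 3 # r, b, h, g, x, c, k]"
    by (rule runs_clear[where r = "3 # r"]) auto
  then show ?case by (auto intro: runs_mono)
next
  case (2 m w)
  have "runs (read_label (Suc m) w) [out, i, 3 # r, b, h, g, x, c, k] (Suc 1)
    [out, i, 3 # r, b, h, g, x, c, k]"
    unfolding read_label.simps by (rule runs_Cond) (auto intro: runs_Loop_end)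
  then show ?case by (auto intro: runs_mono)
next
  case (3 m w a l)
  define c1 where "c1 = replicate (if a then w else 0) 2 @ c"
  have 1: "runs (Cond (\<lambda>t. t ! 2 = 2) (pushes 7 2 w) skip) [out, i, syms (a # l) @ 3 # r, b, h, g, x, c, k]
    (Suc (2 * (if a then w else 0) + 1)) [out, i, syms (a # l) @ 3 # r, b, h, g, x, c1, k]"
    by (rule runs_Cond) (cases a; auto simp: c1_def intro!: runs_pushes[where n = w, simplified] runs_Loop_end)+
  have 2: "runs (Pop 2) [out, i, syms (a # l) @ 3 # r, b, h, g, x, c1, k] 1
      [out, i, syms l @ 3 # r, b, h, g, x, c1, k]"
    by (rule runs_Pop) auto
  have 3: "runs (read_label m (2 * w)) [out, i, syms l @ 3 # r, b, h, g, x, c1, k]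
    (4 * length l + 2 * label_value m (2 * w) l + 2)
    [out, i, 3 # r, b, h, g, x, replicate (label_value m (2 * w) l) 2 @ c1, k]"
    by (rule 3)
  have 4: "replicate (label_value m (2 * w) l) 2 @ c1 = replicate (label_value (Suc m) w (a # l)) 2 @ c"
    by (simp add: c1_def replicate_add[symmetric] add.commute flip: append_assoc)
  have "runs (read_label (Suc m) w) [out, i, syms (a # l) @ 3 # r, b, h, g, x, c, k]
    (Suc (Suc (2 * (if a then w else 0) + 1) + (1 + (4 * length l + 2 * label_value m (2 * w) l + 2))))
    [out, i, 3 # r, b, h, g, x, replicate (label_value (Suc m) w (a # l)) 2 @ c, k]"
    unfolding read_label.simps
    by (rule runs_Cond) (use runs_Seq[OF 1 runs_Seq[OF 2 3]] in \<open>auto simp: 4\<close>)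
  then show ?case by (rule runs_mono) simp
qed

text \<open>The first symbol is the list marker of \<open>enc_list\<close>. The head lies on top of
  stack 3 and is therefore emitted before the tail; the edge is undirected anyway.\<close>

definition emit_ends :: com where
  "emit_ends = Push 0 2 ;; move 3 6 is_bit ;; emit_field 6 ;; Pop 3 ;; move 3 6 is_bit ;; emit_field 6"

lemma runs_emit_ends:
  assumes "\<not> is_bit (top_sym b)"
  shows "runs emit_ends [out, i, a, rev (syms v) @ 3 # rev (syms u) @ b, h, g, [], c, k]
    (10 * length u + 10 * length v + 11)
    [rev (syms (True # code v @ code u)) @ out, i, a, b, h, g, [], c, k]"
proof -
  let ?o1 = "rev (syms [True]) @ out" and ?o2 = "rev (syms (True # code v)) @ out"
    and ?o3 = "rev (syms (True # code v @ code u)) @ out"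
  have 1: "runs (Push 0 2) [out, i, a, rev (syms v) @ 3 # rev (syms u) @ b, h, g, [], c, k] 2
      [?o1, i, a, rev (syms v) @ 3 # rev (syms u) @ b, h, g, [], c, k]"
    by (rule runs_Push) auto
  have 2: "runs (move 3 6 is_bit) [?o1, i, a, rev (syms v) @ 3 # rev (syms u) @ b, h, g, [], c, k]
      (4 * length (rev (syms v)) + 1) [?o1, i, a, 3 # rev (syms u) @ b, h, g, syms v, c, k]"
    by (rule runs_move[where r = "3 # rev (syms u) @ b"]) auto
  have 3: "runs (emit_field 6) [?o1, i, a, 3 # rev (syms u) @ b, h, g, syms v, c, k]
      (6 * length v + 3) [?o2, i, a, 3 # rev (syms u) @ b, h, g, [], c, k]"
    by (rule runs_emit_field[where r = "[]"]) auto
  have 4: "runs (Pop 3) [?o2, i, a, 3 # rev (syms u) @ b, h, g, [], c, k] 1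
      [?o2, i, a, rev (syms u) @ b, h, g, [], c, k]"
    by (rule runs_Pop) auto
  have 5: "runs (move 3 6 is_bit) [?o2, i, a, rev (syms u) @ b, h, g, [], c, k]
      (4 * length (rev (syms u)) + 1) [?o2, i, a, b, h, g, syms u, c, k]"
    by (rule runs_move[where r = b]) (use assms in auto)
  have 6: "runs (emit_field 6) [?o2, i, a, b, h, g, syms u, c, k] (6 * length u + 3)
      [?o3, i, a, b, h, g, [], c, k]"
    by (rule runs_emit_field[where r = "[]"]) auto
  show ?thesis unfolding emit_ends_def
    by (rule runs_mono[OF runs_Seq[OF 1 runs_Seq[OF 2 runs_Seq[OF 3 runs_Seq[OF 4 runs_Seq[OF 5 6]]]]]]) simp
qed

text \<open>Writes the fraction \<open>2^E / 1\<close>. Each group of three pushes is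
  \<open>code [True]\<close>: the first completes the padding to the power of 2, the second is the
  denominator.\<close>

definition emit_budget :: "nat \<Rightarrow> nat \<Rightarrow> com" where
  "emit_budget T K = Pop 2 ;; read_label T K ;; Pop 2 ;; emit_pad 7 6 ;;
     (Push 0 2 ;; Push 0 2 ;; Push 0 1) ;; (Push 0 2 ;; Push 0 2 ;; Push 0 1)"

lemma runs_emit_one:
  "runs (Push 0 2 ;; Push 0 2 ;; Push 0 1) (out # s) 6 ((rev (syms (code [True])) @ out) # s)"
proof -
  have "runs (Push 0 2 ;; Push 0 2 ;; Push 0 1) (out # s) (2 + (2 + 2)) ((1 # 2 # 2 # out) # s)"
    by (intro runs_Seq runs_Push) auto
  then show ?thesis by simp
qed

lemma runs_emit_budget:
  assumes "E = label_value T K l + length c" "0 \<notin> set c"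
  shows "runs (emit_budget T K) [out, i, 3 # field l @ r, b, h, g, [], c, k]
    (4 * length l + 10 * E + 17)
    [rev (syms (pad E @ code [True] @ code [True])) @ out, i, r, b, h, g,
      rev (replicate (label_value T K l) 2 @ c), [], k]"
proof -
  let ?lc = "replicate (label_value T K l) 2 @ c"
  have 1: "runs (Pop 2) [out, i, 3 # field l @ r, b, h, g, [], c, k] 1
      [out, i, syms l @ 3 # r, b, h, g, [], c, k]"
    by (rule runs_Pop) (auto simp: field_def)
  have 2: "runs (read_label T K) [out, i, syms l @ 3 # r, b, h, g, [], c, k]
      (4 * length l + 2 * label_value T K l + 2) [out, i, 3 # r, b, h, g, [], ?lc, k]"
    by (rule runs_read_label)
  have 3: "runs (Pop 2) [out, i, 3 # r, b, h, g, [], ?lc, k] 1 [out, i, r, b, h, g, [], ?lc, k]"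
    by (rule runs_Pop) auto
  have 4: "runs (emit_pad 7 6) [out, i, r, b, h, g, [], ?lc, k] (8 * length ?lc + 1)
      [rev (syms (pad E)) @ out, i, r, b, h, g, rev ?lc, [], k]"
    by (rule runs_emit_pad) (use assms in auto)
  have 5: "runs (Push 0 2 ;; Push 0 2 ;; Push 0 1)
      [rev (syms (pad E)) @ out, i, r, b, h, g, rev ?lc, [], k] 6
      [rev (syms (pad E @ code [True])) @ out, i, r, b, h, g, rev ?lc, [], k]"
    using runs_emit_one[of "rev (syms (pad E)) @ out"] by simp
  have 6: "runs (Push 0 2 ;; Push 0 2 ;; Push 0 1)
      [rev (syms (pad E @ code [True])) @ out, i, r, b, h, g, rev ?lc, [], k] 6
      [rev (syms (pad E @ code [True] @ code [True])) @ out, i, r, b, h, g, rev ?lc, [], k]"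
    using runs_emit_one[of "rev (syms (pad E @ code [True])) @ out"] by simp
  show ?thesis unfolding emit_budget_def
    by (rule runs_mono[OF runs_Seq[OF 1 runs_Seq[OF 2 runs_Seq[OF 3 runs_Seq[OF 4 runs_Seq[OF 5 6]]]]]])
      (use assms in simp)
qed

text \<open>Dividing by \<open>2^E\<close> pads the denominator and leaves the numerator alone.
  Finally the contribution of the label, in symbols 2, is removed from the counter, so that the next
  arc finds the base exponent again.\<close>

definition emit_weight :: com where
  "emit_weight = emit_field 2 ;; Pop 2 ;; emit_pad 6 7 ;; emit_field 2 ;; Pop 2 ;; Pop 2 ;; clear 7 (\<lambda>a. a = 2)"

lemma runs_emit_weight:
  assumes "E = m + length c" "0 \<notin> set c" "top_sym c \<noteq> 2"
  shows "runs emit_weight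
    [out, i, field n @ field d @ 5 # r, b, h, g, rev (replicate m 2 @ c), [], k]
    (6 * length n + 6 * length d + 10 * E + 11)
    [rev (syms (code n @ pad E @ code d)) @ out, i, r, b, h, g, [], c, k]"
proof -
  let ?mc = "replicate m 2 @ c"
  let ?o1 = "rev (syms (code n)) @ out" and ?o2 = "rev (syms (code n @ pad E)) @ out"
    and ?o3 = "rev (syms (code n @ pad E @ code d)) @ out"
  have 1: "runs (emit_field 2) [out, i, field n @ field d @ 5 # r, b, h, g, rev ?mc, [], k]
      (6 * length n + 3) [?o1, i, 3 # field d @ 5 # r, b, h, g, rev ?mc, [], k]"
    by (rule runs_emit_field[where r = "3 # field d @ 5 # r"]) (auto simp: field_def)
  have 2: "runs (Pop 2) [?o1, i, 3 # field d @ 5 # r, b, h, g, rev ?mc, [], k] 1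
      [?o1, i, field d @ 5 # r, b, h, g, rev ?mc, [], k]"
    by (rule runs_Pop) auto
  have 3: "runs (emit_pad 6 7) [?o1, i, field d @ 5 # r, b, h, g, rev ?mc, [], k]
      (8 * length (rev ?mc) + 1) [?o2, i, field d @ 5 # r, b, h, g, [], ?mc, k]"
    by (rule runs_emit_pad) (use assms(2) in \<open>auto simp: assms(1) add.commute\<close>)
  have 4: "runs (emit_field 2) [?o2, i, field d @ 5 # r, b, h, g, [], ?mc, k] (6 * length d + 3)
      [?o3, i, 3 # 5 # r, b, h, g, [], ?mc, k]"
    by (rule runs_emit_field[where r = "3 # 5 # r"]) (auto simp: field_def)
  have 5: "runs (Pop 2) [?o3, i, 3 # 5 # r, b, h, g, [], ?mc, k] 1 [?o3, i, 5 # r, b, h, g, [], ?mc, k]"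
    by (rule runs_Pop) auto
  have 6: "runs (Pop 2) [?o3, i, 5 # r, b, h, g, [], ?mc, k] 1 [?o3, i, r, b, h, g, [], ?mc, k]"
    by (rule runs_Pop) auto
  have 7: "runs (clear 7 (\<lambda>a. a = 2)) [?o3, i, r, b, h, g, [], ?mc, k]
      (2 * length (replicate m (2 :: nat)) + 1) [?o3, i, r, b, h, g, [], c, k]"
    by (rule runs_clear[where r = c]) (use assms in auto)
  show ?thesis unfolding emit_weight_def
    by (rule runs_mono[OF runs_Seq[OF 1 runs_Seq[OF 2 runs_Seq[OF 3 runs_Seq[OF 4
            runs_Seq[OF 5 runs_Seq[OF 6 7]]]]]]]) (use assms in simp)
qed


text \<open>The emitted arc is not put on stack 3, and this is how it gets deleted.\<close>

definition emit_arc :: "nat \<Rightarrow> nat \<Rightarrow> com" where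
  "emit_arc T K = move 2 3 is_bit ;; (Copy 2 3 ;; Pop 2) ;; compare ;;
     Cond (\<lambda>t. t ! 4 = 3) (emit_ends ;; emit_budget T K ;; emit_weight)
       (clear 4 (\<lambda>a. a = 4) ;; skip_record) ;;
     move 5 4 nonblank"

definition exponent :: "nat \<Rightarrow> nat \<Rightarrow> arc \<Rightarrow> nat \<Rightarrow> nat" where
  "exponent T K e s = (case e of (u, v, l, n, d) \<Rightarrow> label_value T K l + s)"

definition edge_code :: "arc \<Rightarrow> nat \<Rightarrow> bool list" where
  "edge_code e E = (case e of (u, v, l, n, d) \<Rightarrow>
     True # code v @ code u @ pad E @ code [True] @ code [True] @ code n @ pad E @ code d)"

lemma label_value_le: "label_value m w l + w \<le> w * 2 ^ m"
  by (induction m w l rule: label_value.induct) (auto simp: algebra_simps)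

lemma runs_emit_arc:
  assumes "\<not> is_bit (top_sym b)" "Q = K * 2 ^ T + s"
  shows "runs (emit_arc T K)
    [out, i, record_of e @ r, b, field h, [], [], replicate s 1, k]
    ((50 + 20 * Q) * length (record_of e))
    (if arc_head e = h
     then [rev (syms (edge_code e (exponent T K e s))) @ out, i, r, b, field h, [], [], replicate s 1, k]
     else [out, i, r, rev (record_of e) @ b, field h, [], [], replicate s 1, k])"
proof -
  obtain u v l n d where e: "e = (u, v, l, n, d)" by (cases e)
  define r1 where "r1 = field l @ field n @ field d"
  define b1 where "b1 = 3 # rev (syms u) @ b"
  define c where "c = replicate s (1 :: nat)"
  define E where "E = label_value T K l + s"
  have A: "record_of e @ r = syms u @ 3 # syms v @ 3 # r1 @ 5 # r"
    unfolding e record_of_def r1_def by (simp add: field_def)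
  have B: "rev (record_of e) @ b = 5 # rev r1 @ 3 # rev (syms v) @ b1"
    unfolding e record_of_def r1_def b1_def by (simp add: field_def)
  have r1: "5 \<notin> set r1" "0 \<notin> set r1" unfolding r1_def by auto
  have c: "0 \<notin> set c" "top_sym c \<noteq> 2" "length c = s" unfolding c_def by (cases s; auto)+
  have len: "length (record_of e) = length u + length v + length r1 + 3"
    unfolding e r1_def by simp
  have r1_len: "length r1 = length l + length n + length d + 3" unfolding r1_def by simp
  have E_le: "E \<le> Q" using label_value_le[of T K l] unfolding E_def assms(2) by linarith
  \<comment> \<open>The two paddings cost \<open>20 * E\<close> steps. A record has at least six
    symbols, so a charge of \<open>20 * Q\<close> per symbol covers them.\<close>
  have "Q * 6 \<le> Q * length (record_of e)" using length_record_of_pos by (rule mult_le_mono2)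
  then have QL: "(50 + 20 * Q) * length (record_of e) \<ge> 50 * length (record_of e) + 120 * Q"
    by (simp add: algebra_simps)
  let ?emit = "emit_ends ;; emit_budget T K ;; emit_weight"
  let ?keep = "clear 4 (\<lambda>a. a = 4) ;; skip_record"
  have 1: "runs (move 2 3 is_bit) [out, i, syms u @ 3 # syms v @ 3 # r1 @ 5 # r, b, field h, [], [], c, k]
      (4 * length (syms u) + 1)
      [out, i, 3 # syms v @ 3 # r1 @ 5 # r, rev (syms u) @ b, field h, [], [], c, k]"
    by (rule runs_move[where r = "3 # syms v @ 3 # r1 @ 5 # r"]) auto
  have 2: "runs (Copy 2 3 ;; Pop 2)
      [out, i, 3 # syms v @ 3 # r1 @ 5 # r, rev (syms u) @ b, field h, [], [], c, k] 3
      [out, i, syms v @ 3 # r1 @ 5 # r, b1, field h, [], [], c, k]"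
    by (rule runs_move1) (auto simp: b1_def)
  note 12 = runs_Seq[OF 1 runs_Seq[OF 2]]
  show ?thesis
  proof (cases "v = h")
    case True
    have 3: "runs compare [out, i, syms v @ 3 # r1 @ 5 # r, b1, field h, [], [], c, k] (8 * length v + 1)
        [out, i, 3 # r1 @ 5 # r, rev (syms v) @ b1, [3], rev (syms v), [], c, k]"
      using runs_compare_eq[where h = "[3]" and g = "[]"] True by (simp add: field_def)
    have 4: "runs emit_ends [out, i, 3 # r1 @ 5 # r, rev (syms v) @ b1, [3], rev (syms v), [], c, k]
        (10 * length u + 10 * length v + 11)
        [rev (syms (True # code v @ code u)) @ out, i, 3 # r1 @ 5 # r, b, [3], rev (syms v), [], c, k]"
      unfolding b1_def by (rule runs_emit_ends) fact
    have 5: "runs (emit_budget T K)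
        [rev (syms (True # code v @ code u)) @ out, i, 3 # r1 @ 5 # r, b, [3], rev (syms v), [], c, k]
        (4 * length l + 10 * E + 17)
        [rev (syms (pad E @ code [True] @ code [True])) @ rev (syms (True # code v @ code u)) @ out, i,
          field n @ field d @ 5 # r, b, [3], rev (syms v), rev (replicate (label_value T K l) 2 @ c), [], k]"
      unfolding r1_def append_assoc by (rule runs_emit_budget) (use c in \<open>auto simp: E_def\<close>)
    have 6: "runs emit_weight
        [rev (syms (pad E @ code [True] @ code [True])) @ rev (syms (True # code v @ code u)) @ out, i,
          field n @ field d @ 5 # r, b, [3], rev (syms v), rev (replicate (label_value T K l) 2 @ c), [], k]
        (6 * length n + 6 * length d + 10 * E + 11)
        [rev (syms (code n @ pad E @ code d)) @
          rev (syms (pad E @ code [True] @ code [True])) @ rev (syms (True # code v @ code u)) @ out, i,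
          r, b, [3], rev (syms v), [], c, k]"
      by (rule runs_emit_weight) (use c in \<open>auto simp: E_def\<close>)
    have out: "rev (syms (code n @ pad E @ code d)) @
          rev (syms (pad E @ code [True] @ code [True])) @ rev (syms (True # code v @ code u)) @ out =
        rev (syms (edge_code e (exponent T K e s))) @ out"
      unfolding e edge_code_def exponent_def E_def by simp
    have 7: "runs (Cond (\<lambda>t. t ! 4 = 3) ?emit ?keep)
        [out, i, 3 # r1 @ 5 # r, rev (syms v) @ b1, [3], rev (syms v), [], c, k]
        (Suc ((10 * length u + 10 * length v + 11) + ((4 * length l + 10 * E + 17) +
          (6 * length n + 6 * length d + 10 * E + 11))))
        [rev (syms (edge_code e (exponent T K e s))) @ out, i, r, b, [3], rev (syms v), [], c, k]"
      by (rule runs_Cond) (use runs_Seq[OF 4 runs_Seq[OF 5 6]] in \<open>auto simp only: out\<close>, simp)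
    have 8: "runs (move 5 4 nonblank)
        [rev (syms (edge_code e (exponent T K e s))) @ out, i, r, b, [3], rev (syms v), [], c, k]
        (4 * length (rev (syms v)) + 1)
        [rev (syms (edge_code e (exponent T K e s))) @ out, i, r, b, field h, [], [], c, k]"
      by (rule runs_move[where r = "[]"]) (auto simp: field_def True)
    have "runs (emit_arc T K) [out, i, record_of e @ r, b, field h, [], [], c, k]
      ((50 + 20 * Q) * length (record_of e))
      [rev (syms (edge_code e (exponent T K e s))) @ out, i, r, b, field h, [], [], c, k]"
      unfolding emit_arc_def A
      by (rule runs_mono[OF 12[OF runs_Seq[OF 3 runs_Seq[OF 7 8]]]])
        (use QL len r1_len E_le in simp)
    then show ?thesis using True by (simp add: e c_def)
  next
    case False
    then obtain j v1 v2 where *: "j \<le> length v" "length v1 \<le> length v" "h = v1 @ v2"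
      "top_sym (replicate j 4 @ field v2) \<noteq> 3"
      "runs compare [out, i, syms v @ 3 # r1 @ 5 # r, b1, field h, [], [], c, k] (8 * length v + 1)
      [out, i, 3 # r1 @ 5 # r, rev (syms v) @ b1, replicate j 4 @ field v2, rev (syms v1) @ [], [], c, k]"
      using runs_compare_neq by blast
    have 3: "runs compare [out, i, syms v @ 3 # r1 @ 5 # r, b1, field h, [], [], c, k] (8 * length v + 1)
      [out, i, 3 # r1 @ 5 # r, rev (syms v) @ b1, replicate j 4 @ field v2, rev (syms v1), [], c, k]"
      using *(5) by simp
    have 4: "runs (clear 4 (\<lambda>a. a = 4))
        [out, i, 3 # r1 @ 5 # r, rev (syms v) @ b1, replicate j 4 @ field v2, rev (syms v1), [], c, k]
        (2 * length (replicate j (4 :: nat)) + 1)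
        [out, i, 3 # r1 @ 5 # r, rev (syms v) @ b1, field v2, rev (syms v1), [], c, k]"
      by (rule runs_clear[where r = "field v2"]) (cases v2; auto simp: field_def)+
    have 5: "runs skip_record
        [out, i, (3 # r1) @ 5 # r, rev (syms v) @ b1, field v2, rev (syms v1), [], c, k]
        (4 * length (3 # r1) + 4)
        [out, i, r, 5 # rev (3 # r1) @ rev (syms v) @ b1, field v2, rev (syms v1), [], c, k]"
      by (rule runs_skip_record) (use r1 in auto)
    have 6: "runs (Cond (\<lambda>t. t ! 4 = 3) ?emit ?keep)
        [out, i, 3 # r1 @ 5 # r, rev (syms v) @ b1, replicate j 4 @ field v2, rev (syms v1), [], c, k]
        (Suc ((2 * length (replicate j (4 :: nat)) + 1) + (4 * length (3 # r1) + 4)))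
        [out, i, r, rev (record_of e) @ b, field v2, rev (syms v1), [], c, k]"
      by (rule runs_Cond) (use runs_Seq[OF 4 5[simplified]] *(4) in \<open>auto simp: B\<close>)
    have 7: "runs (move 5 4 nonblank)
        [out, i, r, rev (record_of e) @ b, field v2, rev (syms v1), [], c, k]
        (4 * length (rev (syms v1)) + 1)
        [out, i, r, rev (record_of e) @ b, field h, [], [], c, k]"
      by (rule runs_move[where r = "[]"]) (auto simp: field_def *(3))
    have "runs (emit_arc T K) [out, i, record_of e @ r, b, field h, [], [], c, k]
      ((50 + 20 * Q) * length (record_of e))
      [out, i, r, rev (record_of e) @ b, field h, [], [], c, k]"
      unfolding emit_arc_def A
      by (rule runs_mono[OF 12[OF runs_Seq[OF 3 runs_Seq[OF 6 7]]]])
        (use QL len r1_len *(1,2) in simp)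
    then show ?thesis using False by (simp add: e c_def)
  qed
qed

definition emit_pass :: "nat \<Rightarrow> nat \<Rightarrow> com" where
  "emit_pass T K = Loop (\<lambda>t. nonblank (t ! 2)) (emit_arc T K) ;; move 3 2 nonblank"

lemma top_rev_record_of [simp]: "\<not> is_bit (top_sym (rev (record_of e) @ b))"
  by (cases e) (simp add: record_of_def)

lemma runs_emit_pass:
  assumes "Q = K * 2 ^ T + s"
  shows "runs (emit_pass T K)
    [out, i, records es, [], field h, [], [], replicate s 1, k]
    ((55 + 20 * Q) * length (records es) + 2)
    [rev (syms (concat (map (\<lambda>e. edge_code e (exponent T K e s)) (filter (\<lambda>e. arc_head e = h) es)))) @ out,
      i, records (filter (\<lambda>e. arc_head e \<noteq> h) es), [], field h, [], [], replicate s 1, k]"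
proof -
  define emitted where "emitted es = rev (syms (concat (map (\<lambda>e. edge_code e (exponent T K e s))
      (filter (\<lambda>e. arc_head e = h) es))))" for es
  define kept where "kept = filter (\<lambda>e. arc_head e \<noteq> h)"
  \<comment> \<open>Below the current record stack 3 must not show a digit, since the tail is taken
    off again up to the first symbol that is not a digit. It shows either nothing or the 5 that ends
    a record.\<close>
  have "runs (Loop (\<lambda>t. nonblank (t ! 2)) (emit_arc T K))
      [out, i, records es, b, field h, [], [], replicate s 1, k]
      ((51 + 20 * Q) * length (records es) + 1)
      [emitted es @ out, i, [], rev (records (kept es)) @ b, field h, [], [], replicate s 1, k]"
    if "\<not> is_bit (top_sym b)" for b
    using that
  proof (induction es arbitrary: b out)
    case Nil
    then show ?case by (auto intro: runs_Loop_end simp: emitted_def kept_def)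
  next
    case (Cons e es)
    have len: "Suc ((50 + 20 * Q) * length (record_of e) + ((51 + 20 * Q) * length (records es) + 1))
        \<le> (51 + 20 * Q) * length (records (e # es)) + 1"
      using length_record_of_pos[of e] by (simp add: algebra_simps)
    have 1: "runs (emit_arc T K)
        [out, i, records (e # es), b, field h, [], [], replicate s 1, k]
        ((50 + 20 * Q) * length (record_of e))
        (if arc_head e = h
         then [rev (syms (edge_code e (exponent T K e s))) @ out, i, records es, b, field h, [], [], replicate s 1, k]
         else [out, i, records es, rev (record_of e) @ b, field h, [], [], replicate s 1, k])"
      using runs_emit_arc[OF Cons.prems assms] by simp
    show ?case
    proof (cases "arc_head e = h")
      case True
      have "emitted (e # es) = emitted es @ rev (syms (edge_code e (exponent T K e s)))"
        "kept (e # es) = kept es"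
        unfolding emitted_def kept_def using True by auto
      then show ?thesis
        using runs_Loop_step[OF _ 1[unfolded if_P[OF True]] Cons.IH[OF Cons.prems] len] by simp
    next
      case False
      have "emitted (e # es) = emitted es" "kept (e # es) = e # kept es"
        unfolding emitted_def kept_def using False by auto
      then show ?thesis
        using runs_Loop_step[OF _ 1[unfolded if_not_P[OF False]] Cons.IH[OF top_rev_record_of] len] by simp
    qed
  qed
  from this[of "[]"] have 1: "runs (Loop (\<lambda>t. nonblank (t ! 2)) (emit_arc T K))
      [out, i, records es, [], field h, [], [], replicate s 1, k]
      ((51 + 20 * Q) * length (records es) + 1)
      [emitted es @ out, i, [], rev (records (kept es)), field h, [], [], replicate s 1, k]"
    by simp
  have 2: "runs (move 3 2 nonblank)
      [emitted es @ out, i, [], rev (records (kept es)), field h, [], [], replicate s 1, k]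
      (4 * length (rev (records (kept es))) + 1)
      [emitted es @ out, i, records (kept es), [], field h, [], [], replicate s 1, k]"
    by (rule runs_move[where r = "[]"]) (auto simp: nonblank_def intro!: gr0I)
  have "length (records (kept es)) \<le> length (records es)"
    unfolding kept_def by (induction es) auto
  then show ?thesis
    unfolding emit_pass_def emitted_def[symmetric] kept_def[symmetric]
    by (intro runs_mono[OF runs_Seq[OF 1 2]]) (simp add: algebra_simps)
qed


section \<open>The main loop\<close>

text \<open>Starting in a head keeps the walk among heads. So some arc enters its last vertex, and
  the round makes progress on every input.\<close>

definition pick_head :: com where
  "pick_head = move 2 3 is_bit ;; (Copy 2 3 ;; Pop 2) ;; copy_field ;; Push 4 3 ;;
     move 5 4 nonblank ;; move 3 2 nonblank"

lemma runs_pick_head: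
  "runs pick_head [out, i, record_of e @ r, [], [], [], x, c, k] (20 * length (record_of e))
    [out, i, record_of e @ r, [], field (arc_head e), [], x, c, k]"
proof -
  obtain u v l n d where e: "e = (u, v, l, n, d)" by (cases e)
  define r1 where "r1 = 3 # field l @ field n @ field d @ [5] @ r"
  have A: "record_of e @ r = syms u @ 3 # syms v @ r1"
    unfolding e record_of_def r1_def by (simp add: field_def)
  have 1: "runs (move 2 3 is_bit) [out, i, syms u @ 3 # syms v @ r1, [], [], [], x, c, k]
      (4 * length (syms u) + 1) [out, i, 3 # syms v @ r1, rev (syms u), [], [], x, c, k]"
    by (rule runs_move[where r = "3 # syms v @ r1"]) auto
  have 2: "runs (Copy 2 3 ;; Pop 2) [out, i, 3 # syms v @ r1, rev (syms u), [], [], x, c, k] 3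
      [out, i, syms v @ r1, 3 # rev (syms u), [], [], x, c, k]"
    by (rule runs_move1) auto
  have 3: "runs copy_field [out, i, syms v @ r1, 3 # rev (syms u), [], [], x, c, k] (6 * length v + 1)
      [out, i, r1, rev (syms v) @ 3 # rev (syms u), [], rev (syms v), x, c, k]"
    using runs_copy_field[where g = "[]"] by (simp add: r1_def)
  have 4: "runs (Push 4 3) [out, i, r1, rev (syms v) @ 3 # rev (syms u), [], rev (syms v), x, c, k] 2
      [out, i, r1, rev (syms v) @ 3 # rev (syms u), [3], rev (syms v), x, c, k]"
    by (rule runs_Push) auto
  have 5: "runs (move 5 4 nonblank)
      [out, i, r1, rev (syms v) @ 3 # rev (syms u), [3], rev (syms v), x, c, k]
      (4 * length (rev (syms v)) + 1)
      [out, i, r1, rev (syms v) @ 3 # rev (syms u), field v, [], x, c, k]"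
    by (rule runs_move[where r = "[]"]) (auto simp: field_def)
  have 6: "runs (move 3 2 nonblank) [out, i, r1, rev (syms v) @ 3 # rev (syms u), field v, [], x, c, k]
      (4 * length (rev (syms v) @ 3 # rev (syms u)) + 1)
      [out, i, syms u @ 3 # syms v @ r1, [], field v, [], x, c, k]"
    by (rule runs_move[where r = "[]"]) auto
  have "runs pick_head [out, i, record_of e @ r, [], [], [], x, c, k] (20 * length (record_of e))
      [out, i, record_of e @ r, [], field v, [], x, c, k]"
    unfolding pick_head_def A
    by (rule runs_mono[OF runs_Seq[OF 1 runs_Seq[OF 2 runs_Seq[OF 3 runs_Seq[OF 4 runs_Seq[OF 5 6]]]]]])
      (simp add: e)
  then show ?thesis by (simp add: e)
qed

definition walk_loop :: com where
  "walk_loop = Loop (\<lambda>t. nonblank (t ! 8)) ((Copy 8 1 ;; Pop 8) ;; walk_pass)"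

lemma runs_walk_loop:
  "runs walk_loop [out, i, records es, [], field h, [], x, c, replicate m 1]
    (m * (25 * length (records es) + 6) + 1)
    [out, replicate m 1 @ i, records es, [], field (((\<lambda>h. walk h es) ^^ m) h), [], x, c, []]"
proof (induction m arbitrary: i h)
  case 0
  then show ?case unfolding walk_loop_def by (auto intro: runs_Loop_end)
next
  case (Suc m)
  have 1: "runs (Copy 8 1 ;; Pop 8)
      [out, i, records es, [], field h, [], x, c, replicate (Suc m) 1] 3
      [out, 1 # i, records es, [], field h, [], x, c, replicate m 1]"
    by (rule runs_move1) auto
  show ?case unfolding walk_loop_def
    using runs_Loop_step[OF _ runs_Seq[OF 1 runs_walk_pass] Suc[of "1 # i" "walk h es", unfolded walk_loop_def]]
    by (simp add: replicate_app_Cons_same funpow_swap1[of "\<lambda>h. walk h es" m h])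
qed

text \<open>The next rank raises the base exponent by \<open>K * T\<close>, which makes room for
  \<open>T\<close> labels at distance \<open>K\<close>.\<close>

definition round_com :: "nat \<Rightarrow> nat \<Rightarrow> com" where
  "round_com T K = pick_head ;; walk_loop ;; move 1 8 nonblank ;; emit_pass T K ;;
     clear 4 nonblank ;; pushes 7 1 (K * T)"

lemma walk_mem_heads:
  assumes "h \<in> arc_head ` set es"
  shows "walk h fs \<in> arc_head ` (set es \<union> set fs)"
proof -
  \<comment> \<open>\<open>A\<close> collects the arcs passed so far, whose heads the walk may still
    occupy.\<close>
  have "h \<in> arc_head ` A \<Longrightarrow> walk h fs \<in> arc_head ` (A \<union> set fs)" for A
  proof (induction fs arbitrary: h A)
    case Nil
    then show ?case by (auto simp: walk_def)
  next
    case (Cons f fs)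
    then have "(if arc_tail f = h then arc_head f else h) \<in> arc_head ` (insert f A)" by auto
    from Cons.IH[OF this] show ?case by (simp add: walk_def)
  qed
  with assms show ?thesis by blast
qed

lemma iterated_walk_mem_heads:
  "h \<in> arc_head ` set es \<Longrightarrow> ((\<lambda>h. walk h es) ^^ m) h \<in> arc_head ` set es"
  using walk_mem_heads[of _ es es] by (induction m) auto

text \<open>The arcs with the ranks of their heads, in the order in which the machine emits them.\<close>

function schedule :: "nat \<Rightarrow> arc list \<Rightarrow> nat \<Rightarrow> (arc \<times> nat) list" where
  "schedule m [] c = []"
| "schedule m (e # es) c =
    (let h = ((\<lambda>h. walk h (e # es)) ^^ m) (arc_head e)
     in map (\<lambda>f. (f, c)) (filter (\<lambda>f. arc_head f = h) (e # es)) @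
        schedule m (filter (\<lambda>f. arc_head f \<noteq> h) (e # es)) (Suc c))"
  by pat_completeness auto

lemma length_filter_heads:
  assumes "h \<in> arc_head ` set es"
  shows "length (filter (\<lambda>f. arc_head f \<noteq> h) es) < length es"
proof -
  obtain f where "f \<in> set es" "arc_head f = h" using assms by blast
  then show ?thesis by (intro length_filter_less) auto
qed

termination
proof (relation "measure (\<lambda>(m, es, c). length es)", goal_cases)
  case (2 m e es c h)
  have "h \<in> arc_head ` set (e # es)"
    unfolding 2 by (rule iterated_walk_mem_heads) simp
  from length_filter_heads[OF this] show ?case by (simp only: in_measure prod.case)
qed simp

lemma length_field_le:
  "h \<in> arc_head ` set es \<Longrightarrow> length (field h) \<le> length (records es)"
proof (induction es)
  case (Cons e es)
  then show ?case by (cases "h = arc_head e"; cases e) auto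
qed simp

lemma runs_round_com:
  assumes "Q = K * 2 ^ T + s" "h = ((\<lambda>h. walk h (e # es)) ^^ m) (arc_head e)"
    "L = length (records (e # es))"
  shows "runs (round_com T K) [out, [], records (e # es), [], [], [], [], replicate s 1, replicate m 1]
    ((80 + 20 * Q + 25 * m) * L + 10 * m + 2 * (K * T) + 10)
    [rev (syms (concat (map (\<lambda>f. edge_code f (exponent T K f s))
        (filter (\<lambda>f. arc_head f = h) (e # es))))) @ out,
      [], records (filter (\<lambda>f. arc_head f \<noteq> h) (e # es)), [], [], [], [], replicate (K * T + s) 1, replicate m 1]"
proof -
  let ?o = "rev (syms (concat (map (\<lambda>f. edge_code f (exponent T K f s))
        (filter (\<lambda>f. arc_head f = h) (e # es))))) @ out"
  let ?r = "records (filter (\<lambda>f. arc_head f \<noteq> h) (e # es))"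
  have 1: "runs pick_head [out, [], records (e # es), [], [], [], [], replicate s 1, replicate m 1]
      (20 * length (record_of e))
      [out, [], records (e # es), [], field (arc_head e), [], [], replicate s 1, replicate m 1]"
    using runs_pick_head by simp
  have 2: "runs walk_loop
      [out, [], records (e # es), [], field (arc_head e), [], [], replicate s 1, replicate m 1]
      (m * (25 * L + 6) + 1)
      [out, replicate m 1, records (e # es), [], field h, [], [], replicate s 1, []]"
    using runs_walk_loop[where i = "[]" and es = "e # es"] assms(2,3) by simp
  have 3: "runs (move 1 8 nonblank)
      [out, replicate m 1, records (e # es), [], field h, [], [], replicate s 1, []]
      (4 * length (replicate m (1 :: nat)) + 1)
      [out, [], records (e # es), [], field h, [], [], replicate s 1, replicate m 1]"
    by (rule runs_move[where r = "[]"]) auto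
  have 4: "runs (emit_pass T K)
      [out, [], records (e # es), [], field h, [], [], replicate s 1, replicate m 1]
      ((55 + 20 * Q) * L + 2)
      [?o, [], ?r, [], field h, [], [], replicate s 1, replicate m 1]"
    using runs_emit_pass[OF assms(1)] unfolding assms(3) .
  have 5: "runs (clear 4 nonblank)
      [?o, [], ?r, [], field h, [], [], replicate s 1, replicate m 1] (2 * length (field h) + 1)
      [?o, [], ?r, [], [], [], [], replicate s 1, replicate m 1]"
    by (rule runs_clear[where r = "[]"]) (auto simp: field_def)
  have 6: "runs (pushes 7 1 (K * T))
      [?o, [], ?r, [], [], [], [], replicate s 1, replicate m 1] (2 * (K * T) + 1)
      [?o, [], ?r, [], [], [], [], replicate (K * T + s) 1, replicate m 1]"
    by (rule runs_pushes) (simp_all add: replicate_add)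
  have "length (field h) \<le> L" unfolding assms(2,3)
    by (intro length_field_le iterated_walk_mem_heads) simp
  moreover have "length (record_of e) \<le> L" unfolding assms(3) by simp
  ultimately show ?thesis unfolding round_com_def
    by (intro runs_mono[OF runs_Seq[OF 1 runs_Seq[OF 2 runs_Seq[OF 3 runs_Seq[OF 4 runs_Seq[OF 5 6]]]]]])
      (simp add: algebra_simps)
qed

definition main_loop :: "nat \<Rightarrow> nat \<Rightarrow> com" where
  "main_loop T K = Loop (\<lambda>t. nonblank (t ! 2)) (round_com T K)"

text \<open>The invariant \<open>c + length es \<le> M\<close> holds because a round raises the rank
  by one and deletes at least one arc. It bounds all base exponents by \<open>K * T * M\<close>, so
  that one time bound fits every round.\<close>

lemma runs_main_loop:
  assumes "length (records es) \<le> L" "c + length es \<le> M"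
  shows "\<exists>s. runs (main_loop T K)
    [out, [], records es, [], [], [], [], replicate (K * T * c) 1, replicate m 1]
    (length es * ((80 + 20 * (K * 2 ^ T + K * T * M) + 25 * m) * L + 10 * m + 2 * (K * T) + 11) + 1)
    ((rev (syms (concat (map (\<lambda>(f, c). edge_code f (exponent T K f (K * T * c))) (schedule m es c)))) @ out) # s)"
  using assms
proof (induction m es c arbitrary: out rule: schedule.induct)
  case (1 m c)
  then show ?case unfolding main_loop_def
    by (intro exI[of _ "[[], [], [], [], [], [], replicate (K * T * c) 1, replicate m 1]"])
      (auto intro: runs_Loop_end)
next
  case (2 m e es c)
  define h where "h = ((\<lambda>h. walk h (e # es)) ^^ m) (arc_head e)"
  define es' where "es' = filter (\<lambda>f. arc_head f \<noteq> h) (e # es)"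
  define R where "R = (80 + 20 * (K * 2 ^ T + K * T * M) + 25 * m) * L + 10 * m + 2 * (K * T) + 10"
  have R1: "(80 + 20 * (K * 2 ^ T + K * T * M) + 25 * m) * L + 10 * m + 2 * (K * T) + 11 = R + 1"
    by (simp add: R_def)
  define o1 where "o1 = rev (syms (concat (map (\<lambda>f. edge_code f (exponent T K f (K * T * c)))
        (filter (\<lambda>f. arc_head f = h) (e # es))))) @ out"
  have len: "length es' \<le> length es"
    using length_filter_heads[of h "e # es"] iterated_walk_mem_heads[of "arc_head e" "e # es" m]
    unfolding es'_def h_def by auto
  have "length (records es') \<le> length (records (e # es))"
    unfolding es'_def by (induction es) auto
  then have len': "length (records es') \<le> L" "Suc c + length es' \<le> M"
    using 2(2,3) len by simp_all
  have "\<exists>s. runs (main_loop T K)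
      [o1, [], records es', [], [], [], [], replicate (K * T * Suc c) 1, replicate m 1]
      (length es' * (R + 1) + 1)
      ((rev (syms (concat (map (\<lambda>(f, c). edge_code f (exponent T K f (K * T * c))) (schedule m es' (Suc c))))) @ o1) # s)"
    using 2(1)[OF h_def, folded es'_def, OF len'] unfolding R1 .
  then obtain s where s: "runs (main_loop T K)
      [o1, [], records es', [], [], [], [], replicate (K * T * Suc c) 1, replicate m 1]
      (length es' * (R + 1) + 1)
      ((rev (syms (concat (map (\<lambda>(f, c). edge_code f (exponent T K f (K * T * c))) (schedule m es' (Suc c))))) @ o1) # s)"
    by blast
  have "runs (round_com T K)
      [out, [], records (e # es), [], [], [], [], replicate (K * T * c) 1, replicate m 1]
      ((80 + 20 * (K * 2 ^ T + K * T * c) + 25 * m) * length (records (e # es)) + 10 * m + 2 * (K * T) + 10)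
      [o1, [], records es', [], [], [], [], replicate (K * T + K * T * c) 1, replicate m 1]"
    unfolding o1_def es'_def by (rule runs_round_com) (auto simp: h_def)
  moreover have "(80 + 20 * (K * 2 ^ T + K * T * c) + 25 * m) * length (records (e # es)) + 10 * m + 2 * (K * T) + 10 \<le> R"
    unfolding R_def using 2(2,3) by (intro add_mono mult_le_mono) auto
  ultimately have 1: "runs (round_com T K)
      [out, [], records (e # es), [], [], [], [], replicate (K * T * c) 1, replicate m 1] R
      [o1, [], records es', [], [], [], [], replicate (K * T * Suc c) 1, replicate m 1]"
    by (auto intro: runs_mono)
  have "Suc (R + (length es' * (R + 1) + 1)) \<le> length (e # es) * (R + 1) + 1"
    using mult_le_mono1[OF len, of "R + 1"] by simp
  then have "runs (main_loop T K)
      [out, [], records (e # es), [], [], [], [], replicate (K * T * c) 1, replicate m 1]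
      (length (e # es) * (R + 1) + 1)
      ((rev (syms (concat (map (\<lambda>(f, c). edge_code f (exponent T K f (K * T * c))) (schedule m es' (Suc c))))) @ o1) # s)"
    unfolding main_loop_def by (intro runs_Loop_step[OF _ 1 s[unfolded main_loop_def]]) simp_all
  moreover have "rev (syms (concat (map (\<lambda>(f, c). edge_code f (exponent T K f (K * T * c))) (schedule m es' (Suc c))))) @ o1 =
    rev (syms (concat (map (\<lambda>(f, c). edge_code f (exponent T K f (K * T * c))) (schedule m (e # es) c)))) @ out"
    unfolding schedule.simps Let_def h_def[symmetric] es'_def[symmetric] o1_def
    by (simp add: o_def)
  ultimately show ?case unfolding R1 by (intro exI[of _ s]) (simp only:)
qed

section \<open>Reading the input\<close>

text \<open>Decoders that accept every word: the machine has to stop on all inputs.\<close>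

fun decode_bits :: "bool list \<Rightarrow> bool list \<times> bool list" where
  "decode_bits (True # b # x) = apfst ((#) b) (decode_bits x)"
| "decode_bits [True] = ([False], [])"
| "decode_bits (False # x) = ([], x)"
| "decode_bits [] = ([], [])"

lemma decode_bits_code: "decode_bits (code u @ x) = (u, x)"
  by (induction u) auto

lemma length_decode_bits: "decode_bits x = (u, y) \<Longrightarrow> length u + length y \<le> length x"
  by (induction x arbitrary: u y rule: decode_bits.induct) (auto simp: apfst_def map_prod_def split: prod.splits)

text \<open>The comparison of lengths ensures termination for an arbitrary \<open>d\<close>. It
  succeeds for \<open>decode_bits\<close> and \<open>decode_arc\<close>, which never return more
  than they were given.\<close>

function decode_list :: "(bool list \<Rightarrow> 'a \<times> bool list) \<Rightarrow> bool list \<Rightarrow> 'a list \<times> bool list" where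
  "decode_list d (True # x) = (let (a, y) = d x in
     if length y \<le> length x then apfst ((#) a) (decode_list d y) else ([], y))"
| "decode_list d (False # x) = ([], x)"
| "decode_list d [] = ([], [])"
  by pat_completeness auto
termination by (relation "measure (\<lambda>(d, x). length x)") auto

lemma decode_list_enc_list:
  assumes "\<And>a y. a \<in> set as \<Longrightarrow> d (enc a @ y) = (a, y)"
  shows "decode_list d (enc_list enc as @ x) = (as, x)"
  using assms by (induction as) (auto simp: enc_list_def)

definition decode_arc :: "bool list \<Rightarrow> arc \<times> bool list" where
  "decode_arc x =
     (let (u, x1) = decode_bits x; (v, x2) = decode_bits x1; (l, x3) = decode_bits x2;
          (n, x4) = decode_bits x3; (d, x5) = decode_bits x4
      in ((u, v, l, n, d), x5))"

lemma length_decode_arc: "decode_arc x = (e, y) \<Longrightarrow> length (record_of e) + length y \<le> length x + 6"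
  unfolding decode_arc_def by (auto split: prod.splits dest!: length_decode_bits)

text \<open>If the word ends right after a marker, the test for symbol 2 fails on the empty stack
  and the digit \<open>False\<close> is stored. The clause of \<open>decode_bits\<close> for
  \<open>[True]\<close> mirrors this.\<close>

definition read_field :: com where
  "read_field = Loop (\<lambda>t. t ! 1 = 2)
     (Pop 1 ;; Cond (\<lambda>t. t ! 1 = 2) (Push 3 2) (Push 3 1) ;; Pop 1) ;; Pop 1 ;; Push 3 3"

lemma runs_Pop_input: "runs (Pop 1) (out # syms x # s) 1 (out # syms (tl x) # s)"
  by (rule runs_Pop) (cases x; auto)+

lemma runs_read_field:
  assumes "decode_bits x = (u, y)"
  shows "runs read_field [out, syms x, a, b, h, g, z, c, k] (6 * length u + 4)
    [out, syms y, a, rev (field u) @ b, h, g, z, c, k]"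
proof -
  let ?body = "Pop 1 ;; Cond (\<lambda>t. t ! 1 = 2) (Push 3 2) (Push 3 1) ;; Pop 1"
  have body: "runs ?body [out, syms (True # x), a, b, h, g, z, c, k] (1 + (Suc 2 + 1))
      [out, syms (tl x), a, sym_of (x \<noteq> [] \<and> hd x) # b, h, g, z, c, k]" for x b
  proof (rule runs_Seq[OF runs_Pop_input runs_Seq])
    show "runs (Cond (\<lambda>t. t ! 1 = 2) (Push 3 2) (Push 3 1))
        [out, syms (tl (True # x)), a, b, h, g, z, c, k] (Suc 2)
        [out, syms x, a, sym_of (x \<noteq> [] \<and> hd x) # b, h, g, z, c, k]"
      by (rule runs_Cond) (cases x; auto intro!: runs_Push)+
  qed (rule runs_Pop_input)
  \<comment> \<open>The loop stops in front of the terminator or at the end of the word; the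
    \<open>Pop\<close> that follows removes the terminator, if there is one.\<close>
  have "\<exists>y'. tl y' = y \<and> runs (Loop (\<lambda>t. t ! 1 = 2) ?body) [out, syms x, a, b, h, g, z, c, k] (6 * length u + 1)
    [out, syms y', a, rev (syms u) @ b, h, g, z, c, k]" for b
    using assms
  proof (induction x arbitrary: u b rule: decode_bits.induct)
    case (1 w x)
    then obtain v where v: "u = w # v" "decode_bits x = (v, y)"
      by (cases "decode_bits x") auto
    from 1(1)[OF v(2), of "sym_of w # b"] obtain y' where y': "tl y' = y"
      "runs (Loop (\<lambda>t. t ! 1 = 2) ?body) [out, syms x, a, sym_of w # b, h, g, z, c, k] (6 * length v + 1)
        [out, syms y', a, rev (syms v) @ sym_of w # b, h, g, z, c, k]" by blast
    have "runs ?body [out, syms (True # w # x), a, b, h, g, z, c, k] (1 + (Suc 2 + 1))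
        [out, syms x, a, sym_of w # b, h, g, z, c, k]"
      using body[of "w # x"] by simp
    from runs_Loop_step[OF _ this y'(2)] show ?case
      using y'(1) by (intro exI[of _ y']) (simp add: v)
  next
    case 2
    then have uy: "u = [False]" "y = []" by auto
    have loop: "runs (Loop (\<lambda>t. t ! 1 = 2) ?body) [out, syms [], a, 1 # b, h, g, z, c, k] 1
        [out, syms [], a, 1 # b, h, g, z, c, k]"
      by (rule runs_Loop_end) auto
    have "runs ?body [out, syms [True], a, b, h, g, z, c, k] (1 + (Suc 2 + 1))
        [out, syms [], a, 1 # b, h, g, z, c, k]"
      using body[of "[]"] by simp
    from runs_Loop_step[OF _ this loop] show ?case by (intro exI[of _ "[]"]) (simp add: uy)
  next
    case (3 x)
    then show ?case by (intro exI[of _ "False # x"]) (auto intro!: runs_Loop_end)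
  next
    case 4
    then show ?case by (intro exI[of _ "[]"]) (auto intro!: runs_Loop_end)
  qed
  then obtain y' where y': "tl y' = y" "runs (Loop (\<lambda>t. t ! 1 = 2) ?body)
      [out, syms x, a, b, h, g, z, c, k] (6 * length u + 1) [out, syms y', a, rev (syms u) @ b, h, g, z, c, k]"
    by blast
  have push: "runs (Push 3 3) [out, syms (tl y'), a, rev (syms u) @ b, h, g, z, c, k] 2
      [out, syms (tl y'), a, rev (field u) @ b, h, g, z, c, k]"
    by (rule runs_Push) (auto simp: field_def)
  show ?thesis unfolding read_field_def
    by (rule runs_mono[OF runs_Seq[OF y'(2) runs_Seq[OF runs_Pop_input push]], unfolded y'(1)]) simp
qed

definition copy_name :: com where
  "copy_name = Loop (\<lambda>t. t ! 1 = 2)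
     (Pop 1 ;; Push 0 2 ;; Cond (\<lambda>t. t ! 1 = 2) (Push 0 2) (Push 0 1) ;; Pop 1) ;; Pop 1 ;; Push 0 1"

lemma runs_copy_name:
  assumes "decode_bits x = (u, y)"
  shows "runs copy_name (out # syms x # s) (8 * length u + 4)
    ((rev (syms (code u)) @ out) # syms y # s)"
proof -
  let ?body = "Pop 1 ;; Push 0 2 ;; Cond (\<lambda>t. t ! 1 = 2) (Push 0 2) (Push 0 1) ;; Pop 1"
  have body: "runs ?body (out # syms (True # x) # s) (1 + (2 + (Suc 2 + 1)))
      ((sym_of (x \<noteq> [] \<and> hd x) # 2 # out) # syms (tl x) # s)" for x out
  proof (rule runs_Seq[OF runs_Pop_input runs_Seq[OF runs_Push runs_Seq]])
    show "runs (Cond (\<lambda>t. t ! 1 = 2) (Push 0 2) (Push 0 1))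
        ((2 # out) # syms x # s) (Suc 2)
        ((sym_of (x \<noteq> [] \<and> hd x) # 2 # out) # syms x # s)"
      by (rule runs_Cond) (cases x; auto intro!: runs_Push)+
  qed (simp_all add: runs_Pop_input[simplified])
  have "\<exists>y' o'. tl y' = y \<and> 1 # o' = rev (syms (code u)) @ out \<and>
    runs (Loop (\<lambda>t. t ! 1 = 2) ?body) (out # syms x # s) (8 * length u + 1) (o' # syms y' # s)"
    using assms
  proof (induction x arbitrary: u out rule: decode_bits.induct)
    case (1 w x)
    then obtain v where v: "u = w # v" "decode_bits x = (v, y)"
      by (cases "decode_bits x") auto
    from 1(1)[OF v(2), of "sym_of w # 2 # out"] obtain y' o' where y': "tl y' = y"
      "1 # o' = rev (syms (code v)) @ sym_of w # 2 # out"
      "runs (Loop (\<lambda>t. t ! 1 = 2) ?body) ((sym_of w # 2 # out) # syms x # s) (8 * length v + 1)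
        (o' # syms y' # s)" by blast
    have "runs ?body (out # syms (True # w # x) # s) (1 + (2 + (Suc 2 + 1)))
        ((sym_of w # 2 # out) # syms x # s)"
      using body[of _ "w # x"] by simp
    from runs_Loop_step[OF _ this y'(3)] show ?case
      using y'(1,2) by (intro exI[of _ y'] exI[of _ o']) (simp add: v)
  next
    case 2
    then have uy: "u = [False]" "y = []" by auto
    have loop: "runs (Loop (\<lambda>t. t ! 1 = 2) ?body) ((1 # 2 # out) # syms [] # s) 1
        ((1 # 2 # out) # syms [] # s)"
      by (rule runs_Loop_end) auto
    have "runs ?body (out # syms [True] # s) (1 + (2 + (Suc 2 + 1)))
        ((1 # 2 # out) # syms [] # s)"
      using body[of _ "[]"] by simp
    from runs_Loop_step[OF _ this loop] show ?case
      by (intro exI[of _ "[]"] exI[of _ "1 # 2 # out"]) (simp add: uy)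
  next
    case (3 x)
    then show ?case by (intro exI[of _ "False # x"] exI[of _ out]) (auto intro!: runs_Loop_end)
  next
    case 4
    then show ?case by (intro exI[of _ "[]"] exI[of _ out]) (auto intro!: runs_Loop_end)
  qed
  then obtain y' o' where y': "tl y' = y" "1 # o' = rev (syms (code u)) @ out"
    "runs (Loop (\<lambda>t. t ! 1 = 2) ?body) (out # syms x # s) (8 * length u + 1) (o' # syms y' # s)"
    by blast
  have push: "runs (Push 0 1) (o' # syms (tl y') # s) 2 ((rev (syms (code u)) @ out) # syms (tl y') # s)"
    by (rule runs_Push) (auto simp flip: y'(2))
  show ?thesis unfolding copy_name_def
    by (rule runs_mono[OF runs_Seq[OF y'(3) runs_Seq[OF runs_Pop_input push]], unfolded y'(1)]) simp
qed

text \<open>Both instances have the same vertices, so these go straight to the output. They are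
  encoded anew, which repairs malformed lists.\<close>

definition copy_names :: com where
  "copy_names = Loop (\<lambda>t. t ! 1 = 2) (Pop 1 ;; Push 0 2 ;; copy_name) ;; Pop 1 ;; Push 0 1"

lemma runs_copy_names:
  assumes "decode_list decode_bits x = (vs, y)"
  shows "runs copy_names (out # syms x # s) (8 * length x + 4)
    ((rev (syms (enc_list code vs)) @ out) # syms y # s) \<and> length y \<le> length x"
proof -
  let ?body = "Pop 1 ;; Push 0 2 ;; copy_name"
  have "\<exists>y'. tl y' = y \<and> length y' \<le> length x \<and>
    runs (Loop (\<lambda>t. t ! 1 = 2) ?body) (out # syms x # s) (8 * length x + 1)
      ((rev (syms (concat (map (\<lambda>v. True # code v) vs))) @ out) # syms y' # s)"
    using assms
  proof (induction "decode_bits" x arbitrary: vs out rule: decode_list.induct)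
    case (1 x)
    obtain u x1 where u: "decode_bits x = (u, x1)" by fastforce
    have len: "length u + length x1 \<le> length x" using length_decode_bits[OF u] .
    then obtain vs1 where vs1: "vs = u # vs1" "decode_list decode_bits x1 = (vs1, y)"
      using 1(2) u by (cases "decode_list decode_bits x1") auto
    let ?out = "rev (syms (code u)) @ 2 # out"
    from 1(1)[OF u[symmetric] refl _ vs1(2), of ?out] len obtain y' where y': "tl y' = y" "length y' \<le> length x1"
      "runs (Loop (\<lambda>t. t ! 1 = 2) ?body) (?out # syms x1 # s) (8 * length x1 + 1)
      ((rev (syms (concat (map (\<lambda>v. True # code v) vs1))) @ ?out) # syms y' # s)" by auto
    have "runs ?body (out # syms (True # x) # s) (1 + (2 + (8 * length u + 4))) (?out # syms x1 # s)"
      by (rule runs_Seq[OF runs_Pop_input runs_Seq[OF runs_Push runs_copy_name]]) (use u in auto)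
    from runs_Loop_step[OF _ this y'(3)] y'(1,2) len show ?case
      by (intro exI[of _ y']) (simp add: vs1)
  next
    case (2 x)
    then show ?case by (intro exI[of _ "False # x"]) (auto intro!: runs_Loop_end)
  next
    case 3
    then show ?case by (intro exI[of _ "[]"]) (auto intro!: runs_Loop_end)
  qed
  then obtain y' where y': "tl y' = y" "length y' \<le> length x"
    "runs (Loop (\<lambda>t. t ! 1 = 2) ?body) (out # syms x # s) (8 * length x + 1)
      ((rev (syms (concat (map (\<lambda>v. True # code v) vs))) @ out) # syms y' # s)" by blast
  have push: "runs (Push 0 1) ((rev (syms (concat (map (\<lambda>v. True # code v) vs))) @ out) # syms (tl y') # s) 2
      ((rev (syms (enc_list code vs)) @ out) # syms (tl y') # s)"
    by (rule runs_Push) (auto simp: enc_list_def)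
  show ?thesis unfolding copy_names_def
    using runs_mono[OF runs_Seq[OF y'(3) runs_Seq[OF runs_Pop_input push]], unfolded y'(1)] y'(1,2)
    by auto
qed

text \<open>Each arc adds a symbol to stack 8, which becomes the clock of the walks.\<close>

definition read_arc :: com where
  "read_arc = Push 8 1 ;; read_field ;; read_field ;; read_field ;; read_field ;; read_field ;; Push 3 5"

lemma runs_read_arc:
  assumes "decode_arc x = (e, y)"
  shows "runs read_arc [out, syms x, a, b, h, g, z, c, k] (6 * length (record_of e))
    [out, syms y, a, rev (record_of e) @ b, h, g, z, c, 1 # k]"
proof -
  obtain u v l n d x1 x2 x3 x4 where dec: "decode_bits x = (u, x1)" "decode_bits x1 = (v, x2)"
    "decode_bits x2 = (l, x3)" "decode_bits x3 = (n, x4)" "decode_bits x4 = (d, y)" "e = (u, v, l, n, d)"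
    using assms unfolding decode_arc_def by (auto split: prod.splits)
  have 1: "runs (Push 8 1) [out, syms x, a, b, h, g, z, c, k] 2 [out, syms x, a, b, h, g, z, c, 1 # k]"
    by (rule runs_Push) auto
  have 2: "runs (Push 3 5) [out, syms y, a, b, h, g, z, c, 1 # k] 2 [out, syms y, a, 5 # b, h, g, z, c, 1 # k]" for b
    by (rule runs_Push) auto
  show ?thesis unfolding read_arc_def
    using runs_mono[OF runs_Seq[OF 1 runs_Seq[OF runs_read_field[OF dec(1)] runs_Seq[OF runs_read_field[OF dec(2)]
      runs_Seq[OF runs_read_field[OF dec(3)] runs_Seq[OF runs_read_field[OF dec(4)]
      runs_Seq[OF runs_read_field[OF dec(5)] 2]]]]]]]
    by (simp add: dec(6) record_of_def)
qed

text \<open>Clearing the rest of the input frees stack 1 for the used part of the clock.\<close>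

definition read_arcs :: com where
  "read_arcs = Loop (\<lambda>t. t ! 1 = 2) (Pop 1 ;; read_arc) ;; clear 1 nonblank ;; move 3 2 nonblank"

lemma runs_read_arcs:
  assumes "decode_list decode_arc x = (es, y)"
  shows "runs read_arcs [out, syms x, [], [], h, g, z, c, []] (80 * length x + 3)
    [out, [], records es, [], h, g, z, c, replicate (length es) 1] \<and> length (records es) \<le> 6 * length x"
proof -
  let ?body = "Pop 1 ;; read_arc"
  \<comment> \<open>An arc consumes at least its list marker, and its record exceeds the letters
    read for it by at most six delimiters; hence the factor 6.\<close>
  have "\<exists>y'. length (records es) + 6 * length y' \<le> 6 * length x \<and>
    runs (Loop (\<lambda>t. t ! 1 = 2) ?body) [out, syms x, [], b, h, g, z, c, k] (8 * length (records es) + 1)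
      [out, syms y', [], rev (records es) @ b, h, g, z, c, replicate (length es) 1 @ k]" for b k
    using assms
  proof (induction "decode_arc" x arbitrary: es b k rule: decode_list.induct)
    case (1 x)
    obtain e x1 where e: "decode_arc x = (e, x1)" by fastforce
    have len: "length (record_of e) + length x1 \<le> length x + 6" using length_decode_arc[OF e] .
    then have len1: "length x1 \<le> length x" using length_record_of_pos[of e] by linarith
    then obtain es1 where es1: "es = e # es1" "decode_list decode_arc x1 = (es1, y)"
      using 1(2) e by (cases "decode_list decode_arc x1") auto
    from 1(1)[OF e[symmetric] refl len1 es1(2), of "rev (record_of e) @ b" "1 # k"] obtain y' where
      y': "length (records es1) + 6 * length y' \<le> 6 * length x1"
      "runs (Loop (\<lambda>t. t ! 1 = 2) ?body) [out, syms x1, [], rev (record_of e) @ b, h, g, z, c, 1 # k]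
        (8 * length (records es1) + 1)
        [out, syms y', [], rev (records es1) @ rev (record_of e) @ b, h, g, z, c, replicate (length es1) 1 @ 1 # k]"
      by blast
    have "runs ?body [out, syms (True # x), [], b, h, g, z, c, k] (1 + 6 * length (record_of e))
        [out, syms x1, [], rev (record_of e) @ b, h, g, z, c, 1 # k]"
      by (rule runs_Seq[OF runs_Pop_input]) (use runs_read_arc[OF e] in simp)
    from runs_Loop_step[OF _ this y'(2)] y'(1) len length_record_of_pos[of e] show ?case
      by (intro exI[of _ y']) (simp add: es1 replicate_app_Cons_same)
  next
    case (2 x)
    then show ?case by (intro exI[of _ "False # x"]) (auto intro!: runs_Loop_end)
  next
    case 3
    then show ?case by (intro exI[of _ "[]"]) (auto intro!: runs_Loop_end)
  qed
  from this[of "[]" "[]"] obtain y' where y': "length (records es) + 6 * length y' \<le> 6 * length x"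
    "runs (Loop (\<lambda>t. t ! 1 = 2) ?body) [out, syms x, [], [], h, g, z, c, []] (8 * length (records es) + 1)
      [out, syms y', [], rev (records es), h, g, z, c, replicate (length es) 1]"
    by auto
  have 2: "runs (clear 1 nonblank)
      [out, syms y', [], rev (records es), h, g, z, c, replicate (length es) 1] (2 * length (syms y') + 1)
      [out, [], [], rev (records es), h, g, z, c, replicate (length es) 1]"
    by (rule runs_clear[where r = "[]"]) auto
  have 3: "runs (move 3 2 nonblank)
      [out, [], [], rev (records es), h, g, z, c, replicate (length es) 1] (4 * length (rev (records es)) + 1)
      [out, [], records es, [], h, g, z, c, replicate (length es) 1]"
    by (rule runs_move[where r = "[]"]) (auto simp: nonblank_def intro!: gr0I)
  show ?thesis unfolding read_arcs_def
    using runs_mono[OF runs_Seq[OF y'(2) runs_Seq[OF 2 3]], of "80 * length x + 3"] y'(1) by simp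
qed

section \<open>The reduction\<close>

definition reduction :: "nat \<Rightarrow> nat \<Rightarrow> bool list \<Rightarrow> bool list" where
  "reduction T K x =
     (let (vs, y) = decode_list decode_bits x; (es, _) = decode_list decode_arc y
      in enc_list code vs @
         concat (map (\<lambda>(f, c). edge_code f (exponent T K f (K * T * c))) (schedule (length es) es 0)) @
         [False])"

definition reduction_com :: "nat \<Rightarrow> nat \<Rightarrow> com" where
  "reduction_com T K = move 0 1 nonblank ;; copy_names ;; read_arcs ;; main_loop T K ;; Push 0 1"

lemma wf_pushes: "i < k \<Longrightarrow> a < m \<Longrightarrow> wf_com k m (pushes i a n)"
  by (induction n) auto

lemma wf_read_label: "wf_com 9 6 (read_label n w)"
  by (induction n arbitrary: w) (auto intro: wf_pushes)

lemma wf_reduction_com: "wf_com 9 6 (reduction_com T K)"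
  unfolding reduction_com_def copy_names_def copy_name_def read_arcs_def read_arc_def read_field_def
    main_loop_def round_com_def pick_head_def walk_loop_def walk_pass_def walk_arc_def compare_def
    copy_field_def skip_record_def emit_pass_def emit_arc_def emit_ends_def emit_budget_def
    emit_weight_def emit_field_def emit_pad_def
  by (simp add: wf_read_label wf_pushes)

lemma runs_reduction_com:
  fixes T K :: nat
  defines "R \<equiv> \<lambda>N :: nat. (80 + 20 * (K * 2 ^ T + K * T * N) + 25 * N) * (6 * N) + 10 * N + 2 * (K * T) + 11"
  shows "\<exists>s. runs (reduction_com T K) (rev (syms x) # replicate 8 [])
    (length x * R (length x) + 100 * length x + 20) (rev (syms (reduction T K x)) # s)"
proof -
  let ?N = "length x"
  obtain vs y where vs: "decode_list decode_bits x = (vs, y)" by fastforce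
  obtain es y1 where es: "decode_list decode_arc y = (es, y1)" by fastforce
  let ?o1 = "rev (syms (enc_list code vs))"
  let ?o2 = "rev (syms (concat (map (\<lambda>(f, c). edge_code f (exponent T K f (K * T * c))) (schedule (length es) es 0)))) @ ?o1"
  have 1: "runs (move 0 1 nonblank) (rev (syms x) # replicate 8 []) (4 * length (rev (syms x)) + 1)
      [[], syms x, [], [], [], [], [], [], []]"
    by (rule runs_move[where r = "[]"]) (auto simp: numeral_eq_Suc)
  have 2: "runs copy_names [[], syms x, [], [], [], [], [], [], []] (8 * ?N + 4)
      [?o1, syms y, [], [], [], [], [], [], []]"
    and len_y: "length y \<le> ?N"
    using runs_copy_names[OF vs, of "[]"] by simp_all
  have 3: "runs read_arcs [?o1, syms y, [], [], [], [], [], [], []] (80 * length y + 3)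
      [?o1, [], records es, [], [], [], [], [], replicate (length es) 1]"
    and len_es: "length (records es) \<le> 6 * length y"
    using runs_read_arcs[OF es] by simp_all
  have "6 * length es \<le> length (records es)"
  proof (induction es)
    case (Cons e es)
    then show ?case using length_record_of_pos[of e] by simp
  qed simp
  then have es_le: "length es \<le> ?N" using len_y len_es by linarith
  let ?R = "\<lambda>m. (80 + 20 * (K * 2 ^ T + K * T * ?N) + 25 * m) * (6 * ?N) + 10 * m + 2 * (K * T) + 11"
  obtain s where "runs (main_loop T K)
      [?o1, [], records es, [], [], [], [], replicate (K * T * 0) 1, replicate (length es) 1]
      (length es * ?R (length es) + 1) (?o2 # s)"
    using runs_main_loop[of es "6 * ?N" 0 ?N T K ?o1 "length es"] len_y len_es es_le by auto
  moreover have "length es * ?R (length es) + 1 \<le> ?N * ?R ?N + 1"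
    using es_le by (intro add_mono mult_le_mono) auto
  ultimately have 4: "runs (main_loop T K)
      [?o1, [], records es, [], [], [], [], [], replicate (length es) 1] (?N * ?R ?N + 1) (?o2 # s)"
    by (auto intro: runs_mono)
  have 5: "runs (Push 0 1) (?o2 # s) 2 (rev (syms (reduction T K x)) # s)"
    by (rule runs_Push) (auto simp: reduction_def vs es)
  have "runs (reduction_com T K) (rev (syms x) # replicate 8 [])
      (?N * ?R ?N + 100 * ?N + 20) (rev (syms (reduction T K x)) # s)"
    unfolding reduction_com_def
    by (rule runs_mono[OF runs_Seq[OF 1 runs_Seq[OF 2 runs_Seq[OF 3 runs_Seq[OF 4 5]]]]])
      (use len_y in simp)
  then show ?thesis unfolding R_def by blast
qed

text \<open>\<open>T\<close> and \<open>K\<close> are built into the program, so even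
  \<open>2 ^ T\<close> is only a coefficient.\<close>

lemma polytime_reduction: "polytime (reduction T K)"
proof (rule polytime_exec[OF wf_reduction_com])
  let ?X = "[:0, 1:] :: nat poly"
  let ?p = "?X * (([:80 + 20 * (K * 2 ^ T):] + [:20 * (K * T):] * ?X + [:25:] * ?X) * ([:6:] * ?X)
      + [:10:] * ?X + [:2 * (K * T) + 11:]) + [:100:] * ?X + [:20:]"
  fix x :: "bool list"
  have nine: "(9 :: nat) - 1 = 8" by simp
  have sym: "sym_of = (\<lambda>b. if b then 2 else 1)" by (auto simp: sym_of_def)
  obtain s where "runs (reduction_com T K) (rev (syms x) # replicate 8 [])
    (length x * ((80 + 20 * (K * 2 ^ T + K * T * length x) + 25 * length x) * (6 * length x)
      + 10 * length x + 2 * (K * T) + 11) + 100 * length x + 20) (rev (syms (reduction T K x)) # s)"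
    using runs_reduction_com by blast
  moreover have "length x * ((80 + 20 * (K * 2 ^ T + K * T * length x) + 25 * length x) * (6 * length x)
      + 10 * length x + 2 * (K * T) + 11) + 100 * length x + 20 = poly ?p (length x)"
    by (simp add: algebra_simps)
  ultimately have "runs (reduction_com T K) (rev (syms x) # replicate (9 - 1) []) (poly ?p (length x))
      (rev (syms (reduction T K x)) # s)"
    unfolding nine by (simp only:)
  then show "\<exists>t \<le> poly ?p (length x). \<exists>s. exec (reduction_com T K)
      (rev (map (\<lambda>b. if b then 2 else 1) x) # replicate (9 - 1) []) t
      (rev (map (\<lambda>b. if b then 2 else 1) (reduction T K x)) # s)"
    unfolding runs_def sym by blast
qed auto

section \<open>Pricings and labelings\<close>

text \<open>Let \<open>k\<close> be the least exponent that contributes. Then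
  \<open>x \<le> 2 ^ k\<close>, and as the exponents are distinct the terms are dominated by the
  series of the powers of 1/2.\<close>

lemma sum_capped_powers_le:
  fixes x :: real and f :: "'a \<Rightarrow> nat"
  assumes "finite S" "inj_on f S" "x \<ge> 0"
  shows "(\<Sum>i\<in>S. x / 2 ^ f i * of_bool (x \<le> 2 ^ f i)) \<le> 2"
proof -
  define J where "J = {j \<in> f ` S. x \<le> 2 ^ j}"
  have fin: "finite J" unfolding J_def using assms by auto
  have "(\<Sum>i\<in>S. x / 2 ^ f i * of_bool (x \<le> 2 ^ f i)) = (\<Sum>j\<in>f ` S. x / 2 ^ j * of_bool (x \<le> 2 ^ j))"
    using assms by (simp add: sum.reindex)
  also have "\<dots> = (\<Sum>j\<in>J. x / 2 ^ j)"
    unfolding J_def using assms by (intro sum.mono_neutral_cong_right) auto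
  also have "\<dots> \<le> 2"
  proof (cases "J = {}")
    case False
    define k where "k = Min J"
    have k: "k \<in> J" "\<And>j. j \<in> J \<Longrightarrow> k \<le> j" unfolding k_def using fin False by auto
    have "(\<Sum>j\<in>J. x / 2 ^ j) \<le> (\<Sum>j\<in>J. (1 / 2) ^ (j - k))"
    proof (rule sum_mono)
      fix j assume "j \<in> J"
      have "x / 2 ^ j \<le> 2 ^ k / 2 ^ j" using k(1) by (intro divide_right_mono) (auto simp: J_def)
      also have "\<dots> = (1 / 2) ^ (j - k)" using k(2)[OF \<open>j \<in> J\<close>]
        by (simp add: power_diff power_one_over)
      finally show "x / 2 ^ j \<le> (1 / 2) ^ (j - k)" .
    qed
    also have "\<dots> = (\<Sum>d\<in>(\<lambda>j. j - k) ` J. (1 / 2) ^ d)"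
      using k(2) by (subst sum.reindex) (auto intro!: inj_onI simp: eq_diff_iff)
    also have "\<dots> \<le> (\<Sum>d. (1 / 2 :: real) ^ d)"
      using fin by (intro sum_le_suminf) (auto intro: summable_geometric)
    also have "\<dots> = 2" by (simp add: suminf_geometric)
    finally show ?thesis .
  qed simp
  finally show ?thesis .
qed

text \<open>Separates the estimates from the machine. Later \<open>es\<close> is the order of
  emission and \<open>rk v\<close> the round that emits the arcs into \<open>v\<close>. Only heads
  receive a rank in this way, hence the arc \<open>(t, u)\<close> in \<open>rk_less\<close>.\<close>

locale ranked_gmd =
  fixes T :: nat and D :: "nat pair_pre_digraph" and l :: "nat \<times> nat \<Rightarrow> nat"
    and w :: "nat \<times> nat \<Rightarrow> real" and \<epsilon> :: real
    and es :: "(nat \<times> nat) list" and rk :: "nat \<Rightarrow> nat" and K :: nat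
  assumes inst: "gmd_instance T D l w"
    and ndeg: "ndeg D w \<ge> 1 / \<epsilon>" and eps: "\<epsilon> > 0"
    and es: "distinct es" "set es = parcs D"
    and no_loop: "\<And>u v. (u, v) \<in> parcs D \<Longrightarrow> u \<noteq> v"
    and rk_inj: "inj_on rk (snd ` parcs D)"
    and rk_less: "\<And>t u v. (t, u) \<in> parcs D \<Longrightarrow> (u, v) \<in> parcs D \<Longrightarrow> rk v < rk u"
    and K: "1 / \<epsilon> \<le> 2 ^ K"
begin

definition edge_exp :: "nat \<times> nat \<Rightarrow> nat" where
  "edge_exp e = K * (l e + T * rk (snd e))"

definition G :: "(nat, nat) multigraph" where
  "G = \<lparr>mverts = pverts D, medges = {..<length es}, ends = (\<lambda>i. {snd (es ! i), fst (es ! i)})\<rparr>"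

definition budget :: "nat \<Rightarrow> real" where "budget i = 2 ^ edge_exp (es ! i)"

definition weight :: "nat \<Rightarrow> real" where "weight i = w (es ! i) / 2 ^ edge_exp (es ! i)"

abbreviation "A \<equiv> parcs D"

lemma finA: "finite A" and finV: "finite (pverts D)"
  and endsV: "\<And>u v. (u, v) \<in> A \<Longrightarrow> u \<in> pverts D \<and> v \<in> pverts D"
  and w_pos: "\<And>e. e \<in> A \<Longrightarrow> w e > 0" and w_sum: "(\<Sum>e\<in>A. w e) = 1"
  and l_range: "\<And>e. e \<in> A \<Longrightarrow> 1 \<le> l e \<and> l e \<le> T"
proof -
  interpret pair_fin_digraph D using inst by (simp add: gmd_instance_def)
  show "finite A" "finite (pverts D)" by auto
  show "u \<in> pverts D \<and> v \<in> pverts D" if "(u, v) \<in> A" for u v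
    using that by (metis in_arcsD1 in_arcsD2)
qed (use inst in \<open>auto simp: gmd_instance_def\<close>)

lemma gp_instance: "gp_instance G budget weight"
proof -
  have "ends G i \<subseteq> mverts G \<and> card (ends G i) = 2" "weight i > 0" if "i < length es" for i
  proof -
    have "es ! i \<in> A" using nth_mem[OF that] es(2) by simp
    then show "ends G i \<subseteq> mverts G \<and> card (ends G i) = 2" "weight i > 0"
      using endsV[of "fst (es ! i)" "snd (es ! i)"] no_loop[of "fst (es ! i)" "snd (es ! i)"] w_pos
      by (auto simp: G_def weight_def)
  qed
  then show ?thesis unfolding gp_instance_def by (auto simp: G_def finV budget_def)
qed

lemma gp_value_eq:
  "gp_value G budget weight p =
    (\<Sum>(u, v)\<in>A. w (u, v) / 2 ^ edge_exp (u, v) * (p u + p v) * of_bool (p u + p v \<le> 2 ^ edge_exp (u, v)))"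
proof -
  let ?f = "\<lambda>(u, v). w (u, v) / 2 ^ edge_exp (u, v) * (p u + p v) * of_bool (p u + p v \<le> 2 ^ edge_exp (u, v))"
  have "edge_price G p i = p (fst (es ! i)) + p (snd (es ! i))" if "i < length es" for i
  proof -
    have "es ! i \<in> A" using nth_mem[OF that] es(2) by simp
    then have "fst (es ! i) \<noteq> snd (es ! i)" using no_loop[of "fst (es ! i)" "snd (es ! i)"] by auto
    then show ?thesis by (simp add: edge_price_def G_def add.commute)
  qed
  then have "gp_value G budget weight p = (\<Sum>i<length es. ?f (es ! i))"
    unfolding gp_value_def by (intro sum.cong) (auto simp: G_def weight_def budget_def case_prod_beta)
  also have "\<dots> = sum ?f A"
    using es sum.reindex_bij_betw[OF bij_betw_nth[OF es(1) refl refl], of ?f] by simp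
  finally show ?thesis .
qed

lemma finite_labelings: "finite ((\<lambda>lv. \<Sum>e\<in>gmd_satisfied D l lv. w e) ` (pverts D \<rightarrow>\<^sub>E {0..T}))"
  using finV by (intro finite_imageI finite_PiE) auto

text \<open>A vertex with a nonzero label is priced at the budget of its incoming arcs with this
  label, and label 0 means price 0. Then a satisfied arc sells exactly at its budget and earns its
  original weight.\<close>

lemma gmd_opt_le_gp_opt: "gmd_opt T D l w \<le> gp_opt G budget weight"
proof -
  have "gmd_opt T D l w \<in> (\<lambda>lv. \<Sum>e\<in>gmd_satisfied D l lv. w e) ` (pverts D \<rightarrow>\<^sub>E {0..T})"
    unfolding gmd_opt_def using finite_labelings by (intro Max_in) (auto simp: PiE_eq_empty_iff)
  then obtain lv where lv: "gmd_opt T D l w = (\<Sum>e\<in>gmd_satisfied D l lv. w e)" by auto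
  define p where "p v = (if lv v = 0 then 0 else 2 ^ (K * (lv v + T * rk v)) :: real)" for v
  have p: "p \<in> pricings G" by (auto simp: pricings_def p_def)
  have "gmd_opt T D l w = (\<Sum>e\<in>A. w e * of_bool (lv (fst e) = 0 \<and> lv (snd e) = l e))"
    unfolding lv using finA by (intro sum.mono_neutral_cong_left) (auto simp: gmd_satisfied_def)
  also have "\<dots> \<le> gp_value G budget weight p"
    unfolding gp_value_eq
  proof (rule sum_mono, clarify)
    fix u v assume e: "(u, v) \<in> A"
    show "w (u, v) * of_bool (lv (fst (u, v)) = 0 \<and> lv (snd (u, v)) = l (u, v)) \<le>
      w (u, v) / 2 ^ edge_exp (u, v) * (p u + p v) * of_bool (p u + p v \<le> 2 ^ edge_exp (u, v))"
    proof (cases "lv u = 0 \<and> lv v = l (u, v)")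
      case True
      then have "p u = 0" "p v = 2 ^ edge_exp (u, v)" using l_range[OF e] by (auto simp: p_def edge_exp_def)
      then show ?thesis using True by simp
    next
      case False
      have "0 \<le> p u" "0 \<le> p v" by (auto simp: p_def)
      then show ?thesis using False w_pos[OF e] by auto
    qed
  qed
  also have "\<dots> \<le> gp_opt G budget weight"
    using gp_opt_attained[OF gp_instance] p by metis
  finally show ?thesis .
qed

definition out_max :: "nat \<Rightarrow> real" where
  "out_max u = Max (insert 0 {w (u, v) | v. (u, v) \<in> A})"

lemma out_max: "0 \<le> out_max u" "(u, v) \<in> A \<Longrightarrow> w (u, v) \<le> out_max u"
proof -
  have "{w (u, v) | v. (u, v) \<in> A} \<subseteq> w ` A" by auto
  then have "finite {w (u, v) | v. (u, v) \<in> A}" using finA finite_subset by blast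
  then show "0 \<le> out_max u" "(u, v) \<in> A \<Longrightarrow> w (u, v) \<le> out_max u"
    unfolding out_max_def by (auto intro!: Max_ge)
qed

lemma sum_out_max: "(\<Sum>u\<in>pverts D. out_max u) \<le> \<epsilon>"
proof -
  let ?s = "\<Sum>u\<in>pverts D. out_max u"
  have "1 / \<epsilon> \<le> inverse ?s" using ndeg unfolding ndeg_def out_max_def by simp
  moreover have "?s \<ge> 0" by (intro sum_nonneg out_max)
  \<comment> \<open>Since \<open>inverse 0 = 0\<close>, a vanishing sum would contradict the
    positive lower bound.\<close>
  moreover have "?s \<noteq> 0" using calculation(1) eps by (auto simp: not_le)
  ultimately show ?thesis using eps by (simp add: field_simps)
qed

text \<open>A number in base \<open>T\<close> with last digit in \<open>1..T\<close> instead of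
  \<open>0..T-1\<close>. After subtracting 1, division by \<open>T\<close> recovers the rank, and
  the rank determines the head.\<close>

lemma edge_exp_eqD:
  assumes "(u, v) \<in> A" "(u, v') \<in> A" "l (u, v) + T * rk v = l (u, v') + T * rk v'"
  shows "v = v'"
proof -
  have div_T: "(a - 1 + T * r) div T = r" if "1 \<le> a" "a \<le> T" for a r :: nat
  proof -
    have "0 < T" "a - 1 < T" using that by linarith+
    then show ?thesis by simp
  qed
  have "(l (u, v) - 1 + T * rk v) div T = rk v" "(l (u, v') - 1 + T * rk v') div T = rk v'"
    using l_range[OF assms(1)] l_range[OF assms(2)] by (simp_all only: div_T)
  moreover have "l (u, v) - 1 + T * rk v = l (u, v') - 1 + T * rk v'"
    using assms(3) l_range[OF assms(1)] l_range[OF assms(2)] by linarith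
  ultimately have "rk v = rk v'" by metis
  then show ?thesis by (rule inj_onD[OF rk_inj]) (use assms in force)+
qed

text \<open>Dropping the price of the head and raising all weights at a tail to their maximum only
  increases the sum. What remains at a tail is a capped sum over distinct exponents; they are
  distinct because \<open>K > 0\<close>.\<close>

lemma tail_part:
  assumes "K > 0" "\<And>v. v \<in> pverts D \<Longrightarrow> p v \<ge> 0"
  shows "(\<Sum>(u, v)\<in>A. w (u, v) / 2 ^ edge_exp (u, v) * p u * of_bool (p u + p v \<le> 2 ^ edge_exp (u, v))) \<le> 2 * \<epsilon>"
proof -
  let ?out = "\<lambda>u. {v. (u, v) \<in> A}"
  let ?f = "\<lambda>(u, v). out_max u * (p u / 2 ^ edge_exp (u, v) * of_bool (p u \<le> 2 ^ edge_exp (u, v)))"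
  have fin: "finite (?out u)" for u
    using finite_subset[of "?out u" "snd ` A"] finA by force
  have "(\<Sum>(u, v)\<in>A. w (u, v) / 2 ^ edge_exp (u, v) * p u * of_bool (p u + p v \<le> 2 ^ edge_exp (u, v))) \<le> sum ?f A"
  proof (rule sum_mono, clarify)
    fix u v assume e: "(u, v) \<in> A"
    then have nn: "0 \<le> p u" "0 \<le> p v" using assms(2) endsV by auto
    have "w (u, v) / 2 ^ edge_exp (u, v) * p u * of_bool (p u + p v \<le> 2 ^ edge_exp (u, v)) \<le>
        w (u, v) / 2 ^ edge_exp (u, v) * p u * of_bool (p u \<le> 2 ^ edge_exp (u, v))"
      using nn w_pos[OF e] by (intro mult_left_mono) auto
    also have "\<dots> = w (u, v) * (p u / 2 ^ edge_exp (u, v) * of_bool (p u \<le> 2 ^ edge_exp (u, v)))" by simp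
    also have "\<dots> \<le> out_max u * (p u / 2 ^ edge_exp (u, v) * of_bool (p u \<le> 2 ^ edge_exp (u, v)))"
      using nn out_max(2)[OF e] by (intro mult_right_mono) auto
    finally show "w (u, v) / 2 ^ edge_exp (u, v) * p u * of_bool (p u + p v \<le> 2 ^ edge_exp (u, v)) \<le>
      out_max u * (p u / 2 ^ edge_exp (u, v) * of_bool (p u \<le> 2 ^ edge_exp (u, v)))" .
  qed
  also have "A = Sigma (pverts D) ?out" using endsV by auto
  then have "sum ?f A = (\<Sum>u\<in>pverts D. \<Sum>v\<in>?out u. ?f (u, v))"
    using finV fin by (simp add: sum.Sigma)
  also have "\<dots> \<le> (\<Sum>u\<in>pverts D. out_max u * 2)"
  proof (rule sum_mono)
    fix u assume u: "u \<in> pverts D"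
    have "inj_on (\<lambda>v. edge_exp (u, v)) (?out u)"
      using edge_exp_eqD assms(1) by (auto simp: inj_on_def edge_exp_def)
    then have "(\<Sum>v\<in>?out u. p u / 2 ^ edge_exp (u, v) * of_bool (p u \<le> 2 ^ edge_exp (u, v))) \<le> 2"
      using fin assms(2)[OF u] by (intro sum_capped_powers_le)
    then show "(\<Sum>v\<in>?out u. ?f (u, v)) \<le> out_max u * 2"
      using out_max(1)[of u] by (simp only: prod.case flip: sum_distrib_left) (rule mult_left_mono)
  qed
  also have "\<dots> \<le> 2 * \<epsilon>" using sum_out_max by (simp flip: sum_distrib_right)
  finally show ?thesis .
qed

text \<open>The labeling sends a vertex whose price lies in \<open>(2^(K (i - 1 + T r)), 2^(K (i + T r))]\<close>, where
  \<open>r\<close> is its rank, to \<open>i\<close>. An arc within its budget has a tail of label 0, because budgets at the head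
  are below the scale of the tail.\<close>

lemma head_part:
  assumes p: "\<And>v. v \<in> pverts D \<Longrightarrow> p v \<ge> 0"
  shows "(\<Sum>(u, v)\<in>A. w (u, v) / 2 ^ edge_exp (u, v) * p v * of_bool (p u + p v \<le> 2 ^ edge_exp (u, v)))
    \<le> gmd_opt T D l w + 1 / 2 ^ K"
proof -
  define thr :: "nat \<Rightarrow> nat \<Rightarrow> real" where "thr v i = 2 ^ (K * (i + T * rk v))" for v i
  \<comment> \<open>The alternative \<open>i = T\<close> makes the minimum exist and gives label
    \<open>T\<close> to prices above all thresholds. Ranks are constrained only at heads; all other
    vertices get label 0.\<close>
  define lv where "lv v = (if v \<in> snd ` A then LEAST i. i = T \<or> p v \<le> thr v i else 0)" for v
  have lv_le: "lv v \<le> T" for v unfolding lv_def by (auto intro: Least_le)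
  have lv_least: "lv v \<le> i" if "p v \<le> thr v i" for v i unfolding lv_def using that by (auto intro: Least_le)
  have lv_cases: "lv v = T \<or> p v \<le> thr v (lv v)" if "v \<in> snd ` A" for v
    unfolding lv_def using that LeastI[of "\<lambda>i. i = T \<or> p v \<le> thr v i" T] by auto
  have lv0: "lv v = 0" if "v \<notin> snd ` A" for v using that by (simp add: lv_def)
  let ?sat = "\<lambda>(u, v). lv u = 0 \<and> lv v = l (u, v)"
  have "(\<Sum>(u, v)\<in>A. w (u, v) / 2 ^ edge_exp (u, v) * p v * of_bool (p u + p v \<le> 2 ^ edge_exp (u, v)))
      \<le> (\<Sum>e\<in>A. w e * of_bool (?sat e) + w e * (1 / 2 ^ K))"
  proof (rule sum_mono, clarify)
    fix u v assume e: "(u, v) \<in> A"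
    let ?e = "(u, v)"
    have nn: "0 \<le> p u" "0 \<le> p v" using p endsV[OF e] by auto
    have v: "v \<in> snd ` A" using e by force
    show "w ?e / 2 ^ edge_exp ?e * p v * of_bool (p u + p v \<le> 2 ^ edge_exp ?e) \<le>
        w ?e * of_bool (lv u = 0 \<and> lv v = l ?e) + w ?e * (1 / 2 ^ K)"
    proof (cases "p u + p v \<le> 2 ^ edge_exp ?e")
      case True
      have thr: "2 ^ edge_exp ?e = thr v (l ?e)" by (simp add: edge_exp_def thr_def)
      have "lv u = 0"
      proof (cases "u \<in> snd ` A")
        case True
        then have "rk v < rk u" using rk_less e by auto
        \<comment> \<open>A label is at most \<open>T\<close> and so fits between the scales of two
          consecutive ranks.\<close>
        then have "T * Suc (rk v) \<le> T * rk u" by (intro mult_le_mono2) simp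
        then have "l ?e + T * rk v \<le> T * rk u" using l_range[OF e] by simp
        then have "thr v (l ?e) \<le> thr u 0" unfolding thr_def by (intro power_increasing mult_le_mono2) auto
        then have "p u \<le> thr u 0" using \<open>p u + p v \<le> 2 ^ edge_exp ?e\<close> nn unfolding thr by linarith
        then show ?thesis using lv_least[of u 0] by simp
      qed (rule lv0)
      have pv: "p v \<le> thr v (l ?e)" using True nn unfolding thr by linarith
      then have "lv v \<le> l ?e" by (rule lv_least)
      then consider "lv v = l ?e" | "lv v < l ?e" by linarith
      then have "p v / 2 ^ edge_exp ?e \<le> of_bool (lv u = 0 \<and> lv v = l ?e) + 1 / 2 ^ K"
      proof cases
        case 1
        have "0 < thr v (l ?e)" by (simp add: thr_def)
        then have "p v / 2 ^ edge_exp ?e \<le> 1" using pv by (simp add: thr)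
        then show ?thesis using 1 \<open>lv u = 0\<close> by (simp add: add_increasing2)
      next
        \<comment> \<open>The label is below \<open>T\<close>, so it was chosen for its threshold,
          which is at least a factor \<open>2 ^ K\<close> below the budget.\<close>
        case 2
        then have "p v \<le> thr v (lv v)" using lv_cases[OF v] l_range[OF e] by auto
        also have "\<dots> \<le> thr v (l ?e - 1)" unfolding thr_def using 2 by (intro power_increasing mult_le_mono2) auto
        finally have le: "p v \<le> thr v (l ?e - 1)" .
        have "l ?e + T * rk v = Suc (l ?e - 1 + T * rk v)" using 2 by linarith
        then have "edge_exp ?e = K * (l ?e - 1 + T * rk v) + K" by (simp only: edge_exp_def snd_conv mult_Suc_right add.commute)
        then have eq: "2 ^ edge_exp ?e = thr v (l ?e - 1) * 2 ^ K" unfolding thr_def by (simp only: power_add)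
        have "p v / 2 ^ edge_exp ?e \<le> thr v (l ?e - 1) / (thr v (l ?e - 1) * 2 ^ K)"
          unfolding eq by (rule divide_right_mono[OF le]) (simp add: thr_def)
        also have "\<dots> = 1 / 2 ^ K" by (simp add: thr_def)
        finally show ?thesis by (simp add: add_increasing)
      qed
      then have "w ?e * (p v / 2 ^ edge_exp ?e) \<le> w ?e * (of_bool (lv u = 0 \<and> lv v = l ?e) + 1 / 2 ^ K)"
        using w_pos[OF e] by (intro mult_left_mono) auto
      then show ?thesis using True by (simp add: algebra_simps)
    next
      case False
      then show ?thesis using w_pos[OF e] by simp
    qed
  qed
  \<comment> \<open>The weights sum to 1, so the rounding losses add up to
    \<open>1 / 2 ^ K\<close>.\<close>
  also have "\<dots> = (\<Sum>e\<in>A. w e * of_bool (?sat e)) + 1 / 2 ^ K"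
    by (simp add: sum.distrib w_sum flip: sum_divide_distrib)
  also have "(\<Sum>e\<in>A. w e * of_bool (?sat e)) = (\<Sum>e\<in>gmd_satisfied D l (restrict lv (pverts D)). w e)"
    using finA endsV by (intro sum.mono_neutral_cong_right) (auto simp: gmd_satisfied_def)
  also have "\<dots> \<le> gmd_opt T D l w"
    unfolding gmd_opt_def using lv_le by (intro Max_ge[OF finite_labelings]) auto
  finally show ?thesis by simp
qed

text \<open>The revenue of an edge splits into the prices of its two ends. The tails contribute at
  most \<open>2 * \<epsilon>\<close>, and the rounding at the heads at most
  \<open>1 / 2 ^ K \<le> \<epsilon>\<close>.\<close>

lemma gp_opt_le:
  assumes "K > 0"
  shows "gp_opt G budget weight \<le> gmd_opt T D l w + 3 * \<epsilon>"
proof -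
  obtain p where p: "p \<in> pricings G" "gp_value G budget weight p = gp_opt G budget weight"
    using gp_opt_attained[OF gp_instance] by blast
  then have nn: "\<And>v. v \<in> pverts D \<Longrightarrow> p v \<ge> 0" by (simp add: pricings_def G_def)
  have "gp_opt G budget weight =
      (\<Sum>(u, v)\<in>A. w (u, v) / 2 ^ edge_exp (u, v) * p u * of_bool (p u + p v \<le> 2 ^ edge_exp (u, v))) +
      (\<Sum>(u, v)\<in>A. w (u, v) / 2 ^ edge_exp (u, v) * p v * of_bool (p u + p v \<le> 2 ^ edge_exp (u, v)))"
    unfolding p(2)[symmetric] gp_value_eq sum.distrib[symmetric]
    by (intro sum.cong) (auto simp: algebra_simps add_divide_distrib)
  also have "\<dots> \<le> 2 * \<epsilon> + (gmd_opt T D l w + 1 / 2 ^ K)"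
    using tail_part[OF assms nn] head_part[OF nn] by (intro add_mono) auto
  also have "1 / 2 ^ K \<le> \<epsilon>" using K eps by (simp add: field_simps)
  finally show ?thesis by simp
qed

end

section \<open>Correctness of the schedule\<close>

abbreviation arc_ends :: "arc list \<Rightarrow> (bool list \<times> bool list) set" where
  "arc_ends es \<equiv> (\<lambda>e. (arc_tail e, arc_head e)) ` set es"

lemma walk_rtrancl: "arc_ends fs \<subseteq> E \<Longrightarrow> (h, walk h fs) \<in> E\<^sup>*"
proof (induction fs arbitrary: h)
  case (Cons f fs)
  have "(h, if arc_tail f = h then arc_head f else h) \<in> E\<^sup>*" using Cons.prems by auto
  also have "(if arc_tail f = h then arc_head f else h, walk h (f # fs)) \<in> E\<^sup>*"
    using Cons by (simp add: walk_def)
  finally show ?case .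
qed (simp add: walk_def)

text \<open>A pass that begins in a tail follows at least one arc, namely the first listed arc out
  of this vertex.\<close>

lemma walk_trancl:
  "arc_ends fs \<subseteq> E \<Longrightarrow> h \<in> arc_tail ` set fs \<Longrightarrow> (h, walk h fs) \<in> E\<^sup>+"
proof (induction fs)
  case (Cons f fs)
  show ?case
  proof (cases "arc_tail f = h")
    case True
    then have "(h, arc_head f) \<in> E" using Cons.prems by auto
    moreover have "(arc_head f, walk (arc_head f) fs) \<in> E\<^sup>*"
      using Cons.prems by (intro walk_rtrancl) auto
    ultimately show ?thesis using True by (simp add: walk_def)
  next
    case False
    then show ?thesis using Cons by (auto simp: walk_def)
  qed
qed simp

lemma walk_not_tail: "h \<notin> arc_tail ` set fs \<Longrightarrow> walk h fs = h"
  by (induction fs) (auto simp: walk_def)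

text \<open>Each pass strictly decreases the number of tails that are reachable from the current vertex.\<close>

lemma iterated_walk_sink:
  assumes acyc: "acyclic (arc_ends es)" and m: "length es \<le> m"
  shows "((\<lambda>h. walk h es) ^^ m) h \<notin> arc_tail ` set es"
proof -
  let ?E = "arc_ends es"
  let ?next = "\<lambda>h. walk h es"
  \<comment> \<open>Counting only tails bounds this potential by the number of arcs, hence by the
    clock.\<close>
  define reach where "reach h = {t \<in> arc_tail ` set es. (h, t) \<in> ?E\<^sup>*}" for h
  have fin: "finite (reach h)" for h unfolding reach_def by simp
  have less: "card (reach (?next h)) < card (reach h)" if h: "h \<in> arc_tail ` set es" for h
  proof (rule psubset_card_mono[OF fin])
    have step: "(h, ?next h) \<in> ?E\<^sup>+" using h by (intro walk_trancl) auto
    have "h \<notin> reach (?next h)"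
      using trancl_rtrancl_trancl[OF step, of h] acyc unfolding reach_def acyclic_def by blast
    moreover have "h \<in> reach h" using h unfolding reach_def by simp
    moreover have "reach (?next h) \<subseteq> reach h"
      using rtrancl_trans[OF trancl_into_rtrancl[OF step]] unfolding reach_def by blast
    ultimately show "reach (?next h) \<subset> reach h" by blast
  qed
  \<comment> \<open>A walk that has reached a vertex without outgoing arcs stays there, so the first
    alternative persists.\<close>
  have "(?next ^^ k) h \<notin> arc_tail ` set es \<or> card (reach ((?next ^^ k) h)) + k \<le> card (reach h)" for k
  proof (induction k)
    case (Suc k)
    show ?case
    proof (cases "(?next ^^ k) h \<in> arc_tail ` set es")
      case True
      then show ?thesis using Suc less[OF True] by simp
    next
      case False
      then show ?thesis using walk_not_tail[OF False] by simp
    qed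
  qed simp
  from this[of m] show ?thesis
  proof
    assume le: "card (reach ((?next ^^ m) h)) + m \<le> card (reach h)"
    have "card (reach h) \<le> card (arc_tail ` set es)" unfolding reach_def by (intro card_mono) auto
    also have "\<dots> \<le> m" using m card_image_le[of "set es" arc_tail] card_length[of es] by simp
    finally have "card (reach ((?next ^^ m) h)) = 0" using le by linarith
    then have "reach ((?next ^^ m) h) = {}" using fin by simp
    then show ?thesis unfolding reach_def by auto
  qed
qed

text \<open>The rank of a head is the round that emits its incoming arcs. At that time the head is a
  sink among the remaining arcs, so its outgoing arcs were emitted in earlier rounds and their heads
  have smaller ranks.\<close>

lemma schedule_ranks:
  assumes "acyclic (arc_ends es)" "length es \<le> m" "distinct es"
  shows "\<exists>r. distinct (schedule m es c) \<and>
    set (schedule m es c) = (\<lambda>e. (e, r (arc_head e))) ` set es \<and>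
    (\<forall>h\<in>arc_head ` set es. c \<le> r h) \<and> inj_on r (arc_head ` set es) \<and>
    (\<forall>e\<in>set es. \<forall>f\<in>set es. arc_head f = arc_tail e \<longrightarrow> r (arc_head e) < r (arc_head f))"
  using assms
proof (induction m es c rule: schedule.induct)
  case (2 m e0 es c)
  define as where "as = e0 # es"
  define h where "h = ((\<lambda>h. walk h as) ^^ m) (arc_head e0)"
  define now where "now = filter (\<lambda>f. arc_head f = h) as"
  define later where "later = filter (\<lambda>f. arc_head f \<noteq> h) as"
  have sch: "schedule m as c = map (\<lambda>f. (f, c)) now @ schedule m later (Suc c)"
    unfolding as_def now_def later_def h_def by (simp only: schedule.simps Let_def)
  have prems: "acyclic (arc_ends as)" "length as \<le> m" "distinct as" using 2(2-4) unfolding as_def .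
  have "acyclic (arc_ends later)"
    by (rule acyclic_subset[OF prems(1)]) (auto simp: later_def)
  moreover have "length later \<le> m"
    using prems(2) length_filter_le[of _ as] unfolding later_def by (rule order_trans[rotated])
  moreover have "distinct later" using prems(3) unfolding later_def by simp
  ultimately obtain r where r: "distinct (schedule m later (Suc c))"
    "set (schedule m later (Suc c)) = (\<lambda>e. (e, r (arc_head e))) ` set later"
    "\<forall>h\<in>arc_head ` set later. Suc c \<le> r h" "inj_on r (arc_head ` set later)"
    "\<forall>e\<in>set later. \<forall>f\<in>set later. arc_head f = arc_tail e \<longrightarrow> r (arc_head e) < r (arc_head f)"
    using 2(1)[OF refl, folded as_def, folded h_def, folded later_def] by blast
  have sink: "h \<notin> arc_tail ` set as"
    unfolding h_def using prems by (intro iterated_walk_sink)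
  have now: "set now = {f \<in> set as. arc_head f = h}" and later: "set later = {f \<in> set as. arc_head f \<noteq> h}"
    unfolding now_def later_def by auto
  \<comment> \<open>Later rounds count from \<open>Suc c\<close>, so the value \<open>c\<close> is
    new and smaller than all others.\<close>
  define r' where "r' = r(h := c)"
  have r'_later: "r' (arc_head e) = r (arc_head e)" if "e \<in> set later" for e
    using that later by (auto simp: r'_def)
  have "distinct (schedule m as c)"
  proof -
    have "distinct (map (\<lambda>f. (f, c)) now)"
      using prems(3) unfolding now_def by (auto simp: distinct_map inj_on_def)
    moreover have "set (map (\<lambda>f. (f, c)) now) \<inter> set (schedule m later (Suc c)) = {}"
      using r(2) now later by auto
    ultimately show ?thesis unfolding sch using r(1) by simp
  qed
  moreover have "set (schedule m as c) = (\<lambda>e. (e, r' (arc_head e))) ` set as"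
  proof -
    have "set as = set now \<union> set later" using now later by auto
    moreover have "(\<lambda>f. (f, c)) ` set now = (\<lambda>e. (e, r' (arc_head e))) ` set now"
      using now by (intro image_cong) (auto simp: r'_def)
    moreover have "(\<lambda>e. (e, r (arc_head e))) ` set later = (\<lambda>e. (e, r' (arc_head e))) ` set later"
      using r'_later by (intro image_cong) auto
    ultimately show ?thesis unfolding sch set_append r(2) set_map by (simp add: image_Un)
  qed
  moreover
  have ge: "Suc c \<le> r' (arc_head e)" if "e \<in> set as" "arc_head e \<noteq> h" for e
  proof -
    have "e \<in> set later" using that later by simp
    then have "Suc c \<le> r (arc_head e)" using r(3) by blast
    then show ?thesis using that(2) by (simp add: r'_def)
  qed
  have "\<forall>h\<in>arc_head ` set as. c \<le> r' h"
  proof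
    fix x assume "x \<in> arc_head ` set as"
    then show "c \<le> r' x" using ge by (cases "x = h") (auto simp: r'_def Suc_le_eq less_imp_le)
  qed
  moreover have "inj_on r' (arc_head ` set as)"
  proof (rule inj_onI)
    fix x y assume xy: "x \<in> arc_head ` set as" "y \<in> arc_head ` set as" "r' x = r' y"
    have c: "r' h = c" by (simp add: r'_def)
    show "x = y"
    proof (cases "x = h \<or> y = h")
      case True
      then show ?thesis using xy ge c by fastforce
    next
      case False
      then have "x \<in> arc_head ` set later" "y \<in> arc_head ` set later" "r x = r y"
        using xy later by (auto simp: r'_def)
      then show ?thesis using r(4) by (auto dest: inj_onD)
    qed
  qed
  moreover have "r' (arc_head e) < r' (arc_head f)"
    if "e \<in> set as" "f \<in> set as" "arc_head f = arc_tail e" for e f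
  proof -
    \<comment> \<open>The head of \<open>f\<close> is the tail of \<open>e\<close>, whereas the sink
      \<open>h\<close> is no tail; so \<open>f\<close> does not enter \<open>h\<close>.\<close>
    have f: "f \<in> set later" using that sink later by auto
    show ?thesis
    proof (cases "arc_head e = h")
      case True
      then show ?thesis using ge[of f] f later by (simp add: r'_def)
    next
      case False
      then have "e \<in> set later" using that later by auto
      then show ?thesis using f r(5) that r'_later by metis
    qed
  qed
  ultimately show ?case unfolding as_def[symmetric] by blast
qed simp

section \<open>Binary encodings\<close>

lemma binary_double: "n > 0 \<Longrightarrow> binary (2 * n) = False # binary n"
  by (subst binary.simps) simp

lemma binary_mult_power: "n > 0 \<Longrightarrow> binary (n * 2 ^ k) = replicate k False @ binary n"
proof (induction k)
  case (Suc k)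
  have "binary (n * 2 ^ Suc k) = binary (2 * (n * 2 ^ k))" by (simp add: algebra_simps)
  then show ?case using Suc by (simp add: binary_double)
qed simp

lemma binary_1: "binary 1 = [True]"
  by (simp add: binary.simps)

lemma inj_binary: "inj binary"
proof (rule injI)
  show "binary m = binary n \<Longrightarrow> m = n" for m n
  proof (induction m arbitrary: n rule: less_induct)
    case (less m)
    show ?case
    proof (cases "m = 0 \<or> n = 0")
      case True
      then show ?thesis using less.prems by (auto simp: binary.simps split: if_splits)
    next
      case False
      then have "odd m = odd n" "binary (m div 2) = binary (n div 2)"
        using less.prems binary.simps[of m] binary.simps[of n] by auto
      moreover from this(2) have "m div 2 = n div 2" using less.IH False by simp
      ultimately show ?thesis by (metis dvd_mult_div_cancel odd_two_times_div_two_succ)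
    qed
  qed
qed

lemma label_value_binary: "n < 2 ^ k \<Longrightarrow> label_value k w (binary n) = w * n"
proof (induction k arbitrary: n w)
  case (Suc k)
  show ?case
  proof (cases "n = 0")
    case True
    then show ?thesis by (simp add: binary.simps)
  next
    case False
    have "n div 2 < 2 ^ k" using Suc.prems by auto
    then have "label_value (Suc k) w (binary n) = (if odd n then w else 0) + 2 * w * (n div 2)"
      using False Suc.IH by (subst binary.simps) simp
    also have "(if odd n then w else 0) = w * (n mod 2)"
      by (simp add: odd_iff_mod_2_eq_one)
    also have "w * (n mod 2) + 2 * w * (n div 2) = w * (n mod 2 + 2 * (n div 2))"
      by (simp only: distrib_left mult.assoc mult.left_commute)
    finally show ?thesis by simp
  qed
qed simp

lemma enc_nat_eq: "enc_nat n = code (binary n)"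
  by (simp add: enc_nat_def code_def)

lemma enc_nat_mult_power: "n > 0 \<Longrightarrow> enc_nat (n * 2 ^ k) = pad k @ enc_nat n"
  by (simp add: enc_nat_eq binary_mult_power code_replicate_False)


lemma enc_list_map: "enc_list enc (map g xs) = enc_list (\<lambda>x. enc (g x)) xs"
  by (simp add: enc_list_def o_def)

definition arc_of :: "(nat \<times> nat \<Rightarrow> nat) \<Rightarrow> (nat \<times> nat \<Rightarrow> nat \<times> nat) \<Rightarrow> nat \<times> nat \<Rightarrow> arc" where
  "arc_of l wq e = (binary (fst e), binary (snd e), binary (l e), binary (fst (wq e)), binary (snd (wq e)))"

lemma inj_arc_of: "inj (arc_of l wq)"
  using inj_binary by (auto simp: inj_def arc_of_def)

lemma reduction_eq:
  assumes "x = enc_list enc_nat vs @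
    enc_list (\<lambda>e. enc_nat (fst e) @ enc_nat (snd e) @ enc_nat (l e) @ enc_frac (wq e)) as"
  shows "reduction T K x = enc_list enc_nat vs @
    concat (map (\<lambda>(f, c). edge_code f (exponent T K f (K * T * c)))
      (schedule (length as) (map (arc_of l wq) as) 0)) @ [False]"
proof -
  define y where "y = enc_list (\<lambda>e. enc_nat (fst e) @ enc_nat (snd e) @ enc_nat (l e) @ enc_frac (wq e)) as"
  define enc_arc where "enc_arc = (\<lambda>(u, v, l, n, d). code u @ code v @ code l @ code n @ code d)"
  have vs: "enc_list enc_nat vs = enc_list code (map binary vs)"
    by (simp add: enc_list_map enc_nat_eq[abs_def])
  have 1: "decode_list decode_bits x = (map binary vs, y)"
    unfolding assms vs y_def[symmetric] by (rule decode_list_enc_list) (rule decode_bits_code)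
  have "y = enc_list enc_arc (map (arc_of l wq) as) @ []"
    by (simp add: y_def enc_list_map enc_arc_def arc_of_def enc_nat_eq enc_frac_def)
  also have "decode_list decode_arc \<dots> = (map (arc_of l wq) as, [])"
    by (rule decode_list_enc_list)
      (auto simp: enc_arc_def decode_arc_def decode_bits_code)
  finally show ?thesis using 1 unfolding reduction_def by (simp add: vs)
qed

text \<open>For a finite relation acyclicity amounts to well-foundedness, which passes to the image
  under an injective map.\<close>

lemma acyclic_map_prod:
  assumes "finite R" "acyclic R" "inj g"
  shows "acyclic (map_prod g g ` R)"
  using wf_map_prod_image[OF finite_acyclic_wf[OF assms(1,2)] assms(3)] by (rule wf_acyclic)

context ranked_gmd begin

lemma edge_code_eq:
  assumes "e \<in> parcs D" "snd (wq e) > 0"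
  shows "edge_code (arc_of l wq e) (exponent T K (arc_of l wq e) (K * T * rk (snd e))) =
    True # enc_nat (snd e) @ enc_nat (fst e) @ enc_frac (2 ^ edge_exp e, 1) @
      enc_frac (fst (wq e), snd (wq e) * 2 ^ edge_exp e)"
proof -
  \<comment> \<open>Labels are at most \<open>T < 2 ^ T\<close>, so the \<open>T\<close> digits that
    are read determine them.\<close>
  have "l e < 2 ^ T" using l_range[OF assms(1)] less_exp[of T] by linarith
  then have "label_value T K (binary (l e)) = K * l e" by (rule label_value_binary)
  then have "exponent T K (arc_of l wq e) (K * T * rk (snd e)) = edge_exp e"
    by (simp add: exponent_def arc_of_def edge_exp_def algebra_simps)
  moreover have "enc_nat (2 ^ edge_exp e) = pad (edge_exp e) @ code [True]"
    using enc_nat_mult_power[of 1 "edge_exp e"] by (simp add: enc_nat_eq binary_1[simplified])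
  ultimately show ?thesis using assms(2)
    by (simp add: edge_code_def arc_of_def enc_frac_def enc_nat_mult_power enc_nat_eq[of "snd e"]
        enc_nat_eq[of "fst e"] enc_nat_eq[of "fst (wq e)"] enc_nat_eq[of "snd (wq e)"] enc_nat_eq[of "Suc 0"]
        binary_1[simplified])
qed

lemma encodes_gp_reduction:
  assumes x: "x = enc_list enc_nat vs @
      enc_list (\<lambda>e. enc_nat (fst e) @ enc_nat (snd e) @ enc_nat (l e) @ enc_frac (wq e)) as"
    and vs: "distinct vs" "set vs = pverts D"
    and wq: "\<And>e. e \<in> parcs D \<Longrightarrow> fraction (wq e) (w e)"
    and sch: "schedule (length as) (map (arc_of l wq) as) 0 = map (\<lambda>e. (arc_of l wq e, rk (snd e))) es"
  shows "encodes_gp (reduction T K x) G budget weight"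
proof -
  let ?enc = "\<lambda>i. enc_nat (snd (es ! i)) @ enc_nat (fst (es ! i)) @ enc_frac (2 ^ edge_exp (es ! i), 1) @
      enc_frac (fst (wq (es ! i)), snd (wq (es ! i)) * 2 ^ edge_exp (es ! i))"
  have wq_pos: "snd (wq e) > 0" if "e \<in> parcs D" for e using wq[OF that] by (simp add: fraction_def)
  have "map (\<lambda>(f, c). edge_code f (exponent T K f (K * T * c))) (map (\<lambda>e. (arc_of l wq e, rk (snd e))) es)
      = map (\<lambda>e. True # enc_nat (snd e) @ enc_nat (fst e) @ enc_frac (2 ^ edge_exp e, 1) @
          enc_frac (fst (wq e), snd (wq e) * 2 ^ edge_exp e)) es"
    using wq_pos es(2) by (simp add: edge_code_eq)
  also have "\<dots> = map (\<lambda>i. True # ?enc i) [0..<length es]"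
    by (rule nth_equalityI) simp_all
  finally have eq: "reduction T K x = enc_list enc_nat vs @ enc_list ?enc [0..<length es]"
    unfolding reduction_eq[OF x] sch by (simp only: enc_list_def append_assoc)
  have frac: "fraction (2 ^ edge_exp (es ! i), 1) (budget i)"
    "fraction (fst (wq (es ! i)), snd (wq (es ! i)) * 2 ^ edge_exp (es ! i)) (weight i)" if "i < length es" for i
  proof -
    have "es ! i \<in> parcs D" using nth_mem[OF that] es(2) by simp
    then show "fraction (2 ^ edge_exp (es ! i), 1) (budget i)"
      "fraction (fst (wq (es ! i)), snd (wq (es ! i)) * 2 ^ edge_exp (es ! i)) (weight i)"
      using wq[of "es ! i"] by (simp_all add: fraction_def budget_def weight_def)
  qed
  show ?thesis unfolding encodes_gp_def eq
    by (rule exI[of _ vs], rule exI[of _ "[0..<length es]"], rule exI[of _ "\<lambda>i. snd (es ! i)"],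
      rule exI[of _ "\<lambda>i. fst (es ! i)"], rule exI[of _ "\<lambda>i. (2 ^ edge_exp (es ! i), 1)"],
      rule exI[of _ "\<lambda>i. (fst (wq (es ! i)), snd (wq (es ! i)) * 2 ^ edge_exp (es ! i))"])
      (use vs frac in \<open>auto simp: G_def\<close>)
qed

end

lemma reduction_correct:
  assumes inst: "gmd_instance T D l w" and acyc: "acyclic (parcs D)"
    and ndeg: "ndeg D w \<ge> 1 / \<epsilon>" and eps: "\<epsilon> > 0" and enc: "encodes_gmd x D l w"
    and K: "K > 0" "1 / \<epsilon> \<le> 2 ^ K"
  shows "\<exists>(G :: (nat, nat) multigraph) b w'. gp_instance G b w' \<and> encodes_gp (reduction T K x) G b w' \<and>
    gmd_opt T D l w \<le> gp_opt G b w' \<and> gp_opt G b w' \<le> gmd_opt T D l w + 3 * \<epsilon>"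
proof -
  obtain vs as wq where vs: "distinct vs" "set vs = pverts D" and as: "distinct as" "set as = parcs D"
    and wq: "\<forall>e\<in>parcs D. fraction (wq e) (w e)"
    and x: "x = enc_list enc_nat vs @
      enc_list (\<lambda>e. enc_nat (fst e) @ enc_nat (snd e) @ enc_nat (l e) @ enc_frac (wq e)) as"
    using enc unfolding encodes_gmd_def by blast
  let ?arc = "arc_of l wq"
  have ends: "arc_ends (map ?arc as) = map_prod binary binary ` parcs D"
    by (simp add: as(2)[symmetric] image_image arc_of_def map_prod_def case_prod_beta)
  have "finite (parcs D)" using as(2) by (metis List.finite_set)
  then have "acyclic (arc_ends (map ?arc as))"
    unfolding ends by (rule acyclic_map_prod) (use acyc inj_binary in auto)
  moreover have "distinct (map ?arc as)"
    using as(1) inj_on_subset[OF inj_arc_of subset_UNIV] by (simp add: distinct_map)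
  ultimately obtain r where r: "distinct (schedule (length as) (map ?arc as) 0)"
    "set (schedule (length as) (map ?arc as) 0) = (\<lambda>f. (f, r (arc_head f))) ` set (map ?arc as)"
    "inj_on r (arc_head ` set (map ?arc as))"
    "\<forall>e\<in>set (map ?arc as). \<forall>f\<in>set (map ?arc as). arc_head f = arc_tail e \<longrightarrow> r (arc_head e) < r (arc_head f)"
    using schedule_ranks[of "map ?arc as" "length as" 0] by auto
  define rk where "rk v = r (binary v)" for v
  let ?g = "\<lambda>e. (?arc e, rk (snd e))"
  have set_sch: "set (schedule (length as) (map ?arc as) 0) = ?g ` parcs D"
    unfolding r(2) by (auto simp: as(2) image_image rk_def arc_of_def)
  \<comment> \<open>All scheduled pairs are values of \<open>?g\<close>, so the schedule is the
    image of a list of arcs: the original arcs in the order of emission.\<close>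
  then obtain es where sch: "schedule (length as) (map ?arc as) 0 = map ?g es"
    using ex_map_conv[of "schedule (length as) (map ?arc as) 0" ?g] by blast
  have inj_g: "inj ?g" using inj_arc_of by (auto simp: inj_def)
  have heads: "arc_head ` set (map ?arc as) = binary ` snd ` parcs D"
    by (auto simp: as(2) image_image arc_of_def)
  interpret ranked_gmd T D l w \<epsilon> es rk K
  proof
    show "distinct es" using r(1) unfolding sch by (simp add: distinct_map)
    show "set es = parcs D"
      using set_sch unfolding sch by (simp add: inj_image_eq_iff[OF inj_g])
    show "u \<noteq> v" if "(u, v) \<in> parcs D" for u v using acyc that by (auto simp: acyclic_def)
    have "inj_on (r \<circ> binary) (snd ` parcs D)"
      using r(3) unfolding heads by (rule comp_inj_on[OF inj_on_subset[OF inj_binary subset_UNIV]])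
    then show "inj_on rk (snd ` parcs D)" by (simp add: rk_def[abs_def] o_def)
    show "rk v < rk u" if "(t, u) \<in> parcs D" "(u, v) \<in> parcs D" for t u v
    proof -
      have mem: "?arc (t, u) \<in> set (map ?arc as)" "?arc (u, v) \<in> set (map ?arc as)"
        using that as(2) by simp_all
      have "r (arc_head (?arc (u, v))) < r (arc_head (?arc (t, u)))"
        by (rule r(4)[rule_format, OF mem(2,1)]) (simp add: arc_of_def)
      then show ?thesis by (simp add: rk_def arc_of_def)
    qed
  qed (use inst ndeg eps K in auto)
  have "encodes_gp (reduction T K x) G budget weight"
    by (rule encodes_gp_reduction[OF x vs _ sch]) (use wq in blast)
  then show ?thesis using gp_instance gmd_opt_le_gp_opt gp_opt_le[OF assms(6)] by blast
qed

theorem theorem5: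
  fixes T :: nat and \<epsilon> :: real
  assumes "T \<ge> 1" and "\<epsilon> > 0"
  shows "\<exists>f. polytime f \<and>
    (\<forall>(D :: nat pair_pre_digraph) l w s.
       gmd_instance T D l w \<and> acyclic (parcs D) \<and> ndeg D w \<ge> 1 / \<epsilon> \<and> encodes_gmd s D l w \<longrightarrow>
       (\<exists>(G :: (nat, nat) multigraph) b w'.
          gp_instance G b w' \<and> encodes_gp (f s) G b w' \<and>
          gmd_opt T D l w \<le> gp_opt G b w' \<and>
          gp_opt G b w' \<le> gmd_opt T D l w + 3 * \<epsilon>))"
proof -
  obtain k where "1 / \<epsilon> < 2 ^ k" using real_arch_pow[of 2 "1 / \<epsilon>"] by auto
  \<comment> \<open>Passing to \<open>Suc k\<close> makes the exponent positive, as the bound on the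
    tails requires.\<close>
  also have "(2 :: real) ^ k \<le> 2 ^ Suc k" by simp
  finally have K: "1 / \<epsilon> \<le> 2 ^ Suc k" by simp
  show ?thesis
    using polytime_reduction reduction_correct[OF _ _ _ assms(2) _ _ K] by blast
qed

end
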